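(* Let $\mathcal{A}:=\prod_{k\ge 5}\mathbb{A}_k$ be the profinite group which is the direct product of all alternating groups $\mathbb{A}_k$ with $k\ge5$. For every $n\ge 2$ the profinite group $\mathcal{A}$ admits a generating set $A$ of size $n$ with respect to which the Cayley graph $\Gamma(\mathcal{A})$ is tree-like.
   Context: A generating set of a profinite group is a subset generating a dense (abstract) subgroup. A graph (in the sense of Serre) has a vertex set and an edge set with initial/terminal vertex maps and an edge inversion $e\mapsto e^{-1}$ exchanging positive and negative edges; subgraphs are closed under endpoints and inversion. A profinite graph is a projective limit of finite discrete graphs; a subgraph of a profinite graph is required to be topologically closed. A profinite graph is connected if all its finite continuous quotient graphs are connected as abstract graphs. A connected profinite graph $\Gamma$ is tree-like if for every pair $\{u,v\}$ of vertices the intersection of all connected subgraphs of $\Gamma$ containing $\{u,v\}$ is connected. The Cayley graph $\Gamma(\mathcal G)$ of a profinite group $\mathcal G$ with respect to a finite generating set $A$ is the profinite graph with vertex set $\mathcal G$ and edge set $\mathcal G\times\widetilde A$, where $\widetilde A=A\cup A^{-1}$ with $A^{-1}$ a disjoint set of formal inverses; the edge $(g,a)$ goes from $g$ to $ga$ and has inverse $(ga,a^{-1})$; edges with label in $A$ are positive. *)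

theory Defs
  imports "HOL-Analysis.Analysis" "HOL-Algebra.Product_Groups" "HOL-Algebra.Sym_Groups"
begin

section \<open>Graphs in the sense of Serre\<close>

record ('v, 'e) sgraph =
  verts :: "'v set"
  edges :: "'e set"
  pos_edges :: "'e set"
  ini :: "'e \<Rightarrow> 'v"
  ter :: "'e \<Rightarrow> 'v"
  einv :: "'e \<Rightarrow> 'e"

definition serre_graph :: "('v, 'e, 'm) sgraph_scheme \<Rightarrow> bool" where
  "serre_graph \<Gamma> \<longleftrightarrow>
     pos_edges \<Gamma> \<subseteq> edges \<Gamma> \<and>
     (\<forall>e\<in>edges \<Gamma>.
        ini \<Gamma> e \<in> verts \<Gamma> \<and> ter \<Gamma> e \<in> verts \<Gamma> \<and>
        einv \<Gamma> e \<in> edges \<Gamma> \<and> einv \<Gamma> (einv \<Gamma> e) = e \<and>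
        ini \<Gamma> (einv \<Gamma> e) = ter \<Gamma> e \<and> ter \<Gamma> (einv \<Gamma> e) = ini \<Gamma> e \<and>
        (einv \<Gamma> e \<in> pos_edges \<Gamma> \<longleftrightarrow> e \<notin> pos_edges \<Gamma>))"

definition finite_graph :: "('v, 'e, 'm) sgraph_scheme \<Rightarrow> bool" where
  "finite_graph \<Gamma> \<longleftrightarrow> serre_graph \<Gamma> \<and> finite (verts \<Gamma>) \<and> finite (edges \<Gamma>)"

text \<open>Edges are closed under inversion, so directed paths are all paths.\<close>

definition abstractly_connected :: "('v, 'e, 'm) sgraph_scheme \<Rightarrow> bool" where
  "abstractly_connected \<Gamma> \<longleftrightarrow>
     (\<forall>u\<in>verts \<Gamma>. \<forall>v\<in>verts \<Gamma>. (u, v) \<in> {(ini \<Gamma> e, ter \<Gamma> e) | e. e \<in> edges \<Gamma>}\<^sup>*)"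

text \<open>A morphism is a pair of a vertex map and an edge map. Preservation of positive edges, together
  with compatibility with inversion, also gives preservation of negative edges.\<close>

definition graph_hom ::
  "('v, 'e, 'm) sgraph_scheme \<Rightarrow> ('w, 'f, 'n) sgraph_scheme \<Rightarrow> ('v \<Rightarrow> 'w) \<Rightarrow> ('e \<Rightarrow> 'f) \<Rightarrow> bool" where
  "graph_hom \<Gamma> \<Delta> f g \<longleftrightarrow>
     f \<in> verts \<Gamma> \<rightarrow> verts \<Delta> \<and> g \<in> edges \<Gamma> \<rightarrow> edges \<Delta> \<and> g \<in> pos_edges \<Gamma> \<rightarrow> pos_edges \<Delta> \<and>
     (\<forall>e\<in>edges \<Gamma>. ini \<Delta> (g e) = f (ini \<Gamma> e) \<and> ter \<Delta> (g e) = f (ter \<Gamma> e) \<and>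
                   einv \<Delta> (g e) = g (einv \<Gamma> e))"


section \<open>Topological and profinite graphs\<close>

record ('v, 'e) top_graph = "('v, 'e) sgraph" +
  vtop :: "'v topology"
  etop :: "'e topology"

definition topological_graph :: "('v, 'e) top_graph \<Rightarrow> bool" where
  "topological_graph \<Gamma> \<longleftrightarrow>
     serre_graph \<Gamma> \<and> topspace (vtop \<Gamma>) = verts \<Gamma> \<and> topspace (etop \<Gamma>) = edges \<Gamma> \<and>
     continuous_map (etop \<Gamma>) (vtop \<Gamma>) (ini \<Gamma>) \<and>
     continuous_map (etop \<Gamma>) (vtop \<Gamma>) (ter \<Gamma>) \<and>
     continuous_map (etop \<Gamma>) (etop \<Gamma>) (einv \<Gamma>)"

definition top_graph_iso ::
  "('v, 'e) top_graph \<Rightarrow> ('w, 'f) top_graph \<Rightarrow> ('v \<Rightarrow> 'w) \<Rightarrow> ('e \<Rightarrow> 'f) \<Rightarrow> bool" where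
  "top_graph_iso \<Gamma> \<Delta> f g \<longleftrightarrow>
     graph_hom \<Gamma> \<Delta> f g \<and>
     homeomorphic_map (vtop \<Gamma>) (vtop \<Delta>) f \<and> homeomorphic_map (etop \<Gamma>) (etop \<Delta>) g"

text \<open>An inverse system of finite graphs over the directed set \<open>I\<close> with (pre)order \<open>R\<close>;
  for \<open>R i j\<close> the connecting morphism \<open>(p i j, q i j)\<close> goes from \<open>D j\<close> to \<open>D i\<close>.\<close>

definition inverse_system ::
  "'i set \<Rightarrow> ('i \<Rightarrow> 'i \<Rightarrow> bool) \<Rightarrow> ('i \<Rightarrow> ('v, 'e) sgraph)
    \<Rightarrow> ('i \<Rightarrow> 'i \<Rightarrow> 'v \<Rightarrow> 'v) \<Rightarrow> ('i \<Rightarrow> 'i \<Rightarrow> 'e \<Rightarrow> 'e) \<Rightarrow> bool" where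
  "inverse_system I R D p q \<longleftrightarrow>
     I \<noteq> {} \<and>
     (\<forall>i\<in>I. R i i) \<and>
     (\<forall>i\<in>I. \<forall>j\<in>I. \<forall>k\<in>I. R i j \<longrightarrow> R j k \<longrightarrow> R i k) \<and>
     (\<forall>i\<in>I. \<forall>j\<in>I. \<exists>k\<in>I. R i k \<and> R j k) \<and>
     (\<forall>i\<in>I. finite_graph (D i)) \<and>
     (\<forall>i\<in>I. \<forall>j\<in>I. R i j \<longrightarrow> graph_hom (D j) (D i) (p i j) (q i j)) \<and>
     (\<forall>i\<in>I. (\<forall>v\<in>verts (D i). p i i v = v) \<and> (\<forall>e\<in>edges (D i). q i i e = e)) \<and>
     (\<forall>i\<in>I. \<forall>j\<in>I. \<forall>k\<in>I. R i j \<longrightarrow> R j k \<longrightarrow>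
        (\<forall>v\<in>verts (D k). p i j (p j k v) = p i k v) \<and>
        (\<forall>e\<in>edges (D k). q i j (q j k e) = q i k e))"

definition compatible_families ::
  "'i set \<Rightarrow> ('i \<Rightarrow> 'i \<Rightarrow> bool) \<Rightarrow> ('i \<Rightarrow> 'x set) \<Rightarrow> ('i \<Rightarrow> 'i \<Rightarrow> 'x \<Rightarrow> 'x) \<Rightarrow> ('i \<Rightarrow> 'x) set" where
  "compatible_families I R X p =
     {x \<in> (\<Pi>\<^sub>E i\<in>I. X i). \<forall>i\<in>I. \<forall>j\<in>I. R i j \<longrightarrow> p i j (x j) = x i}"

definition limit_graph ::
  "'i set \<Rightarrow> ('i \<Rightarrow> 'i \<Rightarrow> bool) \<Rightarrow> ('i \<Rightarrow> ('v, 'e) sgraph)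
    \<Rightarrow> ('i \<Rightarrow> 'i \<Rightarrow> 'v \<Rightarrow> 'v) \<Rightarrow> ('i \<Rightarrow> 'i \<Rightarrow> 'e \<Rightarrow> 'e) \<Rightarrow> ('i \<Rightarrow> 'v, 'i \<Rightarrow> 'e) top_graph" where
  "limit_graph I R D p q =
     \<lparr>verts = compatible_families I R (\<lambda>i. verts (D i)) p,
      edges = compatible_families I R (\<lambda>i. edges (D i)) q,
      pos_edges = compatible_families I R (\<lambda>i. pos_edges (D i)) q,
      ini = (\<lambda>x. \<lambda>i\<in>I. ini (D i) (x i)),
      ter = (\<lambda>x. \<lambda>i\<in>I. ter (D i) (x i)),
      einv = (\<lambda>x. \<lambda>i\<in>I. einv (D i) (x i)),
      vtop = subtopology (product_topology (\<lambda>i. discrete_topology (verts (D i))) I)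
               (compatible_families I R (\<lambda>i. verts (D i)) p),
      etop = subtopology (product_topology (\<lambda>i. discrete_topology (edges (D i))) I)
               (compatible_families I R (\<lambda>i. edges (D i)) q)\<rparr>"

text \<open>A profinite graph is a projective limit of finite discrete graphs. HOL cannot quantify over
  the types of the index set and of the finite graphs, so these are fixed without loss of
  generality: a finite graph has a copy with vertices and edges in \<open>nat\<close>, and the members of an
  inverse system with limit \<open>\<Gamma>\<close> can be replaced by the images of \<open>\<Gamma>\<close> and then be indexed
  by the kernels of the projections, i.e. by pairs of equivalence relations on the vertices
  and on the edges of \<open>\<Gamma>\<close>.\<close>

definition profinite_graph :: "('v, 'e) top_graph \<Rightarrow> bool" where
  "profinite_graph \<Gamma> \<longleftrightarrow>
     topological_graph \<Gamma> \<and>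
     (\<exists>(I :: (('v \<times> 'v) set \<times> ('e \<times> 'e) set) set) R (D :: _ \<Rightarrow> (nat, nat) sgraph) p q f g.
        inverse_system I R D p q \<and> top_graph_iso \<Gamma> (limit_graph I R D p q) f g)"

text \<open>Finite continuous quotient graphs are represented, up to isomorphism, by the continuous
  surjective morphisms onto finite discrete graphs with vertices and edges in \<open>nat\<close>.\<close>

definition finite_quotient ::
  "('v, 'e) top_graph \<Rightarrow> (nat, nat) sgraph \<Rightarrow> ('v \<Rightarrow> nat) \<Rightarrow> ('e \<Rightarrow> nat) \<Rightarrow> bool" where
  "finite_quotient \<Gamma> \<Delta> f g \<longleftrightarrow>
     finite_graph \<Delta> \<and> graph_hom \<Gamma> \<Delta> f g \<and>
     f ` verts \<Gamma> = verts \<Delta> \<and> g ` edges \<Gamma> = edges \<Delta> \<and>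
     continuous_map (vtop \<Gamma>) (discrete_topology (verts \<Delta>)) f \<and>
     continuous_map (etop \<Gamma>) (discrete_topology (edges \<Delta>)) g"

definition connected_graph :: "('v, 'e) top_graph \<Rightarrow> bool" where
  "connected_graph \<Gamma> \<longleftrightarrow> (\<forall>\<Delta> f g. finite_quotient \<Gamma> \<Delta> f g \<longrightarrow> abstractly_connected \<Delta>)"

text \<open>A subgraph is given by its sets of vertices and edges.\<close>

definition closed_subgraph :: "('v, 'e) top_graph \<Rightarrow> 'v set \<Rightarrow> 'e set \<Rightarrow> bool" where
  "closed_subgraph \<Gamma> W F \<longleftrightarrow>
     closedin (vtop \<Gamma>) W \<and> closedin (etop \<Gamma>) F \<and>
     (\<forall>e\<in>F. ini \<Gamma> e \<in> W \<and> ter \<Gamma> e \<in> W \<and> einv \<Gamma> e \<in> F)"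

definition restrict_graph :: "('v, 'e) top_graph \<Rightarrow> 'v set \<Rightarrow> 'e set \<Rightarrow> ('v, 'e) top_graph" where
  "restrict_graph \<Gamma> W F =
     \<Gamma>\<lparr>verts := verts \<Gamma> \<inter> W, edges := edges \<Gamma> \<inter> F, pos_edges := pos_edges \<Gamma> \<inter> F,
       vtop := subtopology (vtop \<Gamma>) W, etop := subtopology (etop \<Gamma>) F\<rparr>"

definition connected_subgraphs :: "('v, 'e) top_graph \<Rightarrow> 'v \<Rightarrow> 'v \<Rightarrow> ('v set \<times> 'e set) set" where
  "connected_subgraphs \<Gamma> u v =
     {(W, F). closed_subgraph \<Gamma> W F \<and> connected_graph (restrict_graph \<Gamma> W F) \<and> u \<in> W \<and> v \<in> W}"

definition tree_like :: "('v, 'e) top_graph \<Rightarrow> bool" where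
  "tree_like \<Gamma> \<longleftrightarrow>
     profinite_graph \<Gamma> \<and> connected_graph \<Gamma> \<and>
     (\<forall>u\<in>verts \<Gamma>. \<forall>v\<in>verts \<Gamma>.
        connected_graph (restrict_graph \<Gamma> (\<Inter>(W, F)\<in>connected_subgraphs \<Gamma> u v. W)
                                          (\<Inter>(W, F)\<in>connected_subgraphs \<Gamma> u v. F)))"


section \<open>Generating sets and Cayley graphs\<close>

text \<open>In what follows \<open>T\<close> is the topology on the carrier of the group \<open>G\<close>.\<close>

definition top_generates :: "('a, 'm) monoid_scheme \<Rightarrow> 'a topology \<Rightarrow> 'a set \<Rightarrow> bool" where
  "top_generates G T A \<longleftrightarrow> A \<subseteq> carrier G \<and> T closure_of (generate G A) = carrier G"

text \<open>In \<open>A <+> A\<close> the left copy \<open>Inl a\<close> stands for the letter \<open>a\<close>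
  and the right copy \<open>Inr a\<close> for its formal inverse.\<close>

primrec letter_value :: "('a, 'm) monoid_scheme \<Rightarrow> 'a + 'a \<Rightarrow> 'a" where
  "letter_value G (Inl a) = a"
| "letter_value G (Inr a) = inv\<^bsub>G\<^esub> a"

primrec letter_inv :: "'a + 'a \<Rightarrow> 'a + 'a" where
  "letter_inv (Inl a) = Inr a"
| "letter_inv (Inr a) = Inl a"

definition cayley_graph ::
  "('a, 'm) monoid_scheme \<Rightarrow> 'a topology \<Rightarrow> 'a set \<Rightarrow> ('a, 'a \<times> ('a + 'a)) top_graph" where
  "cayley_graph G T A =
     \<lparr>verts = carrier G,
      edges = carrier G \<times> (A <+> A),
      pos_edges = carrier G \<times> (Inl ` A),
      ini = (\<lambda>(g, x). g),
      ter = (\<lambda>(g, x). g \<otimes>\<^bsub>G\<^esub> letter_value G x),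
      einv = (\<lambda>(g, x). (g \<otimes>\<^bsub>G\<^esub> letter_value G x, letter_inv x)),
      vtop = T,
      etop = prod_topology T (discrete_topology (A <+> A))\<rparr>"


section \<open>The product of the alternating groups\<close>

definition alt_prod :: "(nat \<Rightarrow> nat \<Rightarrow> nat) monoid" where
  "alt_prod = product_group {5..} alt_group"

definition alt_prod_top :: "(nat \<Rightarrow> nat \<Rightarrow> nat) topology" where
  "alt_prod_top = product_topology (\<lambda>k. discrete_topology (carrier (alt_group k))) {5..}"

end

(* Call the Cayley graph of the product of the first alternating groups a level. The generators are
   built coordinatewise so that the following dissolving property holds: if two connected subgraphs
   of a level contain u and v, and u and v lie in different components of their intersection, then
   no two connected closed subgraphs of the full Cayley graph project into them and contain a
   common pair of lifts of u and v. To achieve this, glue the two subgraphs along the component of u in their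
   intersection. The result is a finite partial permutation action of the letters in which the two
   copies of v are distinct, and on more points it can be completed to permutations that generate an
   alternating group of arbitrarily large degree. There are only countably many finite partial
   actions, so a single choice of generators completes each of them in arbitrarily high
   coordinates, while all remaining coordinates get arbitrary generators.

   Density follows from the simplicity and pairwise distinct orders of the factors. By compactness
   the dissolving property makes the connected closed subgraphs containing u and v downward
   directed, and a directed intersection of connected profinite graphs is connected. *)

theory Submission
  imports Defs
begin

section \<open>Three-cycles and blocks\<close>

text \<open>Why a completed gluing separates the lifts: a path from \<open>u\<close> to
  \<open>v\<close> in one subgraph spells a word in the generators, and so does a path in the other.
  If the same pair of lifts is joined in both at level \<open>k\<close>, the two words have the same
  value there, hence give the same permutation in coordinate \<open>k\<close>. Traced in the glued
  graph, however, they link the common copy of \<open>u\<close> with different copies of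
  \<open>v\<close>, which one permutation cannot do.

  The obstacle is that the letters must still generate all of \<open>alt_group k\<close>, or density
  would fail. A gluing on which every letter is defined everywhere could not be joined to new
  points; so an undefined value is required, and connectedness of the levels guarantees it. On the
  added points two long cycles that meet in a single point produce a 3-cycle. Generation then
  follows from blocks: a maximal set all of whose 3-cycles lie in the group is a block. After a
  completion it covers more than half of the points, so it is invariant, and connectedness makes it
  everything.\<close>

definition tricycle :: "'a \<Rightarrow> 'a \<Rightarrow> 'a \<Rightarrow> 'a \<Rightarrow> 'a" where
  "tricycle a b c = cycle_of_list [a, b, c]"

lemma tricycle_apply:
  assumes "distinct [a, b, c]"
  shows "tricycle a b c x = (if x = a then b else if x = b then c else if x = c then a else x)"
  using assms by (auto simp: tricycle_def transpose_def)

lemma tricycle_rotate: "distinct [a, b, c] \<Longrightarrow> tricycle a b c = tricycle b c a"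
  by (rule ext) (auto simp: tricycle_apply)

lemma inv_tricycle: "distinct [a, b, c] \<Longrightarrow> inv' (tricycle a b c) = tricycle b a c"
  by (rule inv_unique_comp) (auto simp: fun_eq_iff tricycle_apply split: if_splits)

text \<open>Away from \<open>z\<close> every point moved by one bijection is fixed by the other, so
  the commutator cancels except on three points. This turns two long cycles that meet in one point
  into a 3-cycle.\<close>

lemma commutator_tricycle:
  assumes "bij g" "bij h"
    and supp: "\<And>x. g x \<noteq> x \<Longrightarrow> h x \<noteq> x \<Longrightarrow> x = z"
    and "g z \<noteq> z" "h z \<noteq> z"
  shows "distinct [z, h z, g z]" and "h \<circ> g \<circ> inv' h \<circ> inv' g = tricycle z (h z) (g z)"
proof -
  have gi: "inv' g y = x \<longleftrightarrow> g x = y" "inv' h y = x \<longleftrightarrow> h x = y" for x y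
    using bij_inv_eq_iff[OF assms(1)] bij_inv_eq_iff[OF assms(2)] by metis+
  have gj: "g x = g y \<longleftrightarrow> x = y" "h x = h y \<longleftrightarrow> x = y" for x y
    using assms(1,2) by (auto simp: bij_def inj_eq)
  have gh: "h (g z) = g z" "g (h z) = h z"
    using supp[of "g z"] supp[of "h z"] assms(4,5) gj by metis+
  show d: "distinct [z, h z, g z]"
    using gh assms(4,5) gj by auto
  have fix_out: "h (g (inv' h (inv' g x))) = x" if x: "x \<noteq> z" "x \<noteq> h z" "x \<noteq> g z" for x
  proof (cases "g x = x")
    case True
    then have "inv' g x = x" by (simp add: gi)
    moreover have "g (inv' h x) = inv' h x"
    proof (rule ccontr)
      assume *: "g (inv' h x) \<noteq> inv' h x"
      then have "inv' h x \<noteq> x" using True by metis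
      then have "h (inv' h x) \<noteq> inv' h x" by (metis gi(2))
      then show False using supp * x gi(2) by metis
    qed
    ultimately show ?thesis by (metis gi(2))
  next
    case False
    then have "inv' g x \<noteq> x" "h x = x" by (metis gi(1), metis supp x(1))
    moreover have "g (inv' g x) \<noteq> inv' g x" by (metis False gi(1))
    ultimately have "h (inv' g x) = inv' g x" by (metis supp x(3) gi(1))
    then have "inv' h (inv' g x) = inv' g x" by (simp add: gi)
    then show ?thesis using \<open>h x = x\<close> by (metis gi(1))
  qed
  have "inv' h (inv' g z) = inv' g z"
    by (metis gi gh supp assms(4))
  then have 1: "h (g (inv' h (inv' g z))) = h z" by (metis gi(1))
  have 2: "h (g (inv' h (inv' g (h z)))) = g z" "h (g (inv' h (inv' g (g z)))) = z"
  proof -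
    have "inv' g (h z) = h z" using gh by (simp add: gi)
    then show "h (g (inv' h (inv' g (h z)))) = g z" using gh by (metis gi(2))
    have "h (inv' h z) = z" "inv' h z \<noteq> z" using assms(5) by (metis gi(2))+
    then have "g (inv' h z) = inv' h z" using supp by metis
    then show "h (g (inv' h (inv' g (g z)))) = z" using \<open>h (inv' h z) = z\<close> by (metis gi(1))
  qed
  show "h \<circ> g \<circ> inv' h \<circ> inv' g = tricycle z (h z) (g z)"
    using fix_out 1 2 unfolding fun_eq_iff tricycle_apply[OF d] by auto
qed

section \<open>Sets of points on which a permutation group contains all 3-cycles\<close>

locale perm_set =
  fixes H :: "('a \<Rightarrow> 'a) set"
  assumes comp_closed: "p \<in> H \<Longrightarrow> q \<in> H \<Longrightarrow> p \<circ> q \<in> H"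
    and inv_closed: "p \<in> H \<Longrightarrow> inv' p \<in> H"
    and bij_mem: "p \<in> H \<Longrightarrow> bij p"
begin

text \<open>For a finite set with at least three points this says that \<open>H\<close> contains the
  alternating group on \<open>B\<close>; for smaller sets it is vacuous, hence the cardinality
  hypotheses of \<open>full_Un\<close>.\<close>

definition full :: "'a set \<Rightarrow> bool" where
  "full B \<longleftrightarrow> (\<forall>a\<in>B. \<forall>b\<in>B. \<forall>c\<in>B. distinct [a, b, c] \<longrightarrow> tricycle a b c \<in> H)"

text \<open>Covers both uses of the block argument: elements of \<open>H\<close> itself, and
  elements of the ambient alternating group when \<open>H\<close> is a normal subgroup.\<close>

definition normalizes :: "('a \<Rightarrow> 'a) \<Rightarrow> bool" where
  "normalizes p \<longleftrightarrow> bij p \<and> (\<forall>q\<in>H. p \<circ> q \<circ> inv' p \<in> H)"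

lemma normalizes_mem: "p \<in> H \<Longrightarrow> normalizes p"
  by (simp add: normalizes_def comp_closed inv_closed bij_mem)

lemma tricycle_conj:
  assumes "normalizes p" "distinct [a, b, c]" "tricycle a b c \<in> H"
  shows "tricycle (p a) (p b) (p c) \<in> H"
  using assms conjugation_of_cycle[of "[a, b, c]" p] by (auto simp: normalizes_def tricycle_def)

lemma tricycle_swap:
  "distinct [a, b, c] \<Longrightarrow> tricycle a b c \<in> H \<longleftrightarrow> tricycle b a c \<in> H"
proof -
  have *: "tricycle b a c \<in> H" if "tricycle a b c \<in> H" "distinct [a, b, c]" for a b c
    using inv_closed[OF that(1)] inv_tricycle[OF that(2)] by simp
  assume "distinct [a, b, c]"
  then show ?thesis using *[of a b c] *[of b a c] by auto
qed

lemma full_tricycle: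
  assumes "distinct [a, b, c]" "tricycle a b c \<in> H"
  shows "full {a, b, c}"
proof -
  have 1: "tricycle b c a \<in> H" "tricycle c a b \<in> H"
    using assms tricycle_rotate[of a b c] tricycle_rotate[of b c a] by auto
  have "tricycle b a c \<in> H" "tricycle c b a \<in> H" "tricycle a c b \<in> H"
    using 1 assms tricycle_swap[of a b c] tricycle_swap[of b c a] tricycle_swap[of c a b] by auto
  then show ?thesis
    unfolding full_def using 1 assms by auto
qed

lemma full_image:
  assumes "normalizes p" "full B" shows "full (p ` B)"
  unfolding full_def
proof (intro ballI impI)
  fix a b c assume "a \<in> p ` B" "b \<in> p ` B" "c \<in> p ` B" and d: "distinct [a, b, c]"
  then obtain x y z where xyz: "x \<in> B" "y \<in> B" "z \<in> B" "a = p x" "b = p y" "c = p z" by blast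
  then have "distinct [x, y, z]" using d by auto
  then show "tricycle a b c \<in> H"
    using tricycle_conj[OF assms(1)] assms(2) xyz unfolding full_def by blast
qed

text \<open>Conjugation by 3-cycles inside \<open>B\<close> carries the pair \<open>a\<close>,
  \<open>b\<close> to every other pair of points of \<open>B\<close>, so one 3-cycle through the new
  point \<open>d\<close> brings all the others.\<close>

lemma full_insert:
  assumes B: "full B" and ab: "a \<in> B" "b \<in> B" "a \<noteq> b" and d: "d \<notin> B" and abd: "tricycle a b d \<in> H"
  shows "full (insert d B)"
proof -
  define P where "P x y \<longleftrightarrow> tricycle x y d \<in> H" for x y
  have sym: "P x y \<longleftrightarrow> P y x" if "x \<in> B" "y \<in> B" "x \<noteq> y" for x y
    unfolding P_def using tricycle_swap[of x y d] that d by auto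
  have step: "P x z" if "P x y" "x \<in> B" "y \<in> B" "z \<in> B" "distinct [x, y, z]" for x y z
  proof -
    have t: "tricycle x y z \<in> H" using B that unfolding full_def by blast
    have d': "d \<notin> {x, y, z}" using that d by auto
    have "tricycle y z d \<in> H"
      using tricycle_conj[OF normalizes_mem[OF t], of x y d] that d'
      by (auto simp: tricycle_apply P_def)
    then have "tricycle z x d \<in> H"
      using tricycle_conj[OF normalizes_mem[OF t], of y z d] that d'
      by (auto simp: tricycle_apply P_def)
    then show ?thesis using sym[of z x] that by (auto simp: P_def)
  qed
  have Pab: "P a b" using abd by (simp add: P_def)
  have Pa: "P a y" if "y \<in> B" "y \<noteq> a" for y
    using step[OF Pab, of y] Pab that ab by (cases "y = b") auto
  have P: "P x y" if "x \<in> B" "y \<in> B" "x \<noteq> y" for x y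
    using step[of y a x] Pa[of x] Pa[of y] sym[of a y] sym[of a x] sym[of x y] that ab
    by (cases "x = a"; cases "y = a") auto
  show ?thesis
    unfolding full_def
  proof (intro ballI impI)
    fix x y z assume xyz: "x \<in> insert d B" "y \<in> insert d B" "z \<in> insert d B" "distinct [x, y, z]"
    consider "z = d" "x \<in> B" "y \<in> B" | "y = d" "z \<in> B" "x \<in> B" | "x = d" "y \<in> B" "z \<in> B"
      | "x \<in> B" "y \<in> B" "z \<in> B" using xyz by auto
    then show "tricycle x y z \<in> H"
    proof cases
      case 1 then show ?thesis using P[of x y] xyz by (simp add: P_def)
    next
      case 2 then show ?thesis using P[of z x] xyz tricycle_rotate[of z x y]
        by (auto simp add: P_def)
    next
      case 3 then show ?thesis using P[of y z] xyz tricycle_rotate[of x y z]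
        by (auto simp add: P_def)
    next
      case 4 then show ?thesis using B xyz unfolding full_def by blast
    qed
  qed
qed

text \<open>By \<open>full_insert\<close> one 3-cycle through \<open>y\<close> and two points of
  \<open>B\<close> is enough. If \<open>B\<close> and \<open>C\<close> share a second point,
  \<open>C\<close> contains such a 3-cycle. If \<open>z\<close> is the only common point, the
  commutator of a 3-cycle in \<open>B\<close> and one in \<open>C\<close>, both through
  \<open>z\<close>, is of this kind.\<close>

lemma full_Un_aux:
  assumes B: "full B" "a \<in> B" "b \<in> B" "distinct [z, a, b]" "z \<in> B"
    and C: "full C" "z \<in> C" "c \<in> C" "d \<in> C" "distinct [z, c, d]"
    and y: "y \<in> C" "y \<notin> B"
  shows "full (insert y B)"
proof (cases "\<exists>z'\<in>B \<inter> C. z' \<noteq> z")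
  case True
  then obtain z' where "z' \<in> B" "z' \<in> C" "z' \<noteq> z" by auto
  moreover have "tricycle z z' y \<in> H"
    using C y calculation B unfolding full_def by (metis distinct_length_2_or_more distinct_singleton)
  ultimately show ?thesis using full_insert[of B z z' y] B y by auto
next
  case False
  \<comment> \<open>A third point of \<open>C\<close> besides \<open>z\<close> and
    \<open>y\<close>.\<close>
  define d' where "d' = (if y = c then d else c)"
  have d': "d' \<in> C" "d' \<noteq> y" "d' \<noteq> z" "y \<noteq> z" using C B y by (auto simp: d'_def)
  have ny: "d' \<notin> B" using False d' by auto
  have t: "tricycle z a b \<in> H" "tricycle z y d' \<in> H"
    using B C d' y unfolding full_def by auto
  have ab: "a \<notin> C" "b \<notin> C" using False B by auto
  have zyd: "distinct [z, y, d']" using d' by auto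
  let ?g = "tricycle z a b" and ?h = "tricycle z y d'"
  have "?h \<circ> ?g \<circ> inv' ?h \<circ> inv' ?g = tricycle z (?h z) (?g z)"
  proof (rule commutator_tricycle(2)[OF bij_mem[OF t(1)] bij_mem[OF t(2)]])
    fix x assume "?g x \<noteq> x" "?h x \<noteq> x"
    then have "x \<in> {z, a, b}" "x \<in> {z, y, d'}"
      using tricycle_apply[OF B(4), of x] tricycle_apply[OF zyd, of x] by (metis insertCI)+
    then show "x = z" using B d' ab y C by auto
  qed (use B(4) zyd in \<open>auto simp: tricycle_apply\<close>)
  moreover have "?h z = y" "?g z = a"
    using B(4) zyd by (auto simp: tricycle_apply)
  ultimately have "tricycle z y a \<in> H"
    using t comp_closed inv_closed by metis
  moreover have "a \<noteq> y" using B y by auto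
  ultimately have "tricycle a z y \<in> H" using tricycle_rotate[of a z y] B y d' by auto
  then show ?thesis using full_insert[of B a z y] B y by auto
qed

lemma full_Un:
  assumes B: "full B" "card B \<ge> 3" and C: "full C" "card C \<ge> 3" and ne: "B \<inter> C \<noteq> {}"
  shows "full (B \<union> C)"
proof -
  obtain z where z: "z \<in> B" "z \<in> C" using ne by auto
  have ex: "\<exists>a b. a \<in> X \<and> b \<in> X \<and> distinct [z, a, b]" if "card X \<ge> 3" "z \<in> X" for X :: "'a set"
  proof -
    have "finite X" using that card.infinite by fastforce
    then have "card (X - {z}) \<ge> 2" using that by simp
    then obtain a where a: "a \<in> X - {z}" by (metis card_2_iff' card_le_Suc0_iff_eq ex_in_conv card.empty not_less_eq_eq le0 numeral_2_eq_2)
    have "card (X - {z} - {a}) \<ge> 1" using \<open>card (X - {z}) \<ge> 2\<close> a \<open>finite X\<close> by simp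
    then obtain b where "b \<in> X - {z} - {a}" by (metis card.empty ex_in_conv not_one_le_zero)
    then show ?thesis using a by auto
  qed
  obtain c d where cd: "c \<in> C" "d \<in> C" "distinct [z, c, d]" using ex[OF C(2) z(2)] by auto
  obtain a b where ab: "a \<in> B" "b \<in> B" "distinct [z, a, b]" using ex[OF B(2) z(1)] by auto
  have "finite C" using C(2) card.infinite by fastforce
  \<comment> \<open>The points of \<open>C\<close> are adjoined one at a time;
    \<open>B \<union> D\<close> takes the place of \<open>B\<close> in
    \<open>full_Un_aux\<close>.\<close>
  have "full (B \<union> D)" if "finite D" "D \<subseteq> C" for D
    using that
  proof induction
    case empty then show ?case using B by simp
  next
    case (insert y D)
    then have IH: "full (B \<union> D)" and y: "y \<in> C" by auto
    show ?case
    proof (cases "y \<in> B \<union> D")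
      case True then show ?thesis using IH by (simp add: insert_absorb)
    next
      case False
      show ?thesis
        using full_Un_aux[OF IH, of a b z C c d y] False y ab cd z C by auto
    qed
  qed
  from this[OF \<open>finite C\<close>] show ?thesis by simp
qed

text \<open>A maximal full set is a block: its image under a normalizing permutation is full too,
  and if the two meet then their union is full, so maximality forces equality.\<close>

lemma full_block:
  assumes fin: "finite S" and t: "distinct [a, b, c]" "tricycle a b c \<in> H" "{a, b, c} \<subseteq> S"
  shows "\<exists>B. {a, b, c} \<subseteq> B \<and> B \<subseteq> S \<and> full B \<and>
    (\<forall>p. p permutes S \<longrightarrow> normalizes p \<longrightarrow> p ` B \<inter> B \<noteq> {} \<longrightarrow> p ` B = B)"
proof -
  define \<B> where "\<B> = {B. {a, b, c} \<subseteq> B \<and> B \<subseteq> S \<and> full B}"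
  have "finite \<B>" using fin unfolding \<B>_def by (auto intro: finite_subset[of _ "Pow S"])
  moreover have "{a, b, c} \<in> \<B>" using t full_tricycle by (auto simp: \<B>_def)
  ultimately obtain B where B: "B \<in> \<B>" and max: "\<And>C. C \<in> \<B> \<Longrightarrow> B \<subseteq> C \<Longrightarrow> B = C"
    using finite_has_maximal by (metis empty_iff)
  have finB: "finite B" using B fin finite_subset by (auto simp: \<B>_def)
  have cB: "card B \<ge> 3"
  proof -
    have "card {a, b, c} = 3" using t by auto
    then show ?thesis using card_mono[OF finB, of "{a, b, c}"] B by (auto simp: \<B>_def)
  qed
  show ?thesis
  proof (intro exI[of _ B] conjI allI impI)
    fix p assume p: "p permutes S" "normalizes p" "p ` B \<inter> B \<noteq> {}"
    have c: "card (p ` B) = card B" using permutes_inj_on[OF p(1)] card_image by metis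
    have "full (B \<union> p ` B)"
      using full_Un[of B "p ` B"] full_image[OF p(2), of B] p(3) cB c B
      by (auto simp: \<B>_def)
    moreover have "p ` B \<subseteq> S" using B permutes_image[OF p(1)] by (auto simp: \<B>_def)
    ultimately have "B = B \<union> p ` B" using B by (intro max) (auto simp: \<B>_def)
    then show "p ` B = B" using c finB by (metis card_subset_eq sup.orderI sup_commute)
  qed (use B in \<open>auto simp: \<B>_def\<close>)
qed

end

section \<open>Simplicity of the alternating groups\<close>

context perm_set
begin

text \<open>The 3-cycle only normalizes \<open>H\<close>, yet its commutator with \<open>q\<close>
  lies in \<open>H\<close>. The commutator is the product of a conjugate of the 3-cycle with its
  inverse, so it moves few points.\<close>

lemma commutator_mem:
  assumes q: "q \<in> H" and n: "normalizes (tricycle a b c)" and d: "distinct [a, b, c]"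
  shows "tricycle (q a) (q b) (q c) \<circ> tricycle b a c \<in> H"
proof -
  let ?t = "tricycle a b c"
  have "?t \<circ> inv' q \<circ> inv' ?t \<in> H"
    using n inv_closed[OF q] by (auto simp: normalizes_def)
  then have "q \<circ> (?t \<circ> inv' q \<circ> inv' ?t) \<in> H" using q comp_closed by blast
  moreover have "q \<circ> (?t \<circ> inv' q \<circ> inv' ?t) = (q \<circ> ?t \<circ> inv' q) \<circ> inv' ?t"
    by (simp add: comp_assoc)
  moreover have "q \<circ> ?t \<circ> inv' q = tricycle (q a) (q b) (q c)"
    using conjugation_of_cycle[OF d bij_mem[OF q]] by (simp add: tricycle_def)
  ultimately show ?thesis using inv_tricycle[OF d] by metis
qed

lemma tricycle_if_swap:
  assumes "q \<in> H" "normalizes (tricycle a b c)" "distinct [a, b, c]"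
    and "q a = b" "q b = a" "q c = c"
  shows "tricycle a b c \<in> H"
proof -
  have "tricycle b a c \<circ> tricycle b a c = tricycle a b c"
    using assms(3) by (auto simp: fun_eq_iff tricycle_apply split: if_splits)
  then show ?thesis using commutator_mem[OF assms(1-3)] assms(4-) by simp
qed

lemma tricycle_if_long_orbit:
  assumes "q \<in> H" "normalizes (tricycle a b c)" "distinct [a, b, c, d]"
    and "q a = b" "q b = c" "q c = d"
  shows "tricycle a d b \<in> H"
proof -
  have "tricycle b c d \<circ> tricycle b a c = tricycle a d b"
    using assms(3) by (auto simp: fun_eq_iff tricycle_apply split: if_splits)
  then show ?thesis using commutator_mem[OF assms(1,2)] assms(3-) by simp
qed

text \<open>A permutation in \<open>H\<close> that swaps two points and fixes a third, or that leads
  through four distinct points in a row, has a 3-cycle as a commutator. The cases show that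
  \<open>q\<close> or its commutator \<open>?r\<close> with a 3-cycle behaves in this way, or that
  \<open>?r\<close> is itself a 3-cycle.\<close>

lemma exists_tricycle:
  assumes S: "finite S" "card S \<ge> 5"
    and n: "\<And>a b c. distinct [a, b, c] \<Longrightarrow> {a, b, c} \<subseteq> S \<Longrightarrow> normalizes (tricycle a b c)"
    and q: "q \<in> H" "q permutes S" "q \<noteq> id"
  shows "\<exists>a b c. distinct [a, b, c] \<and> {a, b, c} \<subseteq> S \<and> tricycle a b c \<in> H"
proof -
  obtain a where "q a \<noteq> a" using q(3) by (metis eq_id_iff)
  define b where "b = q a"
  define e where "e = q b"
  have a: "a \<in> S" "b \<in> S" "e \<in> S" "a \<noteq> b" "b \<noteq> e"
    using \<open>q a \<noteq> a\<close> q(2) permutes_in_image[OF q(2)] permutes_inj[OF q(2)]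
    unfolding b_def e_def by (auto simp: permutes_def inj_eq)
  have new: "\<exists>c\<in>S. c \<notin> set xs" if "length xs \<le> 4" for xs
  proof (rule ccontr)
    assume "\<not> ?thesis"
    then have "card S \<le> card (set xs)" by (intro card_mono) auto
    then show False using card_length[of xs] that S by simp
  qed
  obtain c where c: "c \<in> S" "c \<notin> {a, b, e}" using new[of "[a, b, e]"] by auto
  define f where "f = q c"
  have qs: "q a = b" "q b = e" "q c = f" by (simp_all add: b_def e_def f_def)
  have f: "f \<in> S" "f \<noteq> b" "f \<noteq> e"
    using c permutes_in_image[OF q(2)] permutes_inj[OF q(2)]
    unfolding b_def e_def f_def by (auto simp: inj_eq)
  have abc: "distinct [a, b, c]" "distinct [b, e, f]" "distinct [b, a, c]" using a c f by auto
  let ?r = "tricycle b e f \<circ> tricycle b a c"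
  have r: "?r \<in> H"
    using commutator_mem[OF q(1) n[of a b c] abc(1)] a c unfolding b_def e_def f_def by auto
  note r_simps = o_apply tricycle_apply[OF abc(2)] tricycle_apply[OF abc(3)]
  \<comment> \<open>In the two cases that use \<open>g\<close>, all points moved by
    \<open>?r\<close> are among the four listed ones, so a fifth point of \<open>S\<close> is
    fixed.\<close>
  obtain g where g: "g \<in> S" "g \<notin> {a, b, c, if e = a then f else e}"
    using new[of "[a, b, c, if e = a then f else e]"] by auto
  consider "e = a" "f = c" | "e = a" "f \<noteq> c" | "e \<noteq> a" "f = a" | "e \<noteq> a" "f = c"
    | "e \<noteq> a" "f \<noteq> a" "f \<noteq> c" by blast
  then show ?thesis
  proof cases
    case 1
    have "tricycle a b c \<in> H"
      by (rule tricycle_if_swap[OF q(1) n]) (use abc a c qs 1 in auto)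
    then show ?thesis using abc a c by blast
  next
    case 2
    have "?r a = c" "?r c = a" "?r g = g"
      unfolding r_simps using 2 a c f g by auto
    then have "tricycle a c g \<in> H"
      using tricycle_if_swap[OF r n, of a c g] a c g by auto
    moreover have "distinct [a, c, g]" "{a, c, g} \<subseteq> S" using a c g by auto
    ultimately show ?thesis by blast
  next
    case 3
    have d: "distinct [a, c, e]" using 3 a c by auto
    have "?r = tricycle a c e"
      unfolding fun_eq_iff r_simps tricycle_apply[OF d] using 3 a c f by auto
    then have "tricycle a c e \<in> H" using r by simp
    moreover have "{a, c, e} \<subseteq> S" using a c by auto
    ultimately show ?thesis using d by blast
  next
    case 4
    have "?r a = b" "?r b = a" "?r g = g"
      unfolding r_simps using 4 a c f g by auto
    then have "tricycle a b g \<in> H"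
      using tricycle_if_swap[OF r n, of a b g] a c g by auto
    moreover have "distinct [a, b, g]" "{a, b, g} \<subseteq> S" using a c g by auto
    ultimately show ?thesis by blast
  next
    case 5
    have "?r a = c" "?r c = e" "?r e = f"
      unfolding r_simps using 5 a c f g by auto
    then have "tricycle a f c \<in> H"
      using tricycle_if_long_orbit[OF r n, of a c e f] 5 a c f by auto
    moreover have "distinct [a, f, c]" "{a, f, c} \<subseteq> S" using 5 a c f by auto
    ultimately show ?thesis by blast
  qed
qed

end

lemma subgroup_alt_perm_set:
  assumes "subgroup N (alt_group m)"
  shows "perm_set N"
proof
  fix p q assume pq: "p \<in> N" "q \<in> N"
  show "p \<circ> q \<in> N" using subgroup.m_closed[OF assms pq] by (simp add: alt_group_mult)
  have p: "p \<in> carrier (alt_group m)" using subgroup.mem_carrier[OF assms pq(1)] .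
  show "inv' p \<in> N"
    using subgroup.m_inv_closed[OF assms pq(1)] alt_group_inv_equality[OF p] by simp
  show "bij p" using p by (auto simp: alt_group_carrier permutes_bij)
qed

lemma tricycle_mem_alt_group:
  assumes "distinct [a, b, c]" "{a, b, c} \<subseteq> {1..m}"
  shows "tricycle a b c \<in> carrier (alt_group m)"
proof -
  have "tricycle a b c \<in> three_cycles m"
    using assms unfolding tricycle_def by (auto intro!: exI[of _ "[a, b, c]"])
  then show ?thesis using three_cycles_incl by blast
qed

lemma full_imp_eq_alt_group:
  assumes N: "subgroup N (alt_group m)" and full: "perm_set.full N {1..m}"
  shows "N = carrier (alt_group m)"
proof
  show "N \<subseteq> carrier (alt_group m)" using subgroup.subset[OF N] .
  have "three_cycles m \<subseteq> N"
  proof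
    fix p assume "p \<in> three_cycles m"
    then obtain cs where cs: "p = cycle_of_list cs" "cycle cs" "length cs = 3" "set cs \<subseteq> {1..m}"
      by auto
    obtain a b c where "cs = [a, b, c]"
      using cs(3) by (auto simp: numeral_3_eq_3 length_Suc_conv)
    then show "p \<in> N"
      using full cs unfolding perm_set.full_def[OF subgroup_alt_perm_set[OF N]] tricycle_def by auto
  qed
  then show "carrier (alt_group m) \<subseteq> N"
    unfolding alt_group_carrier_as_three_cycles
    using group.generate_subgroup_incl[OF alt_group_is_group _ N] by blast
qed

text \<open>A nontrivial normal subgroup contains a 3-cycle, and a maximal full set \<open>B\<close>
  around it is a block for the whole alternating group. For \<open>x\<close> outside
  \<open>B\<close> the 3-cycle through \<open>a\<close>, \<open>b\<close>, \<open>x\<close> would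
  send \<open>a\<close> into \<open>B\<close> but \<open>b\<close> out of it.\<close>

lemma alt_group_simple:
  assumes m: "m \<ge> 5" and N: "subgroup N (alt_group m)"
    and norm: "\<And>p q. p \<in> carrier (alt_group m) \<Longrightarrow> q \<in> N \<Longrightarrow> p \<circ> q \<circ> inv' p \<in> N"
    and ne: "N \<noteq> {id}"
  shows "N = carrier (alt_group m)"
proof -
  interpret perm_set N using subgroup_alt_perm_set[OF N] .
  have nrm: "normalizes p" if "p \<in> carrier (alt_group m)" for p
    using norm that by (auto simp: normalizes_def alt_group_carrier permutes_bij)
  have "id \<in> N" using subgroup.one_closed[OF N] by (simp add: alt_group_one)
  then obtain q where q: "q \<in> N" "q \<noteq> id" using ne by auto
  have "\<exists>a b c. distinct [a, b, c] \<and> {a, b, c} \<subseteq> {1..m} \<and> tricycle a b c \<in> N"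
  proof (rule exists_tricycle)
    show "q permutes {1..m}" using subgroup.mem_carrier[OF N q(1)] by (simp add: alt_group_carrier)
  qed (use m q nrm tricycle_mem_alt_group in auto)
  then obtain a b c where abc: "distinct [a, b, c]" "{a, b, c} \<subseteq> {1..m}" "tricycle a b c \<in> N" by blast
  obtain B where B: "{a, b, c} \<subseteq> B" "B \<subseteq> {1..m}" "full B"
    and blk: "\<And>p. p permutes {1..m} \<Longrightarrow> normalizes p \<Longrightarrow> p ` B \<inter> B \<noteq> {} \<Longrightarrow> p ` B = B"
    using full_block[OF finite_atLeastAtMost abc(1,3,2)] by metis
  have "x \<in> B" if x: "x \<in> {1..m}" for x
  proof (rule ccontr)
    assume "x \<notin> B"
    then have d: "distinct [a, b, x]" using abc B by auto
    let ?t = "tricycle a b x"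
    have t: "?t \<in> carrier (alt_group m)" using tricycle_mem_alt_group[OF d] x abc by auto
    have im: "?t a = b" "?t b = x" using d by (auto simp: tricycle_apply)
    then have "?t ` B \<inter> B \<noteq> {}" using B by (metis disjoint_iff imageI insert_subset)
    then have "?t ` B = B" using blk nrm[OF t] t by (auto simp: alt_group_carrier)
    then show False using im B \<open>x \<notin> B\<close> by (metis imageI insert_subset)
  qed
  then have "B = {1..m}" using B by auto
  then show ?thesis using full_imp_eq_alt_group[OF N] B by simp
qed

section \<open>Completing partial permutation actions\<close>

definition interval_cycle :: "nat \<Rightarrow> nat \<Rightarrow> nat \<Rightarrow> nat" where
  "interval_cycle j k = cycle_of_list [j..<Suc k]"

lemma interval_cycle_apply:
  assumes "j \<le> k"
  shows "interval_cycle j k x = (if j \<le> x \<and> x < k then Suc x else if x = k then j else x)"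
proof (cases "x \<in> {j..k}")
  case True
  have "map (interval_cycle j k) [j..<Suc k] = rotate1 [j..<Suc k]"
    using cyclic_rotation[of "[j..<Suc k]" 1] by (simp add: interval_cycle_def)
  also have "\<dots> = [Suc j..<Suc k] @ [j]"
    using assms by (simp add: upt_conv_Cons del: upt_Suc)
  finally have "map (interval_cycle j k) [j..<Suc k] ! (x - j) = ([Suc j..<Suc k] @ [j]) ! (x - j)"
    by simp
  then show ?thesis using True assms by (auto simp: nth_append simp del: upt_Suc)
next
  case False
  then show ?thesis using assms id_outside_supp[of x "[j..<Suc k]"]
    by (auto simp: interval_cycle_def simp del: upt_Suc)
qed

lemma interval_cycle_permutes: "interval_cycle j k permutes {j..k}"
  using cycle_permutes[of "[j..<Suc k]"]
  by (simp add: interval_cycle_def atLeastLessThanSuc_atLeastAtMost del: upt_Suc)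

lemma evenperm_interval_cycle:
  assumes "j \<le> k" shows "evenperm (interval_cycle j k) \<longleftrightarrow> even (k - j)"
proof -
  have "swapidseq (k - j) (interval_cycle j k)"
    using swapidseq_ext_imp_swapidseq[OF swapidseq_ext_of_cycles[of "[j..<Suc k]"]] assms
    by (simp add: interval_cycle_def Suc_diff_le del: upt_Suc)
  then show ?thesis using evenperm_unique by blast
qed

lemma interval_cycle_funpow:
  assumes "j \<le> k" shows "interval_cycle j k ^^ Suc (k - j) = id"
  using cycle_is_id_root[of "[j..<Suc k]"] assms
  by (simp add: interval_cycle_def Suc_diff_le del: upt_Suc)

lemma funpow_eq_on:
  assumes "\<And>x. x \<in> A \<Longrightarrow> f x = g x" "\<And>x. x \<in> A \<Longrightarrow> g x \<in> A" "x \<in> A"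
  shows "(f ^^ n) x = (g ^^ n) x \<and> (g ^^ n) x \<in> A"
  using assms by (induction n) auto

text \<open>Serves to cut the long cycle out of a generator: the power kills the other two factors,
  and each point sees only the factor that moves it.\<close>

lemma funpow_disjoint_permutes:
  assumes "c permutes A" "p permutes B" "t permutes C"
    and disj: "A \<inter> B = {}" "A \<inter> C = {}" "B \<inter> C = {}"
    and "p ^^ k = id" "t ^^ k = id"
  shows "(c \<circ> p \<circ> t) ^^ k = c ^^ k"
proof
  let ?f = "c \<circ> p \<circ> t"
  note out = permutes_not_in[OF assms(1)] permutes_not_in[OF assms(2)] permutes_not_in[OF assms(3)]
  note img = permutes_in_image[OF assms(1)] permutes_in_image[OF assms(2)] permutes_in_image[OF assms(3)]
  have fixc: "(c ^^ k) x = x" if "x \<notin> A" for x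
    using that out(1) by (induction k) auto
  fix x
  consider "x \<in> A" | "x \<in> B" | "x \<in> C" | "x \<notin> A" "x \<notin> B" "x \<notin> C" by blast
  then show "(?f ^^ k) x = (c ^^ k) x"
  proof cases
    case 1
    have "?f y = c y" if "y \<in> A" for y using that disj out by (metis comp_apply disjoint_iff)
    then show ?thesis using funpow_eq_on[of A ?f c x k] 1 img by auto
  next
    case 2
    have "?f y = p y" if "y \<in> B" for y using that disj out img by (metis comp_apply disjoint_iff)
    then have "(?f ^^ k) x = (p ^^ k) x" using funpow_eq_on[of B ?f p x k] 2 img by auto
    moreover have "x \<notin> A" using 2 disj by auto
    ultimately show ?thesis using fixc assms by simp
  next
    case 3
    have "?f y = t y" if "y \<in> C" for y using that disj out img by (metis comp_apply disjoint_iff)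
    then have "(?f ^^ k) x = (t ^^ k) x" using funpow_eq_on[of C ?f t x k] 3 img by auto
    moreover have "x \<notin> A" using 3 disj by auto
    ultimately show ?thesis using fixc assms by simp
  next
    case 4
    then have "?f x = id x" using out by simp
    then show ?thesis using funpow_eq_on[of "{x}" ?f id x k] fixc 4 by auto
  qed
qed

text \<open>A partial injection has domain and range of equal size, so their complements in the
  finite set \<open>V\<close> can be matched arbitrarily.\<close>

lemma extend_to_permutation:
  assumes "finite V" "R \<subseteq> V \<times> V" "single_valued R" "single_valued (R\<inverse>)"
  obtains p where "p permutes V" "\<And>x y. (x, y) \<in> R \<Longrightarrow> p x = y"
proof -
  define f where "f x = (THE y. (x, y) \<in> R)" for x
  have f: "f x = y" if "(x, y) \<in> R" for x y
    unfolding f_def using that assms(3) by (auto simp: single_valued_def)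
  have "bij_betw f (Domain R) (Range R)"
    unfolding bij_betw_def inj_on_def
    using f assms(4) by (auto simp: single_valued_def image_iff)
  moreover have fin: "Domain R \<subseteq> V" "Range R \<subseteq> V"
    using assms(2) by auto
  moreover have "finite (Domain R)" "finite (Range R)"
    using fin finite_subset[OF _ assms(1)] by auto
  ultimately have "card (V - Domain R) = card (V - Range R)"
    using bij_betw_same_card[of f] by (simp add: card_Diff_subset)
  then obtain g where g: "bij_betw g (V - Domain R) (V - Range R)"
    using finite_same_card_bij[of "V - Domain R" "V - Range R"] assms(1) by auto
  define p where "p x = (if x \<in> Domain R then f x else if x \<in> V then g x else x)" for x
  have "bij_betw p (Domain R \<union> (V - Domain R)) (Range R \<union> (V - Range R))"
  proof (rule bij_betw_combine)
    show "bij_betw p (Domain R) (Range R)"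
      using \<open>bij_betw f _ _\<close> by (rule bij_betw_cong[THEN iffD1, rotated]) (simp add: p_def)
    show "bij_betw p (V - Domain R) (V - Range R)"
      using g by (rule bij_betw_cong[THEN iffD1, rotated]) (simp add: p_def)
  qed auto
  moreover have "Domain R \<union> (V - Domain R) = V" "Range R \<union> (V - Range R) = V" using fin by auto
  ultimately have "p permutes V"
    using fin by (intro bij_imp_permutes) (auto simp: p_def)
  moreover have "p x = y" if "(x, y) \<in> R" for x y
    using f[OF that] that by (auto simp: p_def)
  ultimately show ?thesis using that by blast
qed

text \<open>A form of Jordan's theorem on primitive groups with a 3-cycle: a maximal full set is a
  block, so it is enough to show that every block around the 3-cycle is everything.\<close>

lemma alt_group_block_criterion:
  assumes H: "subgroup H (alt_group m)"
    and t: "distinct [a, b, c]" "tricycle a b c \<in> H" "{a, b, c} \<subseteq> {1..m}"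
    and blk: "\<And>B. \<lbrakk>{a, b, c} \<subseteq> B; B \<subseteq> {1..m};
       \<And>p. p \<in> H \<Longrightarrow> p ` B \<inter> B \<noteq> {} \<Longrightarrow> p ` B = B\<rbrakk> \<Longrightarrow> {1..m} \<subseteq> B"
  shows "H = carrier (alt_group m)"
proof -
  interpret perm_set H using subgroup_alt_perm_set[OF H] .
  obtain B where B: "{a, b, c} \<subseteq> B" "B \<subseteq> {1..m}" "full B"
    and b: "\<And>p. p permutes {1..m} \<Longrightarrow> normalizes p \<Longrightarrow> p ` B \<inter> B \<noteq> {} \<Longrightarrow> p ` B = B"
    using full_block[OF finite_atLeastAtMost t] by metis
  have "{1..m} \<subseteq> B"
  proof (rule blk[OF B(1,2)])
    fix p assume p: "p \<in> H" "p ` B \<inter> B \<noteq> {}"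
    have "p permutes {1..m}" using subgroup.mem_carrier[OF H p(1)] by (simp add: alt_group_carrier)
    then show "p ` B = B" using b normalizes_mem p by blast
  qed
  then show ?thesis using full_imp_eq_alt_group[OF H] B by (metis subset_antisym)
qed

definition generating_family :: "nat \<Rightarrow> nat \<Rightarrow> (nat \<Rightarrow> nat \<Rightarrow> nat) \<Rightarrow> bool" where
  "generating_family n m \<sigma> \<longleftrightarrow>
     (\<forall>i<n. \<sigma> i \<in> carrier (alt_group m)) \<and>
     generate (alt_group m) (\<sigma> ` {..<n}) = carrier (alt_group m)"

lemma ex_generating_family:
  assumes "m \<ge> 5" "n \<ge> 2"
  shows "\<exists>\<sigma>. generating_family n m \<sigma>"
proof -
  \<comment> \<open>Chosen so that the cycle on \<open>{j..m}\<close> has odd length and is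
    therefore even.\<close>
  define j :: nat where "j = (if odd m then 1 else 2)"
  have j: "j \<le> 2" "1 \<le> j" "even (m - j)" using assms by (auto simp: j_def)
  let ?c = "interval_cycle j m" and ?t = "tricycle 1 2 (3::nat)"
  have c: "?c \<in> carrier (alt_group m)"
    using permutes_subset[OF interval_cycle_permutes[of j m], of "{1..m}"] j assms
    by (auto simp: alt_group_carrier evenperm_interval_cycle)
  have t: "?t \<in> carrier (alt_group m)" using assms by (intro tricycle_mem_alt_group) auto
  define \<sigma> where "\<sigma> i = (if i = 0 then ?t else ?c)" for i :: nat
  have \<sigma>: "\<sigma> ` {..<n} \<subseteq> carrier (alt_group m)" using c t by (auto simp: \<sigma>_def)
  let ?H = "generate (alt_group m) (\<sigma> ` {..<n})"
  have H: "subgroup ?H (alt_group m)"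
    using group.generate_is_subgroup[OF alt_group_is_group \<sigma>] .
  have mem: "\<sigma> i \<in> ?H" if "i < n" for i using that by (auto intro: generate.incl)
  have "?H = carrier (alt_group m)"
  proof (rule alt_group_block_criterion[OF H, of 1 2 3])
    show "?t \<in> ?H" using mem[of 0] assms by (simp add: \<sigma>_def)
    fix B assume B: "{1, 2, 3} \<subseteq> B" "B \<subseteq> {1..m}"
      and blk: "\<And>p. p \<in> ?H \<Longrightarrow> p ` B \<inter> B \<noteq> {} \<Longrightarrow> p ` B = B"
    have "?c 2 = 3" using j assms by (simp add: interval_cycle_apply)
    then have "?c ` B \<inter> B \<noteq> {}" using B by (metis disjoint_iff imageI insert_subset)
    then have cB: "?c ` B = B" using blk[of ?c] mem[of 1] assms by (simp add: \<sigma>_def)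
    have "x \<in> B" if "2 \<le> x" "x \<le> m" for x
      using that
    proof (induction x rule: dec_induct)
      case base then show ?case using B by simp
    next
      case (step x)
      then have "?c x = Suc x" using j assms by (simp add: interval_cycle_apply)
      then show ?case using step cB by (metis Suc_leD imageI)
    qed
    then show "{1..m} \<subseteq> B" using B
      by (metis One_nat_def Suc_1 Suc_leI atLeastAtMost_iff insert_subset le_neq_implies_less subsetI)
  qed (use assms in auto)
  then show ?thesis using \<sigma> unfolding generating_family_def by blast
qed

text \<open>A triple \<open>(x, i, y)\<close> stands for the requirement that the \<open>i\<close>-th permutation maps \<open>x\<close> to \<open>y\<close>.\<close>

definition incomplete_action :: "nat \<Rightarrow> nat \<Rightarrow> (nat \<times> nat \<times> nat) set \<Rightarrow> bool" where
  "incomplete_action n r E \<longleftrightarrow>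
     E \<subseteq> {1..r} \<times> {..<n} \<times> {1..r} \<and>
     (\<forall>x i y y'. (x, i, y) \<in> E \<longrightarrow> (x, i, y') \<in> E \<longrightarrow> y = y') \<and>
     (\<forall>x x' i y. (x, i, y) \<in> E \<longrightarrow> (x', i, y) \<in> E \<longrightarrow> x = x') \<and>
     (\<forall>x\<in>{1..r}. \<forall>y\<in>{1..r}. (x, y) \<in> {(x, y). \<exists>i. (x, i, y) \<in> E \<or> (y, i, x) \<in> E}\<^sup>*) \<and>
     (\<exists>s\<in>{1..r}. \<exists>i<n. \<forall>y. (s, i, y) \<notin> E)"

lemma funpow_mult_eq_id: "f ^^ a = id \<Longrightarrow> f ^^ (a * b) = id"
  by (simp add: funpow_mult[symmetric])

lemma swap_even_funpow: "even k \<Longrightarrow> Transposition.transpose a b ^^ k = id"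
  using funpow_mult_eq_id[where f = "Transposition.transpose a b" and a = 2] by (auto simp: numeral_2_eq_2 elim!: evenE)

lemma inv_funpow_eq:
  assumes "bij f" "f ^^ Suc k = id" shows "inv' (f ^^ k) = f"
  using assms by (intro inv_unique_comp) (simp_all flip: funpow_Suc_right add: funpow_swap1 comp_def)

text \<open>A transposition of two spare points repairs the parity, and even powers remove it
  again.\<close>

lemma ex_even_disjoint_extension:
  assumes "p permutes A" "a \<noteq> b" "{a, b} \<inter> A = {}" "finite A"
  obtains t where "t permutes {a, b}" "evenperm (p \<circ> t)" "\<And>k. even k \<Longrightarrow> t ^^ k = id"
proof (cases "evenperm p")
  case True
  show ?thesis by (rule that[of id]) (use True in auto)
next
  case False
  have "evenperm (p \<circ> Transposition.transpose a b)"
    using False assms(2) permutes_imp_permutation[OF assms(4,1)]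
    by (simp add: evenperm_comp permutation_swap_id evenperm_swap)
  then show ?thesis
    by (intro that[of "Transposition.transpose a b"]) (auto simp: permutes_swap_id swap_even_funpow)
qed

text \<open>An action on \<open>{1..r}\<close> in which \<open>\<sigma> i0\<close> is undefined at \<open>s\<close> is extended by two long cycles, one
  contained in \<open>\<sigma> j0\<close> and one in \<open>\<sigma> i0\<close>, that share the single point \<open>z\<close>. The remaining cycles have
  lengths dividing \<open>K\<close> and the long ones have length \<open>K + 1\<close>, so \<open>K\<close>-th powers isolate the inverses
  of the long cycles, and their commutator is a 3-cycle. The value \<open>Suc r\<close> of \<open>\<sigma> i0\<close> at \<open>s\<close> connects
  the old points with the new ones, and transpositions of spare new points correct the parity.\<close>

lemma complete_action:
  assumes "n \<ge> 2" and E: "incomplete_action n r E"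
  shows "\<exists>m>b. r \<le> m \<and> (\<exists>\<sigma>. generating_family n m \<sigma> \<and> (\<forall>x i y. (x, i, y) \<in> E \<longrightarrow> \<sigma> i x = y))"
proof -
  note E' = E[unfolded incomplete_action_def]
  note Esub = E'[THEN conjunct1]
    and Edet = E'[THEN conjunct2, THEN conjunct1, rule_format]
    and Einj = E'[THEN conjunct2, THEN conjunct2, THEN conjunct1, rule_format]
    and Econ = E'[THEN conjunct2, THEN conjunct2, THEN conjunct2, THEN conjunct1, rule_format]
    and inc = E'[THEN conjunct2, THEN conjunct2, THEN conjunct2, THEN conjunct2]
  obtain s i0 where s: "s \<in> {1..r}" "i0 < n" "\<And>y. (s, i0, y) \<notin> E"
    using inc by (elim bexE exE conjE) metis
  \<comment> \<open>An index different from \<open>i0\<close>; it exists because there are at least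
    two letters.\<close>
  define j0 :: nat where "j0 = (if i0 = 0 then 1 else 0)"
  have j0: "j0 < n" "j0 \<noteq> i0" using assms(1) by (auto simp: j0_def)
  \<comment> \<open>\<open>V i0\<close> also contains the new point \<open>Suc r\<close>, the
    prescribed image of \<open>s\<close>.\<close>
  define V where "V i = (if i = i0 then {1..Suc r} else {1..r})" for i
  define R where "R i = {(x, y). (x, i, y) \<in> E \<or> i = i0 \<and> x = s \<and> y = Suc r}" for i
  have "\<exists>p. p permutes V i \<and> (\<forall>x y. (x, y) \<in> R i \<longrightarrow> p x = y)" for i
  proof -
    have R: "R i \<subseteq> V i \<times> V i" "single_valued (R i)" "single_valued ((R i)\<inverse>)"
    proof -
      show "R i \<subseteq> V i \<times> V i" using Esub s by (auto simp: R_def V_def)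
      show "single_valued (R i)"
        unfolding single_valued_def R_def using Edet s(3) by auto
      show "single_valued ((R i)\<inverse>)"
        unfolding single_valued_def R_def using Einj Esub by auto
    qed
    have "finite (V i)" by (simp add: V_def)
    from extend_to_permutation[OF this R] show ?thesis by metis
  qed
  then obtain \<rho> where \<rho>: "\<And>i. \<rho> i permutes V i" "\<And>i x y. (x, y) \<in> R i \<Longrightarrow> \<rho> i x = y"
    by metis
  have perm: "permutation (\<rho> i)" for i
    by (rule permutes_imp_permutation[OF _ \<rho>(1)]) (simp add: V_def)
  obtain k1 where k1: "\<rho> i0 ^^ k1 = id" "k1 > 0" by (rule permutation_is_nilpotent[OF perm])
  obtain k2 where k2: "\<rho> j0 ^^ k2 = id" "k2 > 0" by (rule permutation_is_nilpotent[OF perm])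
  \<comment> \<open>\<open>k1\<close> and \<open>k2\<close> make the \<open>K\<close>-th powers of
    \<open>\<rho> i0\<close> and \<open>\<rho> j0\<close> trivial. The factor 2 removes the
    transpositions and makes cycles of length \<open>K + 1\<close> even. The last factor pushes the
    degree beyond \<open>b\<close> and leaves room for the spare points.\<close>
  define K where "K = 2 * (k1 * k2 * (b + r + 4))"
  have K: "even K" "\<rho> i0 ^^ K = id" "\<rho> j0 ^^ K = id" "K \<ge> b + r + 4"
  proof -
    show "\<rho> i0 ^^ K = id" using funpow_mult_eq_id[OF k1(1), of "2 * k2 * (b + r + 4)"]
      by (simp add: K_def mult_ac)
    show "\<rho> j0 ^^ K = id" using funpow_mult_eq_id[OF k2(1), of "2 * k1 * (b + r + 4)"]
      by (simp add: K_def mult_ac)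
    have "1 * (b + r + 4) \<le> (k1 * k2) * (b + r + 4)"
      using k1(2) k2(2) by (intro mult_le_mono1) (simp add: Suc_leI)
    then show "K \<ge> b + r + 4" by (simp add: K_def)
  qed (simp add: K_def)
  \<comment> \<open>The long cycles occupy \<open>{Suc r..z}\<close> and \<open>{z..m}\<close>, with
    \<open>K + 1\<close> points each and only \<open>z\<close> in common.\<close>
  define z where "z = r + K + 1"
  define m where "m = r + 2 * K + 1"
  let ?P = "{Suc r..z}" and ?Q = "{z..m}"
  define c where "c i = (if i = j0 then interval_cycle (Suc r) z else
    if i = i0 then interval_cycle z m else id)" for i
  define C where "C i = (if i = j0 then ?P else if i = i0 then ?Q else {})" for i
  \<comment> \<open>Each generator takes its spare points from the long cycle of another one, so no
    further points have to be added.\<close>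
  define T where "T i = (if i = j0 then {m - 1, m} else {r + 2, r + 3})" for i
  have c: "c i permutes C i" "evenperm (c i)" for i
    using K(1) interval_cycle_permutes by (auto simp: c_def C_def evenperm_interval_cycle z_def m_def)
  have disj: "C i \<inter> V i = {}" "C i \<inter> T i = {}" "V i \<inter> T i = {}" for i
    using K(4) j0 by (auto simp: C_def V_def T_def z_def m_def)
  have "\<exists>t. t permutes T i \<and> evenperm (\<rho> i \<circ> t) \<and> (\<forall>k. even k \<longrightarrow> t ^^ k = id)" for i
  proof (cases "i = j0")
    case True
    have "m - 1 \<noteq> m" "{m - 1, m} \<inter> V i = {}" "finite (V i)"
      using disj(3)[of i] True by (auto simp: T_def m_def V_def)
    from ex_even_disjoint_extension[OF \<rho>(1) this] show ?thesis using True by (metis T_def)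
  next
    case False
    have "r + 2 \<noteq> r + 3" "{r + 2, r + 3} \<inter> V i = {}" "finite (V i)"
      using disj(3)[of i] False by (auto simp: T_def V_def)
    from ex_even_disjoint_extension[OF \<rho>(1) this] show ?thesis using False by (metis T_def)
  qed
  then obtain t where t: "\<And>i. t i permutes T i" "\<And>i. evenperm (\<rho> i \<circ> t i)" "\<And>i k. even k \<Longrightarrow> t i ^^ k = id"
    by metis
  define \<sigma> where "\<sigma> i = c i \<circ> \<rho> i \<circ> t i" for i
  have sub: "C i \<subseteq> {1..m}" "V i \<subseteq> {1..m}" "T i \<subseteq> {1..m}" for i
    using K(4) by (auto simp: C_def V_def T_def z_def m_def)
  have \<sigma>: "\<sigma> i \<in> carrier (alt_group m)" for i
  proof -
    have "\<sigma> i permutes {1..m}"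
      unfolding \<sigma>_def using sub c(1) \<rho>(1) t(1) by (intro permutes_compose permutes_subset[OF _ sub(1)] permutes_subset[OF _ sub(2)] permutes_subset[OF _ sub(3)])
    moreover have "evenperm (\<sigma> i)"
    proof -
      have "permutation (c i)" by (rule permutes_imp_permutation[OF _ c(1)]) (simp add: C_def)
      moreover have "permutation (\<rho> i \<circ> t i)"
        by (rule permutation_compose[OF perm permutes_imp_permutation[OF _ t(1)]]) (simp add: T_def)
      ultimately show ?thesis
        using c(2) t(2) by (simp add: \<sigma>_def comp_assoc evenperm_comp)
    qed
    ultimately show ?thesis by (simp add: alt_group_carrier)
  qed
  have \<sigma>_V: "\<sigma> i x = \<rho> i x" if "x \<in> V i" for i x
  proof -
    have "t i x = x" using that disj(3)[of i] by (intro permutes_not_in[OF t(1)]) auto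
    moreover have "\<rho> i x \<in> V i" using that permutes_in_image[OF \<rho>(1)] by blast
    then have "c i (\<rho> i x) = \<rho> i x" using disj(1)[of i] by (intro permutes_not_in[OF c(1)]) auto
    ultimately show ?thesis by (simp add: \<sigma>_def)
  qed
  have \<sigma>_R: "\<sigma> i x = y" if "(x, y) \<in> R i" for i x y
  proof -
    have "x \<in> V i" using that Esub s by (auto simp: R_def V_def)
    then show ?thesis using \<sigma>_V \<rho>(2) that by simp
  qed
  then have \<sigma>_E: "\<sigma> i x = y" if "(x, i, y) \<in> E" for x i y
    using that by (auto simp: R_def)
  let ?H = "generate (alt_group m) (\<sigma> ` {..<n})"
  have H: "subgroup ?H (alt_group m)"
    by (rule group.generate_is_subgroup[OF alt_group_is_group]) (use \<sigma> in auto)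
  interpret H: perm_set ?H using subgroup_alt_perm_set[OF H] .
  have mem: "\<sigma> i \<in> ?H" if "i < n" for i using that by (auto intro: generate.incl)
  have id: "id \<in> ?H" using generate.one[of "alt_group m"] by (simp add: alt_group_one)
  have pow: "p ^^ k \<in> ?H" if "p \<in> ?H" for p k
    using that by (induction k) (use id in \<open>auto intro: H.comp_closed\<close>)
  have cH: "c i \<in> ?H" if i: "i = i0 \<or> i = j0" for i
  proof -
    have "\<rho> i ^^ K = id" using i K by auto
    then have "\<sigma> i ^^ K = c i ^^ K"
      unfolding \<sigma>_def using K(1) t(3) disj by (intro funpow_disjoint_permutes[OF c(1) \<rho>(1) t(1)]) auto
    moreover have "c i ^^ Suc K = id"
      using interval_cycle_funpow[of "Suc r" z] interval_cycle_funpow[of z m] i j0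
      by (auto simp: c_def z_def m_def)
    then have "inv' (c i ^^ K) = c i" using c(1) by (intro inv_funpow_eq permutes_bij)
    ultimately have "inv' (\<sigma> i ^^ K) = c i" by simp
    then show ?thesis using H.inv_closed[OF pow[OF mem, of i K]] i s(2) j0 by auto
  qed
  have cP: "c j0 x = (if Suc r \<le> x \<and> x < z then Suc x else if x = z then Suc r else x)" for x
    by (simp add: c_def interval_cycle_apply z_def)
  have cQ: "c i0 x = (if z \<le> x \<and> x < m then Suc x else if x = m then z else x)" for x
    using j0 by (simp add: c_def interval_cycle_apply z_def m_def)
  have zm: "Suc r < z" "z < m" using K(4) by (auto simp: z_def m_def)
  have com: "distinct [z, c i0 z, c j0 z]" "c i0 \<circ> c j0 \<circ> inv' (c i0) \<circ> inv' (c j0) = tricycle z (c i0 z) (c j0 z)"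
    by (rule commutator_tricycle[of "c j0" "c i0" z]; (rule permutes_bij[OF c(1)])?;
        use zm in \<open>auto simp: cP cQ split: if_splits\<close>)+
  have tri: "tricycle z (Suc z) (Suc r) \<in> ?H" "distinct [z, Suc z, Suc r]"
  proof -
    have "c i0 \<circ> c j0 \<circ> inv' (c i0) \<circ> inv' (c j0) \<in> ?H"
      using cH by (intro H.comp_closed H.inv_closed) auto
    then show "tricycle z (Suc z) (Suc r) \<in> ?H" unfolding com using zm by (simp add: cP cQ)
    show "distinct [z, Suc z, Suc r]" using zm by auto
  qed
  have "?H = carrier (alt_group m)"
  proof (rule alt_group_block_criterion[OF H tri(2,1)])
    show "{z, Suc z, Suc r} \<subseteq> {1..m}" using zm by auto
    fix B assume B: "{z, Suc z, Suc r} \<subseteq> B" "B \<subseteq> {1..m}"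
      and blk: "\<And>p. p \<in> ?H \<Longrightarrow> p ` B \<inter> B \<noteq> {} \<Longrightarrow> p ` B = B"
    have blk': "p ` B = B" if "p \<in> ?H" "x \<in> B" "p x \<in> B" for p x
      using blk[OF that(1)] that by blast
    have BP: "c j0 ` B = B" using blk'[of "c j0" z] cH B zm by (auto simp: cP)
    have P: "x \<in> B" if "Suc r \<le> x" "x \<le> z" for x
      using that
    proof (induction x rule: dec_induct)
      case (step x)
      then have "c j0 x = Suc x" by (simp add: cP)
      then show ?case using step BP by (metis Suc_leD imageI)
    qed (use B in auto)
    have BQ: "c i0 ` B = B" using blk'[of "c i0" z] cH B zm by (auto simp: cQ)
    have Q: "x \<in> B" if "z \<le> x" "x \<le> m" for x
      using that
    proof (induction x rule: dec_induct)
      case (step x)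
      then have "c i0 x = Suc x" by (simp add: cQ)
      then show ?case using step BQ by (metis Suc_leD imageI)
    qed (use B in auto)
    have PQ: "{Suc r..m} \<subseteq> B" using P Q by (metis atLeastAtMost_iff nat_le_linear subsetI)
    have finB: "finite B" using B finite_subset by blast
    have "card {Suc r..m} \<le> card B" using card_mono[OF finB PQ] .
    then have cardB: "2 * card B > m" using K(4) by (simp add: m_def)
    \<comment> \<open>\<open>B\<close> is a block that contains more than half of the points.\<close>
    have stable: "p ` B = B" if p: "p \<in> ?H" for p
    proof (rule blk[OF p], rule notI)
      have pm: "p permutes {1..m}" using subgroup.mem_carrier[OF H p] by (simp add: alt_group_carrier)
      assume "p ` B \<inter> B = {}"
      then have "card (p ` B \<union> B) = 2 * card B"
        using finB card_image[OF permutes_inj_on[OF pm], of B] by (simp add: card_Un_disjoint)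
      moreover have "p ` B \<union> B \<subseteq> {1..m}" using B(2) permutes_image[OF pm] by auto
      ultimately show False using card_mono[of "{1..m}" "p ` B \<union> B"] cardB by simp
    qed
    \<comment> \<open>Both directions are used, since the connectedness of \<open>E\<close> ignores
      the orientation of its edges.\<close>
    have stable_iff: "\<sigma> i x \<in> B \<longleftrightarrow> x \<in> B" if "i < n" for i x
      using stable[OF mem[OF that]] H.bij_mem[OF mem[OF that]]
      by (metis bij_is_inj inj_image_mem_iff)
    have "\<sigma> i0 s = Suc r" by (rule \<sigma>_R) (simp add: R_def)
    then have sB: "s \<in> B" using stable_iff[OF s(2), of s] B by simp
    have "x \<in> B" if x: "x \<in> {1..r}" for x
      using Econ[OF s(1) x]
    proof (induction rule: rtrancl_induct)
      case (step x y)
      then obtain i where "(x, i, y) \<in> E \<or> (y, i, x) \<in> E" by auto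
      then show ?case using Esub \<sigma>_E stable_iff[of i x] stable_iff[of i y] step by auto
    qed (rule sB)
    then show "{1..m} \<subseteq> B" using PQ
      by (metis atLeastAtMost_iff not_less_eq_eq subset_iff)
  qed
  then have "generating_family n m \<sigma>" using \<sigma> by (simp add: generating_family_def)
  moreover have "m > b" "r \<le> m" using K(4) by (auto simp: m_def)
  ultimately show ?thesis using \<sigma>_E by blast
qed

section \<open>One choice of permutations for all partial actions\<close>

lemma countable_incomplete_action: "countable {(r, E). incomplete_action n r E}"
proof (rule countable_subset)
  show "{(r, E). incomplete_action n r E} \<subseteq> UNIV \<times> Collect finite"
  proof safe
    fix r E assume "incomplete_action n r E"
    then have "E \<subseteq> {1..r} \<times> {..<n} \<times> {1..r}"
      unfolding incomplete_action_def by (rule conjunct1)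
    then show "finite E" by (rule finite_subset) simp
  qed simp
qed (simp add: countable_Collect_finite)

text \<open>A request is a partial action together with a bound, so that every action is asked for
  beyond each coordinate. The \<open>j\<close>-th request is met at coordinate \<open>f j\<close>,
  and \<open>f\<close> is strictly increasing, so no coordinate has to serve two requests.\<close>

lemma ex_solving_levels:
  assumes "n \<ge> 2"
  shows "\<exists>\<tau>. (\<forall>k\<ge>5. generating_family n k (\<tau> k)) \<and>
    (\<forall>r E b. incomplete_action n r E \<longrightarrow>
      (\<exists>k>b. k \<ge> 5 \<and> r \<le> k \<and> (\<forall>x i y. (x, i, y) \<in> E \<longrightarrow> \<tau> k i x = y)))"
proof -
  define S where "S = {(r, E). incomplete_action n r E} \<times> (UNIV :: nat set)"
  show ?thesis
  proof (cases "S = {}")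
    case True
    obtain \<tau> where "\<forall>k\<ge>5. generating_family n k (\<tau> k)"
      using ex_generating_family[OF _ assms] by metis
    moreover have "\<not> incomplete_action n r E" for r E using True by (auto simp: S_def)
    ultimately show ?thesis by blast
  next
    case False
    define U where "U j = from_nat_into S j" for j
    have "countable S" unfolding S_def using countable_incomplete_action by (intro countable_SIGMA) auto
    then have surj: "\<exists>j. U j = s" if "s \<in> S" for s
      using from_nat_into_surj[OF _ that] by (auto simp: U_def)
    have US: "incomplete_action n (fst (fst (U j))) (snd (fst (U j)))" for j
      using from_nat_into[OF False, of j] by (auto simp: U_def S_def)
    define P where "P j k \<longleftrightarrow> k > snd (U j) \<and> k \<ge> 5 \<and> fst (fst (U j)) \<le> k \<and>
      (\<exists>\<sigma>. generating_family n k \<sigma> \<and> (\<forall>x i y. (x, i, y) \<in> snd (fst (U j)) \<longrightarrow> \<sigma> i x = y))" for j k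
    have step: "\<exists>k. P j k \<and> k > b" for j b
    proof -
      obtain k where "k > b + snd (U j) + 5" "fst (fst (U j)) \<le> k"
        "\<exists>\<sigma>. generating_family n k \<sigma> \<and> (\<forall>x i y. (x, i, y) \<in> snd (fst (U j)) \<longrightarrow> \<sigma> i x = y)"
        using complete_action[OF assms US, of "b + snd (U j) + 5" j] by metis
      then show ?thesis unfolding P_def by (intro exI[of _ k] conjI) simp_all
    qed
    obtain f where f: "\<And>j. P j (f j)" "\<And>j. f j < f (Suc j)"
      using dependent_nat_choice[of P "\<lambda>_. (<)", OF step[THEN ex_forward] step] by metis
    have inj: "inj f" using f(2) by (intro strict_mono_imp_inj_on strict_monoI_Suc) 
    have "\<exists>\<sigma>. generating_family n k \<sigma> \<and>
        (\<forall>j. k = f j \<longrightarrow> (\<forall>x i y. (x, i, y) \<in> snd (fst (U j)) \<longrightarrow> \<sigma> i x = y))" if "k \<ge> 5" for k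
    proof (cases "k \<in> range f")
      case True
      then obtain j where j: "k = f j" by auto
      then obtain \<sigma> where "generating_family n k \<sigma>" "\<forall>x i y. (x, i, y) \<in> snd (fst (U j)) \<longrightarrow> \<sigma> i x = y"
        using f(1)[of j] by (auto simp: P_def)
      then show ?thesis using j inj by (intro exI[of _ \<sigma>]) (auto simp: inj_eq)
    next
      case False
      then show ?thesis using ex_generating_family[OF that assms] by auto
    qed
    then obtain \<tau> where \<tau>: "\<And>k. k \<ge> 5 \<Longrightarrow> generating_family n k (\<tau> k)"
      "\<And>k j. k \<ge> 5 \<Longrightarrow> k = f j \<Longrightarrow> (\<forall>x i y. (x, i, y) \<in> snd (fst (U j)) \<longrightarrow> \<tau> k i x = y)"
      by metis
    have "\<exists>k>b. k \<ge> 5 \<and> r \<le> k \<and> (\<forall>x i y. (x, i, y) \<in> E \<longrightarrow> \<tau> k i x = y)"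
      if E: "incomplete_action n r E" for r E b
    proof -
      obtain j where j: "U j = ((r, E), b)" using surj[of "((r, E), b)"] E by (auto simp: S_def)
      then have "b < f j" "5 \<le> f j" "r \<le> f j" using f(1)[of j] by (auto simp: P_def)
      then show ?thesis using \<tau>(2)[of "f j" j] j by auto
    qed
    then show ?thesis using \<tau>(1) by blast
  qed
qed

text \<open>A coordinate that completes this star has letters with pairwise different values at 1.
  This is how the generators are seen to be distinct, hence \<open>n\<close> in number.\<close>

lemma incomplete_action_star:
  assumes "n \<ge> 2"
  shows "incomplete_action n (Suc n) {(1, i, i + 2) | i. i < n}" (is "incomplete_action _ _ ?E")
  unfolding incomplete_action_def
proof (intro conjI ballI)
  let ?A = "{(x, y). \<exists>i. (x, i, y) \<in> ?E \<or> (y, i, x) \<in> ?E}"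
  have 1: "(1, x) \<in> ?A\<^sup>*" "(x, 1) \<in> ?A\<^sup>*" if "x \<in> {1..Suc n}" for x
  proof -
    have "x = 1 \<or> (\<exists>i<n. x = i + 2)"
      using that by (cases "x = 1") (auto intro!: exI[of _ "x - 2"])
    then show "(1, x) \<in> ?A\<^sup>*" "(x, 1) \<in> ?A\<^sup>*" by (auto intro: r_into_rtrancl)
  qed
  show "(x, y) \<in> ?A\<^sup>*" if "x \<in> {1..Suc n}" "y \<in> {1..Suc n}" for x y
    using 1(2)[OF that(1)] 1(1)[OF that(2)] by (rule rtrancl_trans)
  show "\<exists>s\<in>{1..Suc n}. \<exists>i<n. \<forall>y. (s, i, y) \<notin> ?E"
    using assms by (intro bexI[of _ 2] exI[of _ 0]) auto
qed auto

section \<open>Subdirect products of alternating groups\<close>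

lemma group_alt_prod: "group alt_prod"
  by (simp add: alt_prod_def alt_group_is_group)

lemma carrier_alt_prod: "carrier alt_prod = (\<Pi>\<^sub>E k\<in>{5..}. carrier (alt_group k))"
  by (simp add: alt_prod_def)

lemma alt_prod_mem: "x \<in> carrier alt_prod \<Longrightarrow> k \<ge> 5 \<Longrightarrow> x k \<in> carrier (alt_group k)"
  by (auto simp: carrier_alt_prod)

lemma alt_prod_mult: "k \<ge> 5 \<Longrightarrow> (x \<otimes>\<^bsub>alt_prod\<^esub> y) k = x k \<circ> y k"
  by (simp add: alt_prod_def alt_group_mult)

lemma alt_prod_one: "k \<ge> 5 \<Longrightarrow> \<one>\<^bsub>alt_prod\<^esub> k = id"
  by (simp add: alt_prod_def alt_group_one)

lemma alt_prod_inv: "x \<in> carrier alt_prod \<Longrightarrow> k \<ge> 5 \<Longrightarrow> (inv\<^bsub>alt_prod\<^esub> x) k = inv' (x k)"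
  using alt_prod_mem[of x k]
  by (simp add: alt_prod_def alt_group_inv_equality alt_group_is_group)

lemma card_alt_group_less:
  assumes "2 \<le> j" "j < m"
  shows "card (carrier (alt_group j)) < card (carrier (alt_group m))"
proof -
  have "fact j < (fact m :: nat)" using assms by (intro fact_less_mono) auto
  then show ?thesis
    using alt_group_card_carrier[of j] alt_group_card_carrier[of m] assms by linarith
qed

lemma finite_carrier_alt_group: "finite (carrier (alt_group m))"
  by (rule finite_subset[OF _ finite_permutations[of "{1..m}"]]) (auto simp: alt_group_carrier)

context
  fixes H
  assumes H: "subgroup H alt_prod"
    and surj: "\<And>k. k \<ge> 5 \<Longrightarrow> (\<lambda>h. h k) ` H = carrier (alt_group k)"
begin

lemma subdirect_carrier: "h \<in> H \<Longrightarrow> h \<in> carrier alt_prod"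
  using subgroup.mem_carrier[OF H] .

text \<open>As \<open>j\<close> grows to \<open>m\<close>, this measures how freely coordinate
  \<open>m\<close> can be prescribed without disturbing the coordinates below
  \<open>j\<close>.\<close>

definition tail_image :: "nat \<Rightarrow> nat \<Rightarrow> (nat \<Rightarrow> nat) set" where
  "tail_image j m = {h m | h. h \<in> H \<and> (\<forall>k\<in>{5..<j}. h k = id)}"

text \<open>Conjugation by an element of \<open>H\<close> keeps the earlier coordinates trivial and
  \<open>H\<close> projects onto the factor, so this is a normal subgroup of a simple group.\<close>

lemma tail_image_cases:
  assumes m: "m \<ge> 5"
  shows "tail_image j m = {id} \<or> tail_image j m = carrier (alt_group m)"
proof -
  have "subgroup (tail_image j m) (alt_group m)"
  proof
    show "tail_image j m \<subseteq> carrier (alt_group m)"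
      using alt_prod_mem[OF subdirect_carrier m] by (auto simp: tail_image_def)
    show "x \<otimes>\<^bsub>alt_group m\<^esub> y \<in> tail_image j m" if x: "x \<in> tail_image j m" and y: "y \<in> tail_image j m" for x y
    proof -
      obtain g where g: "g \<in> H" "x = g m" "\<forall>k\<in>{5..<j}. g k = id"
        using x by (auto simp: tail_image_def)
      obtain h where h: "h \<in> H" "y = h m" "\<forall>k\<in>{5..<j}. h k = id"
        using y by (auto simp: tail_image_def)
      show ?thesis
        using g h m subgroup.m_closed[OF H g(1) h(1)] unfolding tail_image_def
        by (auto simp: alt_group_mult alt_prod_mult intro!: exI[of _ "g \<otimes>\<^bsub>alt_prod\<^esub> h"])
    qed
    show "\<one>\<^bsub>alt_group m\<^esub> \<in> tail_image j m"
      using m subgroup.one_closed[OF H] unfolding tail_image_def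
      by (auto simp: alt_group_one alt_prod_one intro!: exI[of _ "\<one>\<^bsub>alt_prod\<^esub>"])
    show "inv\<^bsub>alt_group m\<^esub> x \<in> tail_image j m" if x: "x \<in> tail_image j m" for x
    proof -
      obtain g where g: "g \<in> H" "x = g m" "\<forall>k\<in>{5..<j}. g k = id"
        using x by (auto simp: tail_image_def)
      then show ?thesis
        using m subgroup.m_inv_closed[OF H g(1)] alt_prod_mem[OF subdirect_carrier[OF g(1)]] unfolding tail_image_def
        by (auto simp: alt_group_inv_equality alt_prod_inv[OF subdirect_carrier[OF g(1)]] inv_id intro!: exI[of _ "inv\<^bsub>alt_prod\<^esub> g"])
    qed
  qed
  moreover have "p \<circ> q \<circ> inv' p \<in> tail_image j m"
    if p: "p \<in> carrier (alt_group m)" and q: "q \<in> tail_image j m" for p q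
  proof -
    obtain h where h: "h \<in> H" "q = h m" "\<forall>k\<in>{5..<j}. h k = id"
      using q by (auto simp: tail_image_def)
    have "p \<in> (\<lambda>h. h m) ` H" using surj[OF m] p by simp
    then obtain g where g: "g \<in> H" "p = g m" by auto
    let ?c = "g \<otimes>\<^bsub>alt_prod\<^esub> h \<otimes>\<^bsub>alt_prod\<^esub> inv\<^bsub>alt_prod\<^esub> g"
    have c: "?c k = g k \<circ> h k \<circ> inv' (g k)" if "k \<ge> 5" for k
      using that by (simp add: alt_prod_mult alt_prod_inv[OF subdirect_carrier[OF g(1)]])
    have "?c k = id" if "k \<in> {5..<j}" for k
    proof -
      have "g k permutes {1..k}"
        using alt_prod_mem[OF subdirect_carrier[OF g(1)], of k] that by (simp add: alt_group_carrier)
      then show ?thesis using c[of k] h(3) that by (simp add: permutes_inv_o)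
    qed
    moreover have "?c \<in> H"
      using g h by (intro subgroup.m_closed[OF H] subgroup.m_inv_closed[OF H])
    moreover have "p \<circ> q \<circ> inv' p = ?c m" using c[OF m] g(2) h(2) by simp
    ultimately show ?thesis unfolding tail_image_def by (intro CollectI exI[of _ ?c]) simp
  qed
  ultimately show ?thesis using alt_group_simple[OF m] by blast
qed

text \<open>If the image shrinks from everything to nothing at stage \<open>j\<close>, then \<open>h m\<close> is a function
  of \<open>h j\<close>, which is impossible because \<open>alt_group j\<close> is smaller than \<open>alt_group m\<close>.\<close>

lemma tail_image_Suc:
  assumes j: "5 \<le> j" "j < m" and full: "tail_image j m = carrier (alt_group m)"
  shows "tail_image (Suc j) m = carrier (alt_group m)"
proof (rule ccontr)
  assume "tail_image (Suc j) m \<noteq> carrier (alt_group m)"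
  then have triv: "tail_image (Suc j) m = {id}" using tail_image_cases[of m "Suc j"] j by auto
  have "\<forall>s\<in>carrier (alt_group m). \<exists>h. h \<in> H \<and> h m = s \<and> (\<forall>k\<in>{5..<j}. h k = id)"
    unfolding full[symmetric] tail_image_def by auto
  then obtain h where h: "\<And>s. s \<in> carrier (alt_group m) \<Longrightarrow> h s \<in> H \<and> h s m = s \<and> (\<forall>k\<in>{5..<j}. h s k = id)"
    by metis
  have "inj_on (\<lambda>s. h s j) (carrier (alt_group m))"
  proof (rule inj_onI)
    fix s t assume st: "s \<in> carrier (alt_group m)" "t \<in> carrier (alt_group m)" "h s j = h t j"
    let ?x = "inv\<^bsub>alt_prod\<^esub> (h s) \<otimes>\<^bsub>alt_prod\<^esub> h t"
    have hs: "h s \<in> H" "h t \<in> H" using h st by auto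
    have x: "?x k = inv' (h s k) \<circ> h t k" "h s k permutes {1..k}" if "k \<ge> 5" for k
      using that alt_prod_mem[OF subdirect_carrier[OF hs(1)], of k]
      by (simp_all add: alt_prod_mult alt_prod_inv[OF subdirect_carrier[OF hs(1)]] alt_group_carrier)
    have "?x k = id" if "k \<in> {5..<Suc j}" for k
    proof (cases "k = j")
      case True
      then show ?thesis using x[of j] j st(3) by (simp add: permutes_inv_o)
    next
      case False
      then have "h s k = id" "h t k = id" using that h st by auto
      then show ?thesis using x(1)[of k] that by (simp add: inv_id)
    qed
    moreover have "?x \<in> H"
      using hs by (intro subgroup.m_closed[OF H] subgroup.m_inv_closed[OF H])
    ultimately have "?x m \<in> tail_image (Suc j) m" unfolding tail_image_def by blast
    then have "inv' s \<circ> t = id" using triv x(1)[of m] j h st by simp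
    moreover have "s permutes {1..m}" using st(1) by (simp add: alt_group_carrier)
    ultimately show "s = t"
      by (metis comp_assoc comp_id id_comp permutes_inv_o(1))
  qed
  moreover have "(\<lambda>s. h s j) ` carrier (alt_group m) \<subseteq> carrier (alt_group j)"
    using h alt_prod_mem[OF subdirect_carrier j(1)] by auto
  ultimately have "card (carrier (alt_group m)) \<le> card (carrier (alt_group j))"
    using card_inj_on_le finite_carrier_alt_group by blast
  then show False using card_alt_group_less[of j m] j by simp
qed

lemma tail_image_full:
  assumes "m \<ge> 5" shows "tail_image m m = carrier (alt_group m)"
proof -
  have "j \<le> m \<longrightarrow> tail_image j m = carrier (alt_group m)" if "5 \<le> j" for j
    using that
  proof (induction j rule: dec_induct)
    case base
    show ?case using surj[OF assms] by (auto simp: tail_image_def)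
  next
    case (step j)
    then show ?case using tail_image_Suc[of j m] by auto
  qed
  then show ?thesis using assms by blast
qed

text \<open>The coordinates are corrected one at a time: \<open>tail_image_full\<close> supplies an
  element of \<open>H\<close> with any desired value at \<open>Suc m\<close> that leaves the earlier
  coordinates alone.\<close>

lemma subdirect_dense:
  assumes g: "g \<in> carrier alt_prod"
  shows "\<exists>h\<in>H. \<forall>k\<in>{5..m}. h k = g k"
proof (induction m)
  case 0
  show ?case using subgroup.one_closed[OF H] by (intro bexI[of _ "\<one>\<^bsub>alt_prod\<^esub>"]) auto
next
  case (Suc m)
  then obtain h where h: "h \<in> H" "\<And>k. k \<in> {5..m} \<Longrightarrow> h k = g k" by blast
  show ?case
  proof (cases "Suc m \<ge> 5")
    case False
    then show ?thesis using h(1) by (intro bexI[of _ h]) auto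
  next
    case True
    let ?d = "inv\<^bsub>alt_prod\<^esub> h \<otimes>\<^bsub>alt_prod\<^esub> g"
    have "?d \<in> carrier alt_prod"
      using group.is_monoid[OF group_alt_prod] group.inv_closed[OF group_alt_prod subdirect_carrier[OF h(1)]] g
      by (simp add: monoid.m_closed)
    then have "?d (Suc m) \<in> tail_image (Suc m) (Suc m)"
      using tail_image_full[OF True] alt_prod_mem[OF _ True] by simp
    then obtain x where x: "x \<in> H" "x (Suc m) = ?d (Suc m)" "\<forall>k\<in>{5..<Suc m}. x k = id"
      unfolding tail_image_def by auto
    have "(h \<otimes>\<^bsub>alt_prod\<^esub> x) k = g k" if "k \<in> {5..Suc m}" for k
    proof (cases "k = Suc m")
      case False
      then show ?thesis using that x(3) h(2)[of k] by (simp add: alt_prod_mult)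
    next
      case k: True
      have "h k permutes {1..k}"
        using alt_prod_mem[OF subdirect_carrier[OF h(1)], of k] True k by (simp add: alt_group_carrier)
      then have "h k \<circ> (inv' (h k) \<circ> g k) = g k"
        by (metis comp_assoc id_comp permutes_inv_o(1))
      then show ?thesis
        using x(2) True k by (simp add: alt_prod_mult alt_prod_inv[OF subdirect_carrier[OF h(1)]])
    qed
    moreover have "h \<otimes>\<^bsub>alt_prod\<^esub> x \<in> H" using subgroup.m_closed[OF H h(1) x(1)] .
    ultimately show ?thesis by blast
  qed
qed

end

section \<open>Limits of finite discrete spaces\<close>

lemma directed_finite_lower_bound:
  assumes "J \<noteq> {}" "\<And>i j. i \<in> J \<Longrightarrow> j \<in> J \<Longrightarrow> \<exists>k\<in>J. C k \<subseteq> C i \<inter> C j" "finite F" "F \<subseteq> J"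
  shows "\<exists>k\<in>J. \<forall>j\<in>F. C k \<subseteq> C j"
  using assms(3,4)
proof (induction F)
  case empty then show ?case using assms(1) by blast
next
  case (insert i F)
  then obtain k where k: "k \<in> J" "\<forall>j\<in>F. C k \<subseteq> C j" by auto
  moreover have "i \<in> J" using insert.prems by simp
  ultimately obtain l where "l \<in> J" "C l \<subseteq> C i \<inter> C k" using assms(2) by metis
  then show ?case using k by (intro bexI[of _ l]) auto
qed

lemma compact_directed_Inter_nonempty:
  assumes X: "compact_space X" and J: "J \<noteq> {}"
    and C: "\<And>j. j \<in> J \<Longrightarrow> closedin X (C j)" "\<And>j. j \<in> J \<Longrightarrow> C j \<noteq> {}"
    and dir: "\<And>i j. i \<in> J \<Longrightarrow> j \<in> J \<Longrightarrow> \<exists>k\<in>J. C k \<subseteq> C i \<inter> C j"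
  shows "(\<Inter>j\<in>J. C j) \<noteq> {}"
proof -
  have "\<Inter>\<F> \<noteq> {}" if F: "finite \<F>" "\<F> \<subseteq> C ` J" for \<F>
  proof -
    obtain F where "F \<subseteq> J" "finite F" "\<F> = C ` F" using finite_subset_image[OF F] by auto
    moreover obtain k where "k \<in> J" "\<forall>j\<in>F. C k \<subseteq> C j"
      using directed_finite_lower_bound[of J C F, OF J dir] calculation by blast
    moreover have "C k \<noteq> {}" using C(2) \<open>k \<in> J\<close> .
    ultimately show ?thesis by fast
  qed
  then show ?thesis using X[unfolded compact_space_fip, rule_format, of "C ` J"] C(1) by blast
qed

text \<open>Levels, images of subgraphs and finite quotients carry different discrete codomains;
  this passes between them.\<close>

lemma continuous_map_discrete_cong:
  assumes "continuous_map X (discrete_topology S) f" "f ` topspace X \<subseteq> T"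
  shows "continuous_map X (discrete_topology T) f"
proof -
  have "openin X {x \<in> topspace X. f x \<in> U}" for U
  proof -
    have "{x \<in> topspace X. f x \<in> U} = {x \<in> topspace X. f x \<in> U \<inter> S}"
      using continuous_map_image_subset_topspace[OF assms(1)] by auto
    moreover have "openin X {x \<in> topspace X. f x \<in> U \<inter> S}"
      using assms(1) by (intro openin_continuous_map_preimage) auto
    ultimately show ?thesis by simp
  qed
  then show ?thesis using assms(2) by (auto simp: continuous_map_def)
qed

lemma closedin_discrete_preimage:
  assumes "continuous_map X (discrete_topology S) f"
  shows "closedin X {x \<in> topspace X. f x \<in> B}"
proof -
  have "continuous_map X (discrete_topology UNIV) f"
    by (rule continuous_map_discrete_cong[OF assms]) simp
  then show ?thesis by (rule closedin_continuous_map_preimage) simp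
qed

text \<open>A compact space presented as the limit of a sequence of finite images. The implication
  \<open>refine\<close> stands for the connecting maps, so none have to be carried along. Vertices
  and edges are both treated as instances.\<close>

locale level_space =
  fixes X :: "'a topology" and p :: "nat \<Rightarrow> 'a \<Rightarrow> 'b"
  assumes compact: "compact_space X"
    and cont: "continuous_map X (discrete_topology (p m ` topspace X)) (p m)"
    and fin: "finite (p m ` topspace X)"
    and refine: "\<lbrakk>x \<in> topspace X; y \<in> topspace X; m \<le> k; p k x = p k y\<rbrakk> \<Longrightarrow> p m x = p m y"
    and sep: "\<lbrakk>x \<in> topspace X; y \<in> topspace X; \<And>m. p m x = p m y\<rbrakk> \<Longrightarrow> x = y"
begin

lemma closedin_fibre: "closedin X {x \<in> topspace X. p m x \<in> B}"
  by (rule closedin_discrete_preimage[OF cont])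

text \<open>For each point of the finite level that the image of the intersection misses,
  compactness gives a member whose image misses it; a common lower bound of these finitely many
  members works.\<close>

lemma directed_level:
  assumes J: "J \<noteq> {}" and C: "\<And>j. j \<in> J \<Longrightarrow> closedin X (C j)"
    and dir: "\<And>i j. i \<in> J \<Longrightarrow> j \<in> J \<Longrightarrow> \<exists>k\<in>J. C k \<subseteq> C i \<inter> C j"
  shows "\<exists>j\<in>J. p m ` C j \<subseteq> p m ` (\<Inter>j\<in>J. C j)"
proof -
  let ?bad = "p m ` topspace X - p m ` (\<Inter>j\<in>J. C j)"
  have "\<exists>j\<in>J. b \<notin> p m ` C j" if b: "b \<in> ?bad" for b
  proof (rule ccontr)
    assume "\<not> ?thesis"
    then have ne: "\<forall>j\<in>J. b \<in> p m ` C j" by blast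
    let ?C = "\<lambda>j. C j \<inter> {x \<in> topspace X. p m x \<in> {b}}"
    have "(\<Inter>j\<in>J. ?C j) \<noteq> {}"
    proof (rule compact_directed_Inter_nonempty[OF compact J])
      show "closedin X (?C j)" if "j \<in> J" for j
        using C[OF that] closedin_fibre by (rule closedin_Int)
      show "?C j \<noteq> {}" if "j \<in> J" for j
        using ne that closedin_subset[OF C[OF that]] by fastforce
      show "\<exists>k\<in>J. ?C k \<subseteq> ?C i \<inter> ?C j" if "i \<in> J" "j \<in> J" for i j
        using dir[OF that] by blast
    qed
    then obtain x where "\<forall>j\<in>J. x \<in> ?C j" by blast
    then have "x \<in> (\<Inter>j\<in>J. C j)" "p m x = b" using J by auto
    then show False using b by blast
  qed
  then obtain j where j: "\<And>b. b \<in> ?bad \<Longrightarrow> j b \<in> J \<and> b \<notin> p m ` C (j b)" by metis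
  have "finite (j ` ?bad)" "j ` ?bad \<subseteq> J" using fin j by auto
  then obtain k where k: "k \<in> J" "\<forall>i\<in>j ` ?bad. C k \<subseteq> C i"
    using directed_finite_lower_bound[of J C, OF J dir] by meson
  have "p m ` C k \<subseteq> p m ` (\<Inter>j\<in>J. C j)"
  proof (rule subsetI, rule ccontr)
    fix b assume b: "b \<in> p m ` C k" "b \<notin> p m ` (\<Inter>j\<in>J. C j)"
    then have "b \<in> ?bad" using closedin_subset[OF C[OF k(1)]] by blast
    then show False using j[of b] k(2) b(1) by blast
  qed
  then show ?thesis using k(1) by blast
qed

text \<open>The points of \<open>S\<close> that agree with \<open>x\<close> at level
  \<open>m\<close> form decreasing nonempty closed sets, and a common point of them equals
  \<open>x\<close> by \<open>sep\<close>.\<close>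

lemma closed_limit:
  assumes S: "closedin X S" and x: "x \<in> topspace X" "\<And>m. p m x \<in> p m ` S"
  shows "x \<in> S"
proof -
  let ?C = "\<lambda>m. S \<inter> {y \<in> topspace X. p m y \<in> {p m x}}"
  have "(\<Inter>m. ?C m) \<noteq> {}"
  proof (rule compact_directed_Inter_nonempty[OF compact])
    show "closedin X (?C m)" for m using S closedin_fibre by (rule closedin_Int)
    show "?C m \<noteq> {}" for m using x(2)[of m] closedin_subset[OF S] by fastforce
    show "\<exists>k\<in>UNIV. ?C k \<subseteq> ?C i \<inter> ?C j" for i j
    proof (intro bexI subsetI)
      fix y assume "y \<in> ?C (max i j)"
      then show "y \<in> ?C i \<inter> ?C j"
        using refine[of y x i "max i j"] refine[of y x j "max i j"] x(1) by auto
    qed simp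
  qed simp
  then obtain y where "\<And>m. y \<in> ?C m" by blast
  then have "y \<in> S" "y = x" using sep[of y x] x(1) by auto
  then show ?thesis by simp
qed

text \<open>Two different fibres of \<open>f\<close> are disjoint closed sets, so compactness
  separates their images at some level. There are finitely many pairs of values, so the maximum of
  these levels separates all fibres.\<close>

lemma continuous_factor:
  assumes W: "closedin X W" and f: "continuous_map (subtopology X W) (discrete_topology D) f"
    and D: "finite D"
  shows "\<exists>m. \<forall>x\<in>W. \<forall>y\<in>W. p m x = p m y \<longrightarrow> f x = f y"
proof -
  let ?W = "\<lambda>a. {x \<in> W. f x = a}"
  have W_sub: "W \<subseteq> topspace X" using closedin_subset[OF W] .
  have fW: "f x \<in> D" if "x \<in> W" for x
    using continuous_map_image_subset_topspace[OF f] that W_sub by auto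
  have cl: "closedin X (?W a)" for a
  proof -
    have "closedin (subtopology X W) {x \<in> topspace (subtopology X W). f x \<in> {a}}"
      by (rule closedin_discrete_preimage[OF f])
    moreover have "{x \<in> topspace (subtopology X W). f x \<in> {a}} = ?W a" using W_sub by auto
    ultimately show ?thesis using closedin_trans_full W by metis
  qed
  have "\<exists>m. p m ` ?W a \<inter> p m ` ?W b = {}" if ab: "a \<noteq> b" for a b
  proof (rule ccontr)
    assume "\<not> ?thesis"
    then have ne: "\<And>m. p m ` ?W a \<inter> p m ` ?W b \<noteq> {}" by blast
    let ?C = "\<lambda>m. ?W a \<inter> {x \<in> topspace X. p m x \<in> p m ` ?W b}"
    have "(\<Inter>m. ?C m) \<noteq> {}"
    proof (rule compact_directed_Inter_nonempty[OF compact])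
      show "closedin X (?C m)" for m using cl closedin_fibre by (rule closedin_Int)
      show "?C m \<noteq> {}" for m
      proof -
        obtain x where "x \<in> ?W a" "p m x \<in> p m ` ?W b" using ne[of m] by blast
        then have "x \<in> ?C m" using W_sub by blast
        then show ?thesis by blast
      qed
      show "\<exists>k\<in>UNIV. ?C k \<subseteq> ?C i \<inter> ?C j" for i j
      proof (intro bexI subsetI)
        fix y assume y: "y \<in> ?C (max i j)"
        then obtain z where z: "z \<in> ?W b" "p (max i j) y = p (max i j) z" by blast
        have "p i y = p i z" "p j y = p j z"
          using refine[of y z i "max i j"] refine[of y z j "max i j"] y z W_sub by auto
        then show "y \<in> ?C i \<inter> ?C j" using y z by blast
      qed simp
    qed simp
    then obtain x where x: "\<And>m. x \<in> ?C m" by blast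
    have "x \<in> topspace X" "\<And>m. p m x \<in> p m ` ?W b" using x by blast+
    then have "x \<in> ?W b" by (rule closed_limit[OF cl])
    then show False using x ab by blast
  qed
  then obtain m where m: "\<And>a b. a \<noteq> b \<Longrightarrow> p (m a b) ` ?W a \<inter> p (m a b) ` ?W b = {}" by metis
  define M where "M = Max ((\<lambda>(a, b). m a b) ` (D \<times> D))"
  have "f x = f y" if xy: "x \<in> W" "y \<in> W" "p M x = p M y" for x y
  proof (rule ccontr)
    assume ne: "f x \<noteq> f y"
    have "m (f x) (f y) \<le> M"
      unfolding M_def using fW xy D by (intro Max_ge) auto
    then have "p (m (f x) (f y)) x = p (m (f x) (f y)) y"
      using refine xy W_sub by blast
    then show False using m[OF ne] xy by blast
  qed
  then show ?thesis by blast
qed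

end

text \<open>A continuous bijection from a compact space onto a Hausdorff space. It is surjective by
  compactness, applied to the directed fibres over the entries of a compatible family.\<close>

lemma limit_homeomorphic:
  assumes X: "compact_space X" and I: "I \<noteq> {}"
    and cont: "\<And>i. i \<in> I \<Longrightarrow> continuous_map X (discrete_topology (S i)) (P i)"
    and surj: "\<And>i. i \<in> I \<Longrightarrow> P i ` topspace X = S i"
    and comp: "\<And>i j x. i \<in> I \<Longrightarrow> j \<in> I \<Longrightarrow> R i j \<Longrightarrow> x \<in> topspace X \<Longrightarrow> c i j (P j x) = P i x"
    and dir: "\<And>i j. i \<in> I \<Longrightarrow> j \<in> I \<Longrightarrow> \<exists>k\<in>I. R i k \<and> R j k"
    and sep: "\<And>x y. x \<in> topspace X \<Longrightarrow> y \<in> topspace X \<Longrightarrow> (\<And>i. i \<in> I \<Longrightarrow> P i x = P i y) \<Longrightarrow> x = y"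
  shows "homeomorphic_map X
    (subtopology (product_topology (\<lambda>i. discrete_topology (S i)) I) (compatible_families I R S c))
    (\<lambda>x. \<lambda>i\<in>I. P i x)" (is "homeomorphic_map X ?Y ?f")
proof (rule continuous_imp_homeomorphic_map)
  have mem: "?f x \<in> compatible_families I R S c" if "x \<in> topspace X" for x
    using that surj comp by (auto simp: compatible_families_def)
  show "continuous_map X ?Y ?f"
    unfolding continuous_map_in_subtopology
  proof
    show "continuous_map X (product_topology (\<lambda>i. discrete_topology (S i)) I) ?f"
      unfolding continuous_map_componentwise using cont by auto
  qed (use mem in auto)
  show "Hausdorff_space ?Y"
    by (intro Hausdorff_space_subtopology) (simp add: Hausdorff_space_product_topology)
  show "inj_on ?f (topspace X)"
  proof (rule inj_onI)
    fix x y assume xy: "x \<in> topspace X" "y \<in> topspace X" "?f x = ?f y"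
    then show "x = y" using sep by (metis restrict_apply')
  qed
  have top: "topspace ?Y = compatible_families I R S c"
    by (auto simp: compatible_families_def)
  show "?f ` topspace X = topspace ?Y"
  proof
    show "?f ` topspace X \<subseteq> topspace ?Y" using mem top by auto
    show "topspace ?Y \<subseteq> ?f ` topspace X"
    proof
      fix y assume "y \<in> topspace ?Y"
      then have y: "y \<in> (\<Pi>\<^sub>E i\<in>I. S i)" "\<And>i j. i \<in> I \<Longrightarrow> j \<in> I \<Longrightarrow> R i j \<Longrightarrow> c i j (y j) = y i"
        unfolding top compatible_families_def by auto
      let ?C = "\<lambda>i. {x \<in> topspace X. P i x \<in> {y i}}"
      have "(\<Inter>i\<in>I. ?C i) \<noteq> {}"
      proof (rule compact_directed_Inter_nonempty[OF X I])
        show "closedin X (?C i)" if "i \<in> I" for i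
          by (rule closedin_discrete_preimage[OF cont[OF that]])
        show "?C i \<noteq> {}" if "i \<in> I" for i
        proof -
          have "y i \<in> P i ` topspace X" using surj[OF that] y(1) that by auto
          then show ?thesis by auto
        qed
        show "\<exists>k\<in>I. ?C k \<subseteq> ?C i \<inter> ?C j" if ij: "i \<in> I" "j \<in> I" for i j
        proof -
          obtain k where k: "k \<in> I" "R i k" "R j k" using dir[OF ij] by blast
          have "?C k \<subseteq> ?C i \<inter> ?C j"
          proof
            fix x assume x: "x \<in> ?C k"
            then have "P i x = c i k (y k)" "P j x = c j k (y k)"
              using comp[of i k x] comp[of j k x] ij k by auto
            then show "x \<in> ?C i \<inter> ?C j" using x y(2) ij k by simp
          qed
          then show ?thesis using k(1) by blast
        qed
      qed
      then obtain x where x: "\<forall>i\<in>I. x \<in> ?C i" by blast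
      then have "?f x = y" using y(1) by (intro extensionalityI[of _ I]) (auto simp: PiE_def)
      moreover have "x \<in> topspace X" using x I by auto
      ultimately show "y \<in> ?f ` topspace X" by blast
    qed
  qed
qed (rule X)

section \<open>Towers of finite quotient graphs\<close>

text \<open>Finite quotients and inverse systems are formulated with graphs on \<open>nat\<close>;
  this moves an arbitrary finite graph there.\<close>

definition transport_graph ::
  "('v \<Rightarrow> 'w) \<Rightarrow> ('e \<Rightarrow> 'f) \<Rightarrow> ('v, 'e) sgraph \<Rightarrow> ('w, 'f) sgraph" where
  "transport_graph \<phi> \<psi> \<Delta> =
     \<lparr>verts = \<phi> ` verts \<Delta>, edges = \<psi> ` edges \<Delta>, pos_edges = \<psi> ` pos_edges \<Delta>,
      ini = (\<lambda>e. \<phi> (ini \<Delta> (inv_into (edges \<Delta>) \<psi> e))),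
      ter = (\<lambda>e. \<phi> (ter \<Delta> (inv_into (edges \<Delta>) \<psi> e))),
      einv = (\<lambda>e. \<psi> (einv \<Delta> (inv_into (edges \<Delta>) \<psi> e)))\<rparr>"

lemma transport_graph:
  assumes \<Delta>: "finite_graph \<Delta>" and inj: "inj_on \<psi> (edges \<Delta>)"
  shows "finite_graph (transport_graph \<phi> \<psi> \<Delta>)" "graph_hom \<Delta> (transport_graph \<phi> \<psi> \<Delta>) \<phi> \<psi>"
proof -
  have s: "serre_graph \<Delta>" using \<Delta> by (simp add: finite_graph_def)
  have pos: "pos_edges \<Delta> \<subseteq> edges \<Delta>" using s by (simp add: serre_graph_def)
  have mem: "\<psi> e \<in> \<psi> ` pos_edges \<Delta> \<longleftrightarrow> e \<in> pos_edges \<Delta>" if "e \<in> edges \<Delta>" for e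
    using inj_on_image_mem_iff[OF inj that pos] .
  have e: "ini \<Delta> e \<in> verts \<Delta>" "ter \<Delta> e \<in> verts \<Delta>" "einv \<Delta> e \<in> edges \<Delta>" "einv \<Delta> (einv \<Delta> e) = e"
     "ini \<Delta> (einv \<Delta> e) = ter \<Delta> e" "ter \<Delta> (einv \<Delta> e) = ini \<Delta> e"
     "einv \<Delta> e \<in> pos_edges \<Delta> \<longleftrightarrow> e \<notin> pos_edges \<Delta>" if "e \<in> edges \<Delta>" for e
    using s that unfolding serre_graph_def by metis+
  have "serre_graph (transport_graph \<phi> \<psi> \<Delta>)"
    unfolding serre_graph_def
  proof (intro conjI ballI)
    fix f assume "f \<in> edges (transport_graph \<phi> \<psi> \<Delta>)"
    then obtain d where d: "d \<in> edges \<Delta>" "f = \<psi> d" by (auto simp: transport_graph_def)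
    note [simp] = inv_into_f_f[OF inj d(1)] inv_into_f_f[OF inj e(3)[OF d(1)]]
    let ?T = "transport_graph \<phi> \<psi> \<Delta>"
    show "ini ?T f \<in> verts ?T" "ter ?T f \<in> verts ?T" "einv ?T f \<in> edges ?T" "einv ?T (einv ?T f) = f"
     "ini ?T (einv ?T f) = ter ?T f" "ter ?T (einv ?T f) = ini ?T f"
     "(einv ?T f \<in> pos_edges ?T) = (f \<notin> pos_edges ?T)"
      using e[OF d(1)] mem[OF d(1)] mem[OF e(3)[OF d(1)]] d(2) by (simp_all add: transport_graph_def)
  qed (use pos in \<open>auto simp: transport_graph_def\<close>)
  then show "finite_graph (transport_graph \<phi> \<psi> \<Delta>)"
    using \<Delta> by (simp add: finite_graph_def transport_graph_def)
  show "graph_hom \<Delta> (transport_graph \<phi> \<psi> \<Delta>) \<phi> \<psi>"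
    unfolding graph_hom_def using inv_into_f_f[OF inj] by (auto simp: transport_graph_def)
qed

lemma graph_hom_comp:
  assumes "graph_hom \<Gamma> \<Delta> f g" "graph_hom \<Delta> \<Theta> \<phi> \<psi>"
  shows "graph_hom \<Gamma> \<Theta> (\<phi> \<circ> f) (\<psi> \<circ> g)"
  using assms unfolding graph_hom_def by (auto simp: Pi_iff)

definition edge_rel :: "('v, 'e, 'm) sgraph_scheme \<Rightarrow> 'e set \<Rightarrow> ('v \<times> 'v) set" where
  "edge_rel \<Gamma> F = {(ini \<Gamma> e, ter \<Gamma> e) | e. e \<in> F}"

lemma abstractly_connected_iff:
  "abstractly_connected \<Gamma> \<longleftrightarrow> (\<forall>u\<in>verts \<Gamma>. \<forall>v\<in>verts \<Gamma>. (u, v) \<in> (edge_rel \<Gamma> (edges \<Gamma>))\<^sup>*)"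
  by (simp add: abstractly_connected_def edge_rel_def)

lemma edge_rel_mono: "F \<subseteq> F' \<Longrightarrow> edge_rel \<Gamma> F \<subseteq> edge_rel \<Gamma> F'"
  by (auto simp: edge_rel_def)

lemma edge_rel_sym:
  assumes "\<And>e. e \<in> F \<Longrightarrow> einv \<Gamma> e \<in> F \<and> ini \<Gamma> (einv \<Gamma> e) = ter \<Gamma> e \<and> ter \<Gamma> (einv \<Gamma> e) = ini \<Gamma> e"
  shows "sym ((edge_rel \<Gamma> F)\<^sup>*)"
proof (rule sym_rtrancl, rule symI)
  fix a b assume "(a, b) \<in> edge_rel \<Gamma> F"
  then obtain e where e: "e \<in> F" "a = ini \<Gamma> e" "b = ter \<Gamma> e" by (auto simp: edge_rel_def)
  then show "(b, a) \<in> edge_rel \<Gamma> F"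
    unfolding edge_rel_def using assms[OF e(1)] by (intro CollectI exI[of _ "einv \<Gamma> e"]) simp
qed

text \<open>The definition of connectedness only mentions quotients with vertices and edges in \<open>nat\<close>;
  by transport it applies to finite quotients of any type.\<close>

lemma connected_graph_finite_quotient:
  assumes \<Gamma>: "connected_graph \<Gamma>" and \<Delta>: "finite_graph (\<Delta> :: ('w, 'f) sgraph)"
    and hom: "graph_hom \<Gamma> \<Delta> f g" and surj: "f ` verts \<Gamma> = verts \<Delta>" "g ` edges \<Gamma> = edges \<Delta>"
    and cont: "continuous_map (vtop \<Gamma>) (discrete_topology (verts \<Delta>)) f"
      "continuous_map (etop \<Gamma>) (discrete_topology (edges \<Delta>)) g"
  shows "abstractly_connected \<Delta>"
proof -
  have fin: "finite (verts \<Delta>)" "finite (edges \<Delta>)" using \<Delta> by (auto simp: finite_graph_def)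
  obtain \<phi> :: "'w \<Rightarrow> nat" where \<phi>: "inj_on \<phi> (verts \<Delta>)"
    using finite_imp_inj_to_nat_seg[OF fin(1)] by blast
  obtain \<psi> :: "'f \<Rightarrow> nat" where \<psi>: "inj_on \<psi> (edges \<Delta>)"
    using finite_imp_inj_to_nat_seg[OF fin(2)] by blast
  let ?T = "transport_graph \<phi> \<psi> \<Delta>"
  have T: "verts ?T = \<phi> ` verts \<Delta>" "edges ?T = \<psi> ` edges \<Delta>"
    by (simp_all add: transport_graph_def)
  have tr: "finite_graph ?T" "graph_hom \<Delta> ?T \<phi> \<psi>" using transport_graph[OF \<Delta> \<psi>] by blast+
  have "finite_quotient \<Gamma> ?T (\<phi> \<circ> f) (\<psi> \<circ> g)"
    unfolding finite_quotient_def
  proof (intro conjI)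
    show "continuous_map (vtop \<Gamma>) (discrete_topology (verts ?T)) (\<phi> \<circ> f)"
      using cont(1) by (rule continuous_map_compose) (simp add: T)
    show "continuous_map (etop \<Gamma>) (discrete_topology (edges ?T)) (\<psi> \<circ> g)"
      using cont(2) by (rule continuous_map_compose) (simp add: T)
    show "(\<phi> \<circ> f) ` verts \<Gamma> = verts ?T" "(\<psi> \<circ> g) ` edges \<Gamma> = edges ?T"
      by (simp_all only: T image_comp[symmetric] surj)
  qed (use tr graph_hom_comp[OF hom] in blast)+
  then have con: "abstractly_connected ?T" using \<Gamma> unfolding connected_graph_def by blast
  show ?thesis
    unfolding abstractly_connected_iff
  proof (intro ballI)
    fix u v assume uv: "u \<in> verts \<Delta>" "v \<in> verts \<Delta>"
    have "(\<phi> u, \<phi> v) \<in> (edge_rel ?T (edges ?T))\<^sup>*"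
      using con uv by (simp add: abstractly_connected_iff T)
    \<comment> \<open>The path is known only through \<open>\<phi>\<close>, so the induction speaks
      of every preimage \<open>x\<close> of its end.\<close>
    then have "\<forall>x\<in>verts \<Delta>. \<phi> v = \<phi> x \<longrightarrow> (u, x) \<in> (edge_rel \<Delta> (edges \<Delta>))\<^sup>*"
    proof (induction rule: rtrancl_induct)
      case base
      then show ?case using \<phi> uv(1) by (auto simp: inj_on_def)
    next
      case (step y z)
      from step.hyps(2) obtain e where e: "e \<in> edges \<Delta>" "y = ini ?T (\<psi> e)" "z = ter ?T (\<psi> e)"
        unfolding edge_rel_def by (auto simp: T)
      have *: "ini \<Delta> e \<in> verts \<Delta>" "ter \<Delta> e \<in> verts \<Delta>"
        using e(1) \<Delta> by (auto simp: finite_graph_def serre_graph_def)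
      have "y = \<phi> (ini \<Delta> e)" "z = \<phi> (ter \<Delta> e)"
        using tr(2) e unfolding graph_hom_def by auto
      then have "(u, ini \<Delta> e) \<in> (edge_rel \<Delta> (edges \<Delta>))\<^sup>*" using step.IH * by blast
      moreover have "(ini \<Delta> e, ter \<Delta> e) \<in> edge_rel \<Delta> (edges \<Delta>)" using e(1) by (auto simp: edge_rel_def)
      ultimately have "(u, ter \<Delta> e) \<in> (edge_rel \<Delta> (edges \<Delta>))\<^sup>*" by (rule rtrancl_into_rtrancl)
      then show ?case using \<open>z = \<phi> (ter \<Delta> e)\<close> \<phi> * by (auto simp: inj_on_def)
    qed
    then show "(u, v) \<in> (edge_rel \<Delta> (edges \<Delta>))\<^sup>*" using uv(2) by blast
  qed
qed

section \<open>Connectedness of closed subgraphs, tested level by level\<close>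

locale graph_tower = V: level_space "vtop \<Gamma>" p + E: level_space "etop \<Gamma>" q
  for \<Gamma> :: "('v, 'e) top_graph" and p :: "nat \<Rightarrow> 'v \<Rightarrow> 'w" and q :: "nat \<Rightarrow> 'e \<Rightarrow> 'f" +
  fixes D :: "nat \<Rightarrow> ('w, 'f) sgraph"
  assumes top: "topological_graph \<Gamma>"
    and finite_level: "finite_graph (D m)"
    and hom: "graph_hom \<Gamma> (D m) (p m) (q m)"
    and surj: "p m ` verts \<Gamma> = verts (D m)" "q m ` edges \<Gamma> = edges (D m)"
begin

lemma topspaces: "topspace (vtop \<Gamma>) = verts \<Gamma>" "topspace (etop \<Gamma>) = edges \<Gamma>"
  using top by (auto simp: topological_graph_def)

lemma serre: "serre_graph \<Gamma>"
  using top by (auto simp: topological_graph_def)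

lemma edge_facts:
  assumes "e \<in> edges \<Gamma>"
  shows "ini \<Gamma> e \<in> verts \<Gamma>" "ter \<Gamma> e \<in> verts \<Gamma>" "einv \<Gamma> e \<in> edges \<Gamma>"
    "ini \<Gamma> (einv \<Gamma> e) = ter \<Gamma> e" "ter \<Gamma> (einv \<Gamma> e) = ini \<Gamma> e"
  using serre assms unfolding serre_graph_def by metis+

lemma level_edge:
  assumes "e \<in> edges \<Gamma>"
  shows "ini (D m) (q m e) = p m (ini \<Gamma> e)" "ter (D m) (q m e) = p m (ter \<Gamma> e)"
    "einv (D m) (q m e) = q m (einv \<Gamma> e)"
  using hom[of m] assms by (auto simp: graph_hom_def)

lemma closed_subgraphD:
  assumes "closed_subgraph \<Gamma> W F"
  shows "W \<subseteq> verts \<Gamma>" "F \<subseteq> edges \<Gamma>" "closedin (vtop \<Gamma>) W" "closedin (etop \<Gamma>) F"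
    "\<And>e. e \<in> F \<Longrightarrow> ini \<Gamma> e \<in> W" "\<And>e. e \<in> F \<Longrightarrow> ter \<Gamma> e \<in> W" "\<And>e. e \<in> F \<Longrightarrow> einv \<Gamma> e \<in> F"
  using assms closedin_subset topspaces unfolding closed_subgraph_def by metis+

definition level_image :: "nat \<Rightarrow> 'v set \<Rightarrow> 'e set \<Rightarrow> ('w, 'f) sgraph" where
  "level_image m W F = (D m)\<lparr>verts := p m ` W, edges := q m ` F, pos_edges := pos_edges (D m) \<inter> q m ` F\<rparr>"

definition level_connected :: "nat \<Rightarrow> 'v set \<Rightarrow> 'e set \<Rightarrow> bool" where
  "level_connected m W F \<longleftrightarrow> (\<forall>u\<in>W. \<forall>v\<in>W. (p m u, p m v) \<in> (edge_rel (D m) (q m ` F))\<^sup>*)"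

lemma level_image_connected: "abstractly_connected (level_image m W F) \<longleftrightarrow> level_connected m W F"
  by (simp add: abstractly_connected_def level_connected_def edge_rel_def level_image_def)

lemma level_rel_sym:
  assumes "\<And>e. e \<in> F \<Longrightarrow> einv \<Gamma> e \<in> F" "F \<subseteq> edges \<Gamma>"
  shows "sym ((edge_rel (D m) (q m ` F))\<^sup>*)"
proof (rule edge_rel_sym)
  fix e assume "e \<in> q m ` F"
  then obtain d where d: "d \<in> F" "e = q m d" by blast
  then have "d \<in> edges \<Gamma>" using assms by blast
  then show "einv (D m) e \<in> q m ` F \<and> ini (D m) (einv (D m) e) = ter (D m) e \<and>
      ter (D m) (einv (D m) e) = ini (D m) e"
    using d assms(1)[OF d(1)] edge_facts level_edge by auto
qed

lemma finite_level_image: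
  assumes "closed_subgraph \<Gamma> W F"
  shows "finite_graph (level_image m W F)"
proof -
  note c = closed_subgraphD[OF assms]
  have D: "serre_graph (D m)" "finite (verts (D m))" "finite (edges (D m))"
    using finite_level by (auto simp: finite_graph_def)
  have sub: "p m ` W \<subseteq> verts (D m)" "q m ` F \<subseteq> edges (D m)" using c(1,2) surj by blast+
  have "serre_graph (level_image m W F)"
    unfolding serre_graph_def
  proof (intro conjI ballI)
    fix e assume "e \<in> edges (level_image m W F)"
    then obtain d where d: "d \<in> F" "e = q m d" by (auto simp: level_image_def)
    then have de: "d \<in> edges \<Gamma>" "e \<in> edges (D m)" using c(2) sub by auto
    show "ini (level_image m W F) e \<in> verts (level_image m W F)"
      "ter (level_image m W F) e \<in> verts (level_image m W F)"
      "einv (level_image m W F) e \<in> edges (level_image m W F)"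
      using d level_edge[OF de(1)] c(5-7)[OF d(1)] by (auto simp: level_image_def)
    then have "einv (D m) e \<in> q m ` F" by (simp add: level_image_def)
    then show "einv (level_image m W F) (einv (level_image m W F) e) = e"
      "ini (level_image m W F) (einv (level_image m W F) e) = ter (level_image m W F) e"
      "ter (level_image m W F) (einv (level_image m W F) e) = ini (level_image m W F) e"
      "(einv (level_image m W F) e \<in> pos_edges (level_image m W F)) = (e \<notin> pos_edges (level_image m W F))"
      using D(1) de(2) d unfolding serre_graph_def by (auto simp: level_image_def)
  qed (auto simp: level_image_def)
  moreover have "finite (p m ` W)" "finite (q m ` F)" using sub D(2,3) finite_subset by blast+
  ultimately show ?thesis by (simp add: finite_graph_def level_image_def)
qed

text \<open>The vertex map of any finite quotient factors through some level. Each edge of a path at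
  that level is lifted separately; consecutive lifts share a vertex only up to the level, which is
  enough for their images to fit together.\<close>

lemma connected_graph_iff:
  assumes WF: "closed_subgraph \<Gamma> W F"
  shows "connected_graph (restrict_graph \<Gamma> W F) \<longleftrightarrow> (\<forall>m. level_connected m W F)"
proof
  note c = closed_subgraphD[OF WF]
  let ?G = "restrict_graph \<Gamma> W F"
  have G: "verts ?G = W" "edges ?G = F" "ini ?G = ini \<Gamma>" "ter ?G = ter \<Gamma>" "einv ?G = einv \<Gamma>"
    "vtop ?G = subtopology (vtop \<Gamma>) W" "etop ?G = subtopology (etop \<Gamma>) F"
    "pos_edges ?G = pos_edges \<Gamma> \<inter> F"
    using c(1,2) by (auto simp: restrict_graph_def)
  {
    assume con: "connected_graph ?G"
    show "\<forall>m. level_connected m W F"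
    proof
      fix m
      let ?I = "level_image m W F"
      have I: "verts ?I = p m ` W" "edges ?I = q m ` F" by (simp_all add: level_image_def)
      have "graph_hom ?G ?I (p m) (q m)"
        using hom[of m] c(2) unfolding graph_hom_def G by (auto simp: level_image_def Pi_iff)
      moreover have "continuous_map (vtop ?G) (discrete_topology (verts ?I)) (p m)"
        unfolding G I by (rule continuous_map_discrete_cong[OF continuous_map_from_subtopology[OF V.cont]]) auto
      moreover have "continuous_map (etop ?G) (discrete_topology (edges ?I)) (q m)"
        unfolding G I by (rule continuous_map_discrete_cong[OF continuous_map_from_subtopology[OF E.cont]]) auto
      ultimately have "abstractly_connected ?I"
        using connected_graph_finite_quotient[OF con finite_level_image[OF WF]] by (simp add: G I)
      then show "level_connected m W F" by (simp add: level_image_connected)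
    qed
  next
    assume lev: "\<forall>m. level_connected m W F"
    show "connected_graph ?G"
      unfolding connected_graph_def
    proof (intro allI impI)
      fix \<Delta> f g assume q: "finite_quotient ?G \<Delta> f g"
      then have fin: "finite (verts \<Delta>)" and h: "graph_hom ?G \<Delta> f g"
        and f: "f ` W = verts \<Delta>" and g: "g ` F = edges \<Delta>"
        and cf: "continuous_map (subtopology (vtop \<Gamma>) W) (discrete_topology (verts \<Delta>)) f"
        unfolding finite_quotient_def finite_graph_def G by blast+
      obtain m where m: "\<And>x y. x \<in> W \<Longrightarrow> y \<in> W \<Longrightarrow> p m x = p m y \<Longrightarrow> f x = f y"
        using V.continuous_factor[OF c(3) cf fin] by blast
      have chain: "(f w, f w') \<in> (edge_rel \<Delta> (edges \<Delta>))\<^sup>*" if w: "w \<in> W" "w' \<in> W" for w w'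
      proof -
        have "(p m w, p m w') \<in> (edge_rel (D m) (q m ` F))\<^sup>*"
          using lev w by (simp add: level_connected_def)
        then have "\<forall>x\<in>W. p m x = p m w' \<longrightarrow> (f w, f x) \<in> (edge_rel \<Delta> (edges \<Delta>))\<^sup>*"
        proof (induction rule: rtrancl_induct)
          case base
          then show ?case using m[OF _ w(1)] by (metis rtrancl.rtrancl_refl)
        next
          case (step y z)
          from step.hyps(2) obtain e where e: "e \<in> F" "y = ini (D m) (q m e)" "z = ter (D m) (q m e)"
            unfolding edge_rel_def by blast
          have eG: "e \<in> edges \<Gamma>" using e(1) c(2) by blast
          have yz: "y = p m (ini \<Gamma> e)" "z = p m (ter \<Gamma> e)" using e level_edge[OF eG] by auto
          have "(f w, f (ini \<Gamma> e)) \<in> (edge_rel \<Delta> (edges \<Delta>))\<^sup>*" using step.IH yz c(5)[OF e(1)] by simp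
          moreover have "(f (ini \<Gamma> e), f (ter \<Gamma> e)) \<in> edge_rel \<Delta> (edges \<Delta>)"
          proof -
            have "ini \<Delta> (g e) = f (ini \<Gamma> e)" "ter \<Delta> (g e) = f (ter \<Gamma> e)" "g e \<in> edges \<Delta>"
              using h e(1) unfolding graph_hom_def G by auto
            then show ?thesis unfolding edge_rel_def by (intro CollectI exI[of _ "g e"]) simp
          qed
          ultimately have "(f w, f (ter \<Gamma> e)) \<in> (edge_rel \<Delta> (edges \<Delta>))\<^sup>*" by (rule rtrancl_into_rtrancl)
          then show ?case using m[OF _ c(6)[OF e(1)]] yz(2) by metis
        qed
        then show ?thesis using w(2) by blast
      qed
      show "abstractly_connected \<Delta>"
        unfolding abstractly_connected_iff f[symmetric] using chain by blast
    qed
  }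
qed

lemma whole_subgraph: "closed_subgraph \<Gamma> (verts \<Gamma>) (edges \<Gamma>)"
  unfolding closed_subgraph_def using edge_facts topspaces by (metis closedin_topspace)

lemma restrict_whole: "restrict_graph \<Gamma> (verts \<Gamma>) (edges \<Gamma>) = \<Gamma>"
proof -
  have "pos_edges \<Gamma> \<subseteq> edges \<Gamma>" using serre by (simp add: serre_graph_def)
  moreover have "subtopology (vtop \<Gamma>) (verts \<Gamma>) = vtop \<Gamma>" "subtopology (etop \<Gamma>) (edges \<Gamma>) = etop \<Gamma>"
    using topspaces by (metis subtopology_topspace)+
  ultimately show ?thesis by (simp add: restrict_graph_def Int_absorb2)
qed

text \<open>By compactness some member has an image at level \<open>m\<close> no larger than that of
  the intersection. Connectedness is asked of a smaller member for each level because the members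
  built in \<open>connected_intersection\<close> are known to be connected only up to their own
  level.\<close>

lemma directed_Inter_connected:
  assumes ne: "\<D> \<noteq> {}"
    and sub: "\<And>W F. (W, F) \<in> \<D> \<Longrightarrow> closed_subgraph \<Gamma> W F"
    and dir: "\<And>A B. A \<in> \<D> \<Longrightarrow> B \<in> \<D> \<Longrightarrow> \<exists>C\<in>\<D>. fst C \<subseteq> fst A \<inter> fst B \<and> snd C \<subseteq> snd A \<inter> snd B"
    and con: "\<And>m A. A \<in> \<D> \<Longrightarrow> \<exists>C\<in>\<D>. fst C \<subseteq> fst A \<and> snd C \<subseteq> snd A \<and> level_connected m (fst C) (snd C)"
  shows "closed_subgraph \<Gamma> (\<Inter>A\<in>\<D>. fst A) (\<Inter>A\<in>\<D>. snd A)"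
    and "level_connected m (\<Inter>A\<in>\<D>. fst A) (\<Inter>A\<in>\<D>. snd A)"
proof -
  let ?W = "\<Inter>A\<in>\<D>. fst A" and ?F = "\<Inter>A\<in>\<D>. snd A"
  have c: "closed_subgraph \<Gamma> (fst A) (snd A)" if "A \<in> \<D>" for A using sub[of "fst A" "snd A"] that by simp
  note cd = closed_subgraphD[OF c]
  show "closed_subgraph \<Gamma> ?W ?F"
    unfolding closed_subgraph_def
  proof (intro conjI ballI)
    show "closedin (vtop \<Gamma>) ?W" "closedin (etop \<Gamma>) ?F" using ne cd(3,4) by (auto intro: closedin_INT)
  qed (use cd(5-7) in auto)
  have "\<exists>A\<in>\<D>. p m ` fst A \<subseteq> p m ` ?W"
    by (rule V.directed_level[OF ne cd(3)]) (use dir in \<open>blast+\<close>)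
  then obtain A where A: "A \<in> \<D>" "p m ` fst A \<subseteq> p m ` ?W" by blast
  have "\<exists>B\<in>\<D>. q m ` snd B \<subseteq> q m ` ?F"
    by (rule E.directed_level[OF ne cd(4)]) (use dir in \<open>blast+\<close>)
  then obtain B where B: "B \<in> \<D>" "q m ` snd B \<subseteq> q m ` ?F" by blast
  obtain C where C: "C \<in> \<D>" "fst C \<subseteq> fst A \<inter> fst B" "snd C \<subseteq> snd A \<inter> snd B"
    using dir[OF A(1) B(1)] by blast
  obtain G where G: "G \<in> \<D>" "fst G \<subseteq> fst C" "snd G \<subseteq> snd C" "level_connected m (fst G) (snd G)"
    using con[OF C(1)] by blast
  have "q m ` snd G \<subseteq> q m ` ?F" using B(2) C(3) G(3) by blast
  then have le: "(edge_rel (D m) (q m ` snd G))\<^sup>* \<subseteq> (edge_rel (D m) (q m ` ?F))\<^sup>*"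
    by (intro rtrancl_mono edge_rel_mono)
  show "level_connected m ?W ?F"
    unfolding level_connected_def
  proof (intro ballI)
    fix u v assume "u \<in> ?W" "v \<in> ?W"
    then have "u \<in> fst G" "v \<in> fst G" using G(1) by auto
    then have "(p m u, p m v) \<in> (edge_rel (D m) (q m ` snd G))\<^sup>*"
      using G(4) by (simp add: level_connected_def)
    then show "(p m u, p m v) \<in> (edge_rel (D m) (q m ` ?F))\<^sup>*" by (rule subsetD[OF le])
  qed
qed

end

section \<open>Connected subgraphs inside the intersection of two closed subgraphs\<close>

context graph_tower
begin

text \<open>The edges are lifted and projected one by one; ends that agree at level \<open>k\<close>
  agree at level \<open>m\<close> by \<open>refine\<close>, so the projected edges still form a
  path.\<close>

lemma level_path_project:
  assumes path: "(p k u, y) \<in> (edge_rel (D k) T)\<^sup>*" and mk: "m \<le> k" and u: "u \<in> verts \<Gamma>"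
    and T: "T \<subseteq> q k ` edges \<Gamma>" and T': "\<And>e. e \<in> edges \<Gamma> \<Longrightarrow> q k e \<in> T \<Longrightarrow> q m e \<in> T'"
    and w: "w \<in> verts \<Gamma>" "p k w = y"
  shows "(p m u, p m w) \<in> (edge_rel (D m) T')\<^sup>*"
  using path w
proof (induction arbitrary: w rule: rtrancl_induct)
  case base
  then have "p m w = p m u" using V.refine[of w u m k] u mk topspaces by simp
  then show ?case by simp
next
  case (step y z)
  from step.hyps(2) obtain d where d: "d \<in> T" "y = ini (D k) d" "z = ter (D k) d"
    unfolding edge_rel_def by blast
  then obtain e where e: "e \<in> edges \<Gamma>" "d = q k e" using T by blast
  note ef = edge_facts[OF e(1)]
  have yz: "y = p k (ini \<Gamma> e)" "z = p k (ter \<Gamma> e)" using level_edge[OF e(1)] d e(2) by auto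
  have "(p m u, p m (ini \<Gamma> e)) \<in> (edge_rel (D m) T')\<^sup>*"
    using step.IH[OF ef(1)] yz by simp
  moreover have "(p m (ini \<Gamma> e), p m (ter \<Gamma> e)) \<in> edge_rel (D m) T'"
    unfolding edge_rel_def using T'[OF e(1)] d(1) e level_edge[OF e(1)]
    by (intro CollectI exI[of _ "q m e"]) simp
  moreover have "p m w = p m (ter \<Gamma> e)"
    using V.refine[of w "ter \<Gamma> e" m k] step.prems mk topspaces yz ef(2) by simp
  ultimately show ?case by (simp add: rtrancl_into_rtrancl)
qed

lemma level_image_refine:
  assumes "F \<subseteq> edges \<Gamma>" "m \<le> k" "e \<in> edges \<Gamma>" "q k e \<in> q k ` F"
  shows "q m e \<in> q m ` F"
proof -
  obtain d where d: "d \<in> F" "q k e = q k d" using assms(4) by blast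
  then have "q m e = q m d" using E.refine[of e d m k] assms topspaces by auto
  then show ?thesis using d(1) by blast
qed

lemma level_connected_mono:
  assumes WF: "closed_subgraph \<Gamma> W F" and "level_connected k W F" "m \<le> k"
  shows "level_connected m W F"
  unfolding level_connected_def
proof (intro ballI)
  fix u v assume uv: "u \<in> W" "v \<in> W"
  note c = closed_subgraphD[OF WF]
  have "(p k u, p k v) \<in> (edge_rel (D k) (q k ` F))\<^sup>*"
    using assms(2) uv by (simp add: level_connected_def)
  then show "(p m u, p m v) \<in> (edge_rel (D m) (q m ` F))\<^sup>*"
    by (rule level_path_project[OF _ assms(3)])
      (use uv c(1,2) level_image_refine[OF c(2) assms(3)] in auto)
qed

text \<open>\<open>path\<close> concerns the intersection of the images, which can exceed the image
  of the intersection. The preimages of the component of \<open>u\<close> at the levels decrease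
  with \<open>m\<close>, and their limit lies in both subgraphs because these are closed.\<close>

lemma connected_intersection:
  assumes c1: "closed_subgraph \<Gamma> W1 F1" and c2: "closed_subgraph \<Gamma> W2 F2"
    and u: "u \<in> W1" "u \<in> W2" and v: "v \<in> W1" "v \<in> W2"
    and path: "\<And>m. (p m u, p m v) \<in> (edge_rel (D m) (q m ` F1 \<inter> q m ` F2))\<^sup>*"
  shows "\<exists>W F. closed_subgraph \<Gamma> W F \<and> (\<forall>m. level_connected m W F) \<and> u \<in> W \<and> v \<in> W \<and>
    W \<subseteq> W1 \<inter> W2 \<and> F \<subseteq> F1 \<inter> F2"
proof -
  note d1 = closed_subgraphD[OF c1] and d2 = closed_subgraphD[OF c2]
  have uv: "u \<in> verts \<Gamma>" "v \<in> verts \<Gamma>" using u v d1(1) by auto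
  define S where "S m = q m ` F1 \<inter> q m ` F2" for m
  define C where "C m = {b. (p m u, b) \<in> (edge_rel (D m) (S m))\<^sup>*}" for m
  define W where "W m = {w \<in> verts \<Gamma>. p m w \<in> C m}" for m
  \<comment> \<open>An edge of \<open>S m\<close> that starts in the component also ends there, by
    \<open>ter_C\<close>.\<close>
  define F where "F m = {e \<in> edges \<Gamma>. q m e \<in> {d \<in> S m. ini (D m) d \<in> C m}}" for m
  have ter_C: "ter (D m) d \<in> C m" if "d \<in> S m" "ini (D m) d \<in> C m" for m d
  proof -
    have "(ini (D m) d, ter (D m) d) \<in> edge_rel (D m) (S m)" using that(1) by (auto simp: edge_rel_def)
    then show ?thesis using that(2) unfolding C_def by (simp add: rtrancl_into_rtrancl)
  qed
  have S_inv: "q m (einv \<Gamma> e) \<in> S m" if e: "e \<in> edges \<Gamma>" "q m e \<in> S m" for e m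
  proof -
    obtain e1 e2 where "e1 \<in> F1" "q m e = q m e1" "e2 \<in> F2" "q m e = q m e2"
      using e(2) unfolding S_def by blast
    then have "q m (einv \<Gamma> e) = q m (einv \<Gamma> e1)" "q m (einv \<Gamma> e) = q m (einv \<Gamma> e2)"
      "einv \<Gamma> e1 \<in> F1" "einv \<Gamma> e2 \<in> F2"
      using level_edge(3) e(1) d1(2,7) d2(2,7) by (metis subsetD)+
    then show ?thesis unfolding S_def by blast
  qed
  have S_sub: "S m \<subseteq> q m ` edges \<Gamma>" for m using d1(2) by (auto simp: S_def)
  have S_ref: "q m e \<in> S m" if "m \<le> k" "e \<in> edges \<Gamma>" "q k e \<in> S k" for m k e
    using that level_image_refine[OF d1(2), of m k e] level_image_refine[OF d2(2), of m k e]
    by (auto simp: S_def)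
  have C_ref: "p m w \<in> C m" if "m \<le> k" "w \<in> verts \<Gamma>" "p k w \<in> C k" for m k w
  proof -
    have "(p k u, p k w) \<in> (edge_rel (D k) (S k))\<^sup>*" using that(3) by (simp add: C_def)
    then have "(p m u, p m w) \<in> (edge_rel (D m) (S m))\<^sup>*"
      by (rule level_path_project[OF _ that(1) uv(1) S_sub]) (use that S_ref in auto)
    then show ?thesis by (simp add: C_def)
  qed
  have W_anti: "W k \<subseteq> W m" if "m \<le> k" for m k
    using C_ref[OF that] by (auto simp: W_def)
  have F_anti: "F k \<subseteq> F m" if "m \<le> k" for m k
  proof
    fix e assume "e \<in> F k"
    then have e: "e \<in> edges \<Gamma>" "q k e \<in> S k" "p k (ini \<Gamma> e) \<in> C k"
      using level_edge(1) by (auto simp: F_def)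
    then have "q m e \<in> S m" "p m (ini \<Gamma> e) \<in> C m"
      using S_ref[OF that e(1,2)] C_ref[OF that edge_facts(1)[OF e(1)] e(3)] by auto
    then show "e \<in> F m" using e(1) level_edge(1) by (simp add: F_def)
  qed
  have cl: "closed_subgraph \<Gamma> (W m) (F m)" for m
    unfolding closed_subgraph_def
  proof (intro conjI ballI)
    show "closedin (vtop \<Gamma>) (W m)" 
      using V.closedin_fibre[of m "C m"] topspaces(1) by (simp add: W_def)
    show "closedin (etop \<Gamma>) (F m)" 
      using E.closedin_fibre[of m "{d \<in> S m. ini (D m) d \<in> C m}"] topspaces(2) by (simp add: F_def)
    fix e assume "e \<in> F m"
    then have e: "e \<in> edges \<Gamma>" "q m e \<in> S m" "ini (D m) (q m e) \<in> C m" by (auto simp: F_def)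
    note ef = edge_facts[OF e(1)] and le = level_edge[OF e(1), of m]
    show "ini \<Gamma> e \<in> W m" using e(3) ef(1) le(1) by (simp add: W_def)
    have t: "p m (ter \<Gamma> e) \<in> C m" using ter_C[OF e(2,3)] le(2) by simp
    then show "ter \<Gamma> e \<in> W m" using ef(2) by (simp add: W_def)
    show "einv \<Gamma> e \<in> F m"
      using S_inv[OF e(1,2)] t ef(3,4) level_edge(1)[OF ef(3), of m] by (simp add: F_def)
  qed
  have con: "level_connected m (W m) (F m)" for m
  proof -
    have reach: "(p m u, b) \<in> (edge_rel (D m) (q m ` F m))\<^sup>*" if "b \<in> C m" for b
      using that unfolding C_def mem_Collect_eq
    proof (induction rule: rtrancl_induct)
      case (step y z)
      from step.hyps(2) obtain d where d: "d \<in> S m" "y = ini (D m) d" "z = ter (D m) d"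
        unfolding edge_rel_def by blast
      obtain e where e: "e \<in> edges \<Gamma>" "d = q m e" using d(1) S_sub by blast
      have "e \<in> F m" using e d step.hyps(1) by (simp add: F_def C_def)
      then have "(y, z) \<in> edge_rel (D m) (q m ` F m)"
        using d e unfolding edge_rel_def by blast
      then show ?case using step.IH by (simp add: rtrancl_into_rtrancl)
    qed simp
    have "sym ((edge_rel (D m) (q m ` F m))\<^sup>*)"
      by (rule level_rel_sym) (use closed_subgraphD[OF cl] in auto)
    then show ?thesis
      unfolding level_connected_def using reach W_def
      by (metis (mono_tags, lifting) mem_Collect_eq rtrancl_trans symD)
  qed
  let ?D = "range (\<lambda>m. (W m, F m))"
  have dir: "\<exists>G\<in>?D. fst G \<subseteq> fst A \<inter> fst B \<and> snd G \<subseteq> snd A \<inter> snd B" if AB: "A \<in> ?D" "B \<in> ?D" for A B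
  proof -
    obtain i j where ij: "A = (W i, F i)" "B = (W j, F j)" using AB by blast
    have "fst (W (max i j), F (max i j)) \<subseteq> fst A \<inter> fst B" "snd (W (max i j), F (max i j)) \<subseteq> snd A \<inter> snd B"
      using W_anti[of i "max i j"] W_anti[of j "max i j"] F_anti[of i "max i j"] F_anti[of j "max i j"]
      unfolding ij by auto
    then show ?thesis by blast
  qed
  have conD: "\<exists>G\<in>?D. fst G \<subseteq> fst A \<and> snd G \<subseteq> snd A \<and> level_connected m (fst G) (snd G)"
    if A: "A \<in> ?D" for m A
  proof -
    obtain i where i: "A = (W i, F i)" using A by blast
    \<comment> \<open>Going up to level \<open>max i m\<close> gives a member below
      \<open>A\<close>, and its connectedness descends to level \<open>m\<close>.\<close>
    have "level_connected m (W (max i m)) (F (max i m))"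
      using level_connected_mono[OF cl con, of m "max i m"] by simp
    then show ?thesis
      using W_anti[of i "max i m"] F_anti[of i "max i m"]
      by (intro bexI[of _ "(W (max i m), F (max i m))"]) (auto simp: i)
  qed
  have clD: "closed_subgraph \<Gamma> W' F'" if "(W', F') \<in> ?D" for W' F' using that cl by blast
  note res = directed_Inter_connected[of ?D, OF _ clD dir conD]
  let ?W = "\<Inter>A\<in>?D. fst A" and ?F = "\<Inter>A\<in>?D. snd A"
  \<comment> \<open>Only edge sets were intersected in \<open>S\<close>; a vertex of the component
    is \<open>u\<close> or the end of such an edge, hence lies in both vertex images.\<close>
  have C_sub: "C m \<subseteq> p m ` W1 \<inter> p m ` W2" for m
  proof
    fix b assume "b \<in> C m"
    then have "(p m u, b) \<in> (edge_rel (D m) (S m))\<^sup>*" by (simp add: C_def)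
    then show "b \<in> p m ` W1 \<inter> p m ` W2"
    proof (cases rule: rtranclE)
      case base
      then show ?thesis using u by blast
    next
      case (step y)
      then obtain e1 e2 where e: "e1 \<in> F1" "b = ter (D m) (q m e1)" "e2 \<in> F2" "b = ter (D m) (q m e2)"
        unfolding edge_rel_def S_def by force
      then have "b = p m (ter \<Gamma> e1)" "b = p m (ter \<Gamma> e2)"
        using level_edge(2) d1(2) d2(2) by (metis subsetD)+
      then show ?thesis using d1(6) d2(6) e by blast
    qed
  qed
  have W_sub: "?W \<subseteq> W1 \<inter> W2"
  proof
    fix w assume "w \<in> ?W"
    then have w: "\<And>m. w \<in> W m" by simp
    have wt: "w \<in> topspace (vtop \<Gamma>)" using w topspaces by (simp add: W_def)
    have "p m w \<in> p m ` W1" "p m w \<in> p m ` W2" for m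
      using w[of m] C_sub[of m] by (auto simp: W_def)
    then show "w \<in> W1 \<inter> W2"
      using V.closed_limit[OF d1(3) wt] V.closed_limit[OF d2(3) wt] by blast
  qed
  have F_sub: "?F \<subseteq> F1 \<inter> F2"
  proof
    fix e assume "e \<in> ?F"
    then have e: "\<And>m. e \<in> F m" by simp
    have et: "e \<in> topspace (etop \<Gamma>)" using e topspaces by (simp add: F_def)
    have "q m e \<in> q m ` F1" "q m e \<in> q m ` F2" for m
      using e[of m] by (auto simp: F_def S_def)
    then show "e \<in> F1 \<inter> F2"
      using E.closed_limit[OF d1(4) et] E.closed_limit[OF d2(4) et] by blast
  qed
  have "u \<in> ?W" "v \<in> ?W" using path uv by (auto simp: W_def C_def S_def)
  then show ?thesis using res W_sub F_sub by blast
qed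

theorem connected_intersections:
  assumes con: "\<And>m. level_connected m (verts \<Gamma>) (edges \<Gamma>)"
    and path: "\<And>m W1 F1 W2 F2 u v.
      \<lbrakk>closed_subgraph \<Gamma> W1 F1; closed_subgraph \<Gamma> W2 F2;
       \<And>k. level_connected k W1 F1; \<And>k. level_connected k W2 F2;
       u \<in> W1; u \<in> W2; v \<in> W1; v \<in> W2\<rbrakk>
      \<Longrightarrow> (p m u, p m v) \<in> (edge_rel (D m) (q m ` F1 \<inter> q m ` F2))\<^sup>*"
    and uv: "u \<in> verts \<Gamma>" "v \<in> verts \<Gamma>"
  shows "connected_graph (restrict_graph \<Gamma> (\<Inter>(W, F)\<in>connected_subgraphs \<Gamma> u v. W)
                                          (\<Inter>(W, F)\<in>connected_subgraphs \<Gamma> u v. F))"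
proof -
  let ?C = "connected_subgraphs \<Gamma> u v"
  have mem: "(W, F) \<in> ?C \<longleftrightarrow> closed_subgraph \<Gamma> W F \<and> (\<forall>m. level_connected m W F) \<and> u \<in> W \<and> v \<in> W" for W F
    using connected_graph_iff[of W F] by (auto simp: connected_subgraphs_def)
  have ne: "?C \<noteq> {}" using mem[of "verts \<Gamma>" "edges \<Gamma>"] whole_subgraph con uv by blast
  have dir: "\<exists>G\<in>?C. fst G \<subseteq> fst A \<inter> fst B \<and> snd G \<subseteq> snd A \<inter> snd B" if "A \<in> ?C" "B \<in> ?C" for A B
  proof -
    obtain W1 F1 W2 F2 where AB: "A = (W1, F1)" "B = (W2, F2)" by (metis surj_pair)
    have a: "closed_subgraph \<Gamma> W1 F1" "\<And>m. level_connected m W1 F1" "u \<in> W1" "v \<in> W1"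
      and b: "closed_subgraph \<Gamma> W2 F2" "\<And>m. level_connected m W2 F2" "u \<in> W2" "v \<in> W2"
      using that mem AB by auto
    obtain W F where "closed_subgraph \<Gamma> W F" "\<forall>m. level_connected m W F" "u \<in> W" "v \<in> W"
      "W \<subseteq> W1 \<inter> W2" "F \<subseteq> F1 \<inter> F2"
      using connected_intersection[OF a(1) b(1) a(3) b(3) a(4) b(4)]
        path[OF a(1) b(1) a(2) b(2) a(3) b(3) a(4) b(4)] by blast
    then show ?thesis using mem[of W F] AB by (intro bexI[of _ "(W, F)"]) auto
  qed
  have conC: "\<exists>G\<in>?C. fst G \<subseteq> fst A \<and> snd G \<subseteq> snd A \<and> level_connected m (fst G) (snd G)"
    if A: "A \<in> ?C" for m A
    using A mem[of "fst A" "snd A"] by (intro bexI[of _ A]) auto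
  have clC: "closed_subgraph \<Gamma> W F" if "(W, F) \<in> ?C" for W F using that mem by blast
  note res = directed_Inter_connected[of ?C, OF ne clC dir conC]
  have eq: "(\<Inter>(W, F)\<in>?C. W) = (\<Inter>A\<in>?C. fst A)" "(\<Inter>(W, F)\<in>?C. F) = (\<Inter>A\<in>?C. snd A)"
    by (simp_all add: case_prod_unfold)
  show ?thesis unfolding eq using connected_graph_iff[OF res(1)] res(2) by blast
qed

end

section \<open>A tower as an inverse limit\<close>

context graph_tower
begin

text \<open>If a negative edge had a positive image, its inverse would have a positive image as
  well, and two mutually inverse edges of the level would both be positive.\<close>

lemma level_pos: "e \<in> edges \<Gamma> \<Longrightarrow> q m e \<in> pos_edges (D m) \<longleftrightarrow> e \<in> pos_edges \<Gamma>"
proof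
  assume e: "e \<in> edges \<Gamma>"
  show "e \<in> pos_edges \<Gamma> \<Longrightarrow> q m e \<in> pos_edges (D m)"
    using hom[of m] by (auto simp: graph_hom_def)
  assume *: "q m e \<in> pos_edges (D m)"
  show "e \<in> pos_edges \<Gamma>"
  proof (rule ccontr)
    assume "e \<notin> pos_edges \<Gamma>"
    then have "einv \<Gamma> e \<in> pos_edges \<Gamma>" using serre e by (auto simp: serre_graph_def)
    then have "einv (D m) (q m e) \<in> pos_edges (D m)"
      using hom[of m] e by (auto simp: graph_hom_def)
    moreover have "q m e \<in> edges (D m)" using surj(2) e by blast
    ultimately show False
      using * finite_level[of m] by (auto simp: finite_graph_def serre_graph_def)
  qed
qed

text \<open>Different levels may have the same kernels and then share one index of the inverse system;
  \<open>n i\<close> picks a level for the index \<open>i\<close>.\<close>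

theorem profinite: "profinite_graph \<Gamma>"
proof -
  \<comment> \<open>A level is indexed by its pair of kernels, matching the index type in
    \<open>profinite_graph\<close>; finer levels have smaller kernels.\<close>
  define K where "K m = ({(x, y). x \<in> verts \<Gamma> \<and> y \<in> verts \<Gamma> \<and> p m x = p m y},
    {(x, y). x \<in> edges \<Gamma> \<and> y \<in> edges \<Gamma> \<and> q m x = q m y})" for m
  define R where "R i j \<longleftrightarrow> fst j \<subseteq> fst i \<and> snd j \<subseteq> snd i"
    for i j :: "('v \<times> 'v) set \<times> ('e \<times> 'e) set"
  define I where "I = range K"
  have "\<exists>(\<phi>::'w \<Rightarrow> nat) (\<psi>::'f \<Rightarrow> nat). inj_on \<phi> (verts (D m)) \<and> inj_on \<psi> (edges (D m))" for m
  proof -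
    have "finite (verts (D m))" "finite (edges (D m))" using finite_level by (auto simp: finite_graph_def)
    then show ?thesis using finite_imp_inj_to_nat_seg by metis
  qed
  then obtain \<phi> :: "nat \<Rightarrow> 'w \<Rightarrow> nat" and \<psi> :: "nat \<Rightarrow> 'f \<Rightarrow> nat"
    where inj: "\<And>m. inj_on (\<phi> m) (verts (D m))" "\<And>m. inj_on (\<psi> m) (edges (D m))" by metis
  define n where "n i = (SOME m. K m = i)" for i
  have Kn: "K (n i) = i" if "i \<in> I" for i
    using that unfolding n_def I_def by (auto intro: someI)
  define T where "T i = transport_graph (\<phi> (n i)) (\<psi> (n i)) (D (n i))" for i
  define P where "P i x = \<phi> (n i) (p (n i) x)" for i x
  define Q where "Q i e = \<psi> (n i) (q (n i) e)" for i e
  \<comment> \<open>The connecting maps send an arbitrary lift down; inclusion of the kernels makes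
    the result independent of the lift.\<close>
  define pp where "pp i j y = P i (SOME x. x \<in> verts \<Gamma> \<and> P j x = y)" for i j y
  define qq where "qq i j y = Q i (SOME x. x \<in> edges \<Gamma> \<and> Q j x = y)" for i j y
  have P_eq: "P i x = P i y \<longleftrightarrow> (x, y) \<in> fst i" if "i \<in> I" "x \<in> verts \<Gamma>" "y \<in> verts \<Gamma>" for i x y
  proof -
    have "P i x = P i y \<longleftrightarrow> p (n i) x = p (n i) y"
      unfolding P_def using inj(1)[of "n i"] surj(1)[of "n i"] that by (metis imageI inj_on_eq_iff)
    also have "\<dots> \<longleftrightarrow> (x, y) \<in> fst (K (n i))" using that by (simp add: K_def)
    finally show ?thesis using Kn[OF that(1)] by simp
  qed
  have Q_eq: "Q i x = Q i y \<longleftrightarrow> (x, y) \<in> snd i" if "i \<in> I" "x \<in> edges \<Gamma>" "y \<in> edges \<Gamma>" for i x y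
  proof -
    have "Q i x = Q i y \<longleftrightarrow> q (n i) x = q (n i) y"
      unfolding Q_def using inj(2)[of "n i"] surj(2)[of "n i"] that by (metis imageI inj_on_eq_iff)
    also have "\<dots> \<longleftrightarrow> (x, y) \<in> snd (K (n i))" using that by (simp add: K_def)
    finally show ?thesis using Kn[OF that(1)] by simp
  qed
  have pp: "pp i j (P j x) = P i x" if "i \<in> I" "j \<in> I" "R i j" "x \<in> verts \<Gamma>" for i j x
  proof -
    let ?y = "SOME y. y \<in> verts \<Gamma> \<and> P j y = P j x"
    have y: "?y \<in> verts \<Gamma> \<and> P j ?y = P j x"
      by (rule someI[of "\<lambda>y. y \<in> verts \<Gamma> \<and> P j y = P j x" x]) (simp add: that(4))
    then have "(?y, x) \<in> fst j" using P_eq[of j ?y x] that(2,4) by simp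
    then have "(?y, x) \<in> fst i" using that(3) by (auto simp: R_def)
    then show ?thesis using P_eq[of i ?y x] y that(1,4) unfolding pp_def by simp
  qed
  have qq: "qq i j (Q j x) = Q i x" if "i \<in> I" "j \<in> I" "R i j" "x \<in> edges \<Gamma>" for i j x
  proof -
    let ?y = "SOME y. y \<in> edges \<Gamma> \<and> Q j y = Q j x"
    have y: "?y \<in> edges \<Gamma> \<and> Q j ?y = Q j x"
      by (rule someI[of "\<lambda>y. y \<in> edges \<Gamma> \<and> Q j y = Q j x" x]) (simp add: that(4))
    then have "(?y, x) \<in> snd j" using Q_eq[of j ?y x] that(2,4) by simp
    then have "(?y, x) \<in> snd i" using that(3) by (auto simp: R_def)
    then show ?thesis using Q_eq[of i ?y x] y that(1,4) unfolding qq_def by simp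
  qed
  have T_fin: "finite_graph (T i)" for i
    unfolding T_def by (rule transport_graph(1)[OF finite_level inj(2)])
  have PQ: "graph_hom \<Gamma> (T i) (P i) (Q i)" for i
    using graph_hom_comp[OF hom transport_graph(2)[OF finite_level inj(2)]]
    unfolding T_def P_def[abs_def] Q_def[abs_def] comp_def .
  have T_verts: "P i ` verts \<Gamma> = verts (T i)" and T_edges: "Q i ` edges \<Gamma> = edges (T i)" for i
    using surj[of "n i"] unfolding P_def Q_def T_def transport_graph_def by (auto simp: image_image[symmetric])
  have T_pos: "Q i e \<in> pos_edges (T i) \<longleftrightarrow> e \<in> pos_edges \<Gamma>" if "e \<in> edges \<Gamma>" for i e
  proof -
    have "pos_edges (D (n i)) \<subseteq> edges (D (n i))" "q (n i) e \<in> edges (D (n i))"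
      using finite_level[of "n i"] that unfolding surj(2)[symmetric] finite_graph_def serre_graph_def by auto
    then show ?thesis
      using inj_on_image_mem_iff[OF inj(2)] level_pos[OF that]
      by (simp add: T_def transport_graph_def Q_def)
  qed
  have ne: "I \<noteq> {}" by (simp add: I_def)
  have dir: "\<exists>k\<in>I. R i k \<and> R j k" if "i \<in> I" "j \<in> I" for i j
  proof -
    obtain a b where ab: "i = K a" "j = K b" using \<open>i \<in> I\<close> \<open>j \<in> I\<close> unfolding I_def by blast
    have "R (K m) (K k)" if mk: "m \<le> k" for m k
    proof -
      have "p m x = p m y" if "x \<in> verts \<Gamma>" "y \<in> verts \<Gamma>" "p k x = p k y" for x y
        using V.refine[of x y m k] that mk topspaces by simp
      moreover have "q m x = q m y" if "x \<in> edges \<Gamma>" "y \<in> edges \<Gamma>" "q k x = q k y" for x y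
        using E.refine[of x y m k] that mk topspaces by simp
      ultimately show ?thesis unfolding R_def K_def by auto
    qed
    then have "R i (K (max a b))" "R j (K (max a b))" using ab by simp_all
    then show ?thesis by (auto simp: I_def)
  qed
  have refl: "R i i" for i by (simp add: R_def)
  have sys: "inverse_system I R T pp qq"
    unfolding inverse_system_def
  proof (intro conjI ballI impI)
    fix i j k assume "R i j" "R j k" then show "R i k" by (auto simp: R_def)
  next
    fix i j assume ij: "i \<in> I" "j \<in> I" "R i j"
    note pp' = pp[OF ij] and qq' = qq[OF ij]
    show "graph_hom (T j) (T i) (pp i j) (qq i j)"
      unfolding graph_hom_def
    proof (intro conjI ballI)
      show "pp i j \<in> verts (T j) \<rightarrow> verts (T i)"
        unfolding T_verts[symmetric] using pp' by auto
      show "qq i j \<in> edges (T j) \<rightarrow> edges (T i)"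
        unfolding T_edges[symmetric] using qq' by auto
      show "qq i j \<in> pos_edges (T j) \<rightarrow> pos_edges (T i)"
      proof
        fix d assume d: "d \<in> pos_edges (T j)"
        then have "d \<in> edges (T j)" using T_fin[of j] by (auto simp: finite_graph_def serre_graph_def)
        then obtain e where e: "e \<in> edges \<Gamma>" "d = Q j e" unfolding T_edges[symmetric] by blast
        then show "qq i j d \<in> pos_edges (T i)" using d T_pos[OF e(1)] qq' by simp
      qed
      fix d assume "d \<in> edges (T j)"
      then obtain e where e: "e \<in> edges \<Gamma>" "d = Q j e" unfolding T_edges[symmetric] by blast
      have h: "ini (T l) (Q l e) = P l (ini \<Gamma> e)" "ter (T l) (Q l e) = P l (ter \<Gamma> e)"
        "einv (T l) (Q l e) = Q l (einv \<Gamma> e)" for l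
        using PQ[of l] e(1) by (auto simp: graph_hom_def)
      show "ini (T i) (qq i j d) = pp i j (ini (T j) d)" "ter (T i) (qq i j d) = pp i j (ter (T j) d)"
        "einv (T i) (qq i j d) = qq i j (einv (T j) d)"
        using edge_facts[OF e(1)] e qq' pp' by (simp_all add: h)
    qed
  next
    fix i v assume i: "i \<in> I" "v \<in> verts (T i)"
    then obtain x where "x \<in> verts \<Gamma>" "v = P i x" unfolding T_verts[symmetric] by blast
    then show "pp i i v = v" using pp[OF i(1) i(1) refl] by simp
  next
    fix i v assume i: "i \<in> I" "v \<in> edges (T i)"
    then obtain x where "x \<in> edges \<Gamma>" "v = Q i x" unfolding T_edges[symmetric] by blast
    then show "qq i i v = v" using qq[OF i(1) i(1) refl] by simp
  next
    fix i j k v assume i: "i \<in> I" "j \<in> I" "k \<in> I" "R i j" "R j k" "v \<in> verts (T k)"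
    then obtain x where "x \<in> verts \<Gamma>" "v = P k x" unfolding T_verts[symmetric] by blast
    moreover have "R i k" using i by (auto simp: R_def)
    ultimately show "pp i j (pp j k v) = pp i k v" using pp i by simp
  next
    fix i j k v assume i: "i \<in> I" "j \<in> I" "k \<in> I" "R i j" "R j k" "v \<in> edges (T k)"
    then obtain x where "x \<in> edges \<Gamma>" "v = Q k x" unfolding T_edges[symmetric] by blast
    moreover have "R i k" using i by (auto simp: R_def)
    ultimately show "qq i j (qq j k v) = qq i k v" using qq i by simp
  qed (use ne dir refl T_fin in auto)
  let ?L = "limit_graph I R T pp qq"
  have cP: "continuous_map (vtop \<Gamma>) (discrete_topology (verts (T i))) (P i)" for i
  proof -
    have "continuous_map (vtop \<Gamma>) (discrete_topology (verts (T i))) (\<phi> (n i) \<circ> p (n i))"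
      by (rule continuous_map_compose[OF V.cont])
        (use T_verts[of i] topspaces in \<open>auto simp: P_def\<close>)
    then show ?thesis by (simp add: comp_def P_def[abs_def])
  qed
  have cQ: "continuous_map (etop \<Gamma>) (discrete_topology (edges (T i))) (Q i)" for i
  proof -
    have "continuous_map (etop \<Gamma>) (discrete_topology (edges (T i))) (\<psi> (n i) \<circ> q (n i))"
      by (rule continuous_map_compose[OF E.cont])
        (use T_edges[of i] topspaces in \<open>auto simp: Q_def\<close>)
    then show ?thesis by (simp add: comp_def Q_def[abs_def])
  qed
  have hV: "homeomorphic_map (vtop \<Gamma>) (vtop ?L) (\<lambda>x. \<lambda>i\<in>I. P i x)"
  proof -
    have "homeomorphic_map (vtop \<Gamma>) (subtopology (product_topology (\<lambda>i. discrete_topology (verts (T i))) I)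
        (compatible_families I R (\<lambda>i. verts (T i)) pp)) (\<lambda>x. \<lambda>i\<in>I. P i x)"
    proof (rule limit_homeomorphic[OF V.compact ne])
      fix x y assume xy: "x \<in> topspace (vtop \<Gamma>)" "y \<in> topspace (vtop \<Gamma>)" "\<And>i. i \<in> I \<Longrightarrow> P i x = P i y"
      have "p m x = p m y" for m
      proof -
        have "K m \<in> I" by (simp add: I_def)
        then have "(x, y) \<in> fst (K m)" using P_eq xy topspaces by blast
        then show ?thesis by (simp add: K_def)
      qed
      then show "x = y" using V.sep xy by blast
    qed (use cP T_verts pp dir topspaces in auto)
    then show ?thesis by (simp add: limit_graph_def)
  qed
  have hE: "homeomorphic_map (etop \<Gamma>) (etop ?L) (\<lambda>x. \<lambda>i\<in>I. Q i x)"
  proof -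
    have "homeomorphic_map (etop \<Gamma>) (subtopology (product_topology (\<lambda>i. discrete_topology (edges (T i))) I)
        (compatible_families I R (\<lambda>i. edges (T i)) qq)) (\<lambda>x. \<lambda>i\<in>I. Q i x)"
    proof (rule limit_homeomorphic[OF E.compact ne])
      fix x y assume xy: "x \<in> topspace (etop \<Gamma>)" "y \<in> topspace (etop \<Gamma>)" "\<And>i. i \<in> I \<Longrightarrow> Q i x = Q i y"
      have "q m x = q m y" for m
      proof -
        have "K m \<in> I" by (simp add: I_def)
        then have "(x, y) \<in> snd (K m)" using Q_eq xy topspaces by blast
        then show ?thesis by (simp add: K_def)
      qed
      then show "x = y" using E.sep xy by blast
    qed (use cQ T_edges qq dir topspaces in auto)
    then show ?thesis by (simp add: limit_graph_def)
  qed
  have "graph_hom \<Gamma> ?L (\<lambda>x. \<lambda>i\<in>I. P i x) (\<lambda>x. \<lambda>i\<in>I. Q i x)"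
  proof -
    have h: "ini (T i) (Q i e) = P i (ini \<Gamma> e)" "ter (T i) (Q i e) = P i (ter \<Gamma> e)"
        "einv (T i) (Q i e) = Q i (einv \<Gamma> e)" if "e \<in> edges \<Gamma>" for i e
      using PQ[of i] that by (auto simp: graph_hom_def)
    have pe: "e \<in> edges \<Gamma>" if "e \<in> pos_edges \<Gamma>" for e using serre that by (auto simp: serre_graph_def)
    have "(\<lambda>i\<in>I. P i x) \<in> compatible_families I R (\<lambda>i. verts (T i)) pp" if "x \<in> verts \<Gamma>" for x
      using that T_verts pp by (auto simp: compatible_families_def)
    moreover have "(\<lambda>i\<in>I. Q i e) \<in> compatible_families I R (\<lambda>i. edges (T i)) qq" if "e \<in> edges \<Gamma>" for e
      using that T_edges qq by (auto simp: compatible_families_def)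
    moreover have "(\<lambda>i\<in>I. Q i e) \<in> compatible_families I R (\<lambda>i. pos_edges (T i)) qq" if "e \<in> pos_edges \<Gamma>" for e
      using that T_pos[OF pe[OF that]] qq pe by (auto simp: compatible_families_def)
    ultimately show ?thesis
      unfolding graph_hom_def limit_graph_def by (auto simp: h intro!: restrict_ext)
  qed
  then have "top_graph_iso \<Gamma> ?L (\<lambda>x. \<lambda>i\<in>I. P i x) (\<lambda>x. \<lambda>i\<in>I. Q i x)"
    using hV hE by (simp add: top_graph_iso_def)
  then show ?thesis using top sys unfolding profinite_graph_def by blast
qed

end

section \<open>The Cayley graph of the product of the alternating groups\<close>

lemma level_space_prod_discrete:
  assumes X: "level_space X p" and S: "finite S"
  shows "level_space (prod_topology X (discrete_topology S)) (\<lambda>m. map_prod (p m) id)"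
proof -
  interpret X: level_space X p by (rule X)
  let ?Y = "prod_topology X (discrete_topology S)"
  have im: "map_prod (p m) id ` topspace ?Y = (p m ` topspace X) \<times> S" for m
    by (simp add: map_prod_surj_on)
  show ?thesis
  proof
    show "compact_space ?Y"
      using X.compact S by (simp add: compact_space_prod_topology compact_space_discrete_topology)
    show "continuous_map ?Y (discrete_topology (map_prod (p m) id ` topspace ?Y)) (map_prod (p m) id)" for m
    proof -
      have "continuous_map ?Y (prod_topology (discrete_topology (p m ` topspace X)) (discrete_topology S))
          (\<lambda>z. (p m (fst z), snd z))"
        unfolding continuous_map_paired
        using continuous_map_compose[OF continuous_map_fst X.cont] continuous_map_snd
        by (auto simp: comp_def)
      then show ?thesis
        unfolding im prod_topology_discrete_topology by (simp add: map_prod_def case_prod_unfold)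
    qed
    show "finite (map_prod (p m) id ` topspace ?Y)" for m
      unfolding im using X.fin S by simp
    fix x y
    assume xy: "x \<in> topspace ?Y" "y \<in> topspace ?Y"
    show "map_prod (p m) id x = map_prod (p m) id y"
      if "m \<le> k" "map_prod (p k) id x = map_prod (p k) id y" for m k
      using X.refine[of "fst x" "fst y" m k] xy that by (auto simp: map_prod_def split: prod.splits)
    show "x = y" if eq: "\<And>m. map_prod (p m) id x = map_prod (p m) id y"
    proof -
      have "p m (fst x) = p m (fst y)" "snd x = snd y" for m
        using eq[of m] by (auto simp: map_prod_def split: prod.splits)
      moreover have "fst x \<in> topspace X" "fst y \<in> topspace X" using xy by auto
      ultimately show ?thesis using X.sep[of "fst x" "fst y"] by (simp add: prod_eq_iff)
    qed
  qed
qed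

section \<open>Finite levels of the Cayley graph\<close>

definition truncate :: "nat \<Rightarrow> (nat \<Rightarrow> 'a) \<Rightarrow> nat \<Rightarrow> 'a" where
  "truncate m g = restrict g {5..m}"

lemma truncate_apply: "k \<in> {5..m} \<Longrightarrow> truncate m g k = g k"
  by (simp add: truncate_def)

lemma truncate_eq_iff: "truncate m x = truncate m y \<longleftrightarrow> (\<forall>k\<in>{5..m}. x k = y k)"
  by (auto simp: truncate_def restrict_def fun_eq_iff)

lemma topspace_alt_prod_top: "topspace alt_prod_top = carrier alt_prod"
  by (simp add: alt_prod_top_def carrier_alt_prod)

lemma alt_prod_eqI:
  assumes "x \<in> carrier alt_prod" "y \<in> carrier alt_prod" "\<And>k. k \<ge> 5 \<Longrightarrow> x k = y k"
  shows "x = y"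
  using assms unfolding carrier_alt_prod by (intro PiE_ext) auto

lemma continuous_map_coordinate:
  "k \<ge> 5 \<Longrightarrow> continuous_map alt_prod_top (discrete_topology (carrier (alt_group k))) (\<lambda>x. x k)"
  unfolding alt_prod_top_def
  using continuous_map_product_projection[of k "{5..}" "\<lambda>k. discrete_topology (carrier (alt_group k))"]
  by simp

lemma level_space_alt_prod: "level_space alt_prod_top truncate"
proof
  show "compact_space alt_prod_top"
    by (simp add: alt_prod_top_def compact_space_product_topology compact_space_discrete_topology
        finite_carrier_alt_group)
  show "finite (truncate m ` topspace alt_prod_top)" for m
  proof (rule finite_subset)
    show "truncate m ` topspace alt_prod_top \<subseteq> (\<Pi>\<^sub>E k\<in>{5..m}. carrier (alt_group k))"
      unfolding topspace_alt_prod_top carrier_alt_prod by (auto simp: truncate_def)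
    show "finite (\<Pi>\<^sub>E k\<in>{5..m}. carrier (alt_group k))"
      by (intro finite_PiE finite_carrier_alt_group) simp
  qed
  show "continuous_map alt_prod_top (discrete_topology (truncate m ` topspace alt_prod_top)) (truncate m)" for m
  proof -
    have cyl: "openin alt_prod_top {x \<in> topspace alt_prod_top. truncate m x = truncate m y}" for y
    proof -
      have "openin alt_prod_top ((\<Inter>k\<in>{5..m}.
          {x \<in> topspace alt_prod_top. x k \<in> {y k} \<inter> carrier (alt_group k)}) \<inter> topspace alt_prod_top)"
        by (intro openin_INT openin_continuous_map_preimage[OF continuous_map_coordinate]) auto
      also have "(\<Inter>k\<in>{5..m}.
          {x \<in> topspace alt_prod_top. x k \<in> {y k} \<inter> carrier (alt_group k)}) \<inter> topspace alt_prod_top =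
        {x \<in> topspace alt_prod_top. truncate m x = truncate m y}"
        using alt_prod_mem unfolding truncate_eq_iff topspace_alt_prod_top by auto
      finally show ?thesis .
    qed
    have "openin alt_prod_top {x \<in> topspace alt_prod_top. truncate m x \<in> U}"
      if U: "U \<subseteq> truncate m ` topspace alt_prod_top" for U
    proof -
      have "{x \<in> topspace alt_prod_top. truncate m x \<in> U} =
          (\<Union>y\<in>{y \<in> topspace alt_prod_top. truncate m y \<in> U}. {x \<in> topspace alt_prod_top. truncate m x = truncate m y})"
        by auto
      then show ?thesis using cyl by (metis (no_types, lifting) openin_Union image_iff)
    qed
    then show ?thesis by (auto simp: continuous_map_def)
  qed
next
  fix x y :: "nat \<Rightarrow> nat \<Rightarrow> nat" and m k
  assume "m \<le> k" "truncate k x = truncate k y"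
  then show "truncate m x = truncate m y" unfolding truncate_eq_iff by auto
next
  fix x y assume xy: "x \<in> topspace alt_prod_top" "y \<in> topspace alt_prod_top"
    "\<And>m. truncate m x = truncate m y"
  show "x = y"
  proof (rule alt_prod_eqI)
    fix k :: nat assume "5 \<le> k"
    then show "x k = y k" using xy(3)[of k] unfolding truncate_eq_iff by auto
  qed (use xy topspace_alt_prod_top in auto)
qed

text \<open>Edges keep their letters from \<open>A <+> A\<close>, so generators with equal
  truncations still label different edges. Products are formed coordinatewise and cut off again, so
  that all levels have vertices of one type. For \<open>m < 5\<close> there is a single
  vertex.\<close>

definition cayley_level ::
  "(nat \<Rightarrow> nat \<Rightarrow> nat) set \<Rightarrow> nat \<Rightarrow> (nat \<Rightarrow> nat \<Rightarrow> nat, (nat \<Rightarrow> nat \<Rightarrow> nat) \<times> _) sgraph" where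
  "cayley_level A m =
     \<lparr>verts = truncate m ` carrier alt_prod,
      edges = truncate m ` carrier alt_prod \<times> (A <+> A),
      pos_edges = truncate m ` carrier alt_prod \<times> Inl ` A,
      ini = fst,
      ter = (\<lambda>(g, x). truncate m (\<lambda>k. g k \<circ> letter_value alt_prod x k)),
      einv = (\<lambda>(g, x). (truncate m (\<lambda>k. g k \<circ> letter_value alt_prod x k), letter_inv x))\<rparr>"

context
  fixes A assumes A: "finite A" "A \<subseteq> carrier alt_prod"
begin

lemma letter_value_mem: "x \<in> A <+> A \<Longrightarrow> letter_value alt_prod x \<in> carrier alt_prod"
  using A(2) group.inv_closed[OF group_alt_prod] by auto

lemma letter_inv_mem: "x \<in> A <+> A \<Longrightarrow> letter_inv x \<in> A <+> A"
  by auto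

lemma letter_inv_inv: "letter_inv (letter_inv x) = x"
  by (cases x) auto

lemma letter_value_inv:
  "x \<in> A <+> A \<Longrightarrow> letter_value alt_prod (letter_inv x) = inv\<^bsub>alt_prod\<^esub> letter_value alt_prod x"
  using A(2) group.inv_inv[OF group_alt_prod] by auto

lemma mult_letter_mem:
  "g \<in> carrier alt_prod \<Longrightarrow> x \<in> A <+> A \<Longrightarrow> g \<otimes>\<^bsub>alt_prod\<^esub> letter_value alt_prod x \<in> carrier alt_prod"
  using letter_value_mem group.is_monoid[OF group_alt_prod] by (simp add: monoid.m_closed)

lemma mult_letter_inv:
  assumes "g \<in> carrier alt_prod" "x \<in> A <+> A"
  shows "g \<otimes>\<^bsub>alt_prod\<^esub> letter_value alt_prod x \<otimes>\<^bsub>alt_prod\<^esub> letter_value alt_prod (letter_inv x) = g"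
  using assms letter_value_mem[OF assms(2)] group_alt_prod
  by (simp add: letter_value_inv group.inv_closed group.is_monoid monoid.m_assoc group.r_inv)

abbreviation (input) "\<Gamma> \<equiv> cayley_graph alt_prod alt_prod_top A"

lemma serre_cayley: "serre_graph \<Gamma>"
  unfolding serre_graph_def
proof (intro conjI ballI)
  fix e assume "e \<in> edges \<Gamma>"
  then obtain g x where e: "e = (g, x)" "g \<in> carrier alt_prod" "x \<in> A <+> A"
    by (auto simp: cayley_graph_def)
  show "ini \<Gamma> e \<in> verts \<Gamma>" "ter \<Gamma> e \<in> verts \<Gamma>" "einv \<Gamma> e \<in> edges \<Gamma>"
    "einv \<Gamma> (einv \<Gamma> e) = e" "ini \<Gamma> (einv \<Gamma> e) = ter \<Gamma> e" "ter \<Gamma> (einv \<Gamma> e) = ini \<Gamma> e"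
    using e mult_letter_mem[OF e(2,3)] letter_inv_mem[OF e(3)] mult_letter_inv[OF e(2,3)]
    by (simp_all add: cayley_graph_def letter_inv_inv)
  show "(einv \<Gamma> e \<in> pos_edges \<Gamma>) = (e \<notin> pos_edges \<Gamma>)"
    using e mult_letter_mem[OF e(2,3)] by (auto simp: cayley_graph_def)
qed (auto simp: cayley_graph_def)

text \<open>Coordinate \<open>k\<close> of the terminal vertex depends only on coordinate
  \<open>k\<close> of the initial vertex and on the letter, so it factors through a finite discrete
  space.\<close>

lemma topological_cayley: "topological_graph \<Gamma>"
proof -
  let ?S = "discrete_topology (A <+> A)"
  let ?E = "prod_topology alt_prod_top ?S"
  let ?t = "\<lambda>(g, x). g \<otimes>\<^bsub>alt_prod\<^esub> letter_value alt_prod x"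
  have coord: "continuous_map ?E (discrete_topology (carrier (alt_group k))) (\<lambda>z. ?t z k)" if k: "k \<ge> 5" for k
  proof -
    have "continuous_map ?E (discrete_topology (carrier (alt_group k) \<times> (A <+> A))) (\<lambda>z. (fst z k, snd z))"
      unfolding prod_topology_discrete_topology continuous_map_paired
      using continuous_map_compose[OF continuous_map_fst continuous_map_coordinate[OF k]] continuous_map_snd
      by (auto simp: comp_def)
    moreover have "continuous_map (discrete_topology (carrier (alt_group k) \<times> (A <+> A)))
       (discrete_topology (carrier (alt_group k))) (\<lambda>(p, x). p \<circ> letter_value alt_prod x k)"
    proof -
      have "p \<circ> letter_value alt_prod x k \<in> carrier (alt_group k)"
        if "p \<in> carrier (alt_group k)" "x \<in> A <+> A" for p x
        using monoid.m_closed[OF group.is_monoid[OF alt_group_is_group], of p k "letter_value alt_prod x k"]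
          that alt_prod_mem[OF letter_value_mem k] by (simp add: alt_group_mult)
      then show ?thesis by (simp add: Pi_iff split_paired_all)
    qed
    ultimately have "continuous_map ?E (discrete_topology (carrier (alt_group k)))
       ((\<lambda>(p, x). p \<circ> letter_value alt_prod x k) \<circ> (\<lambda>z. (fst z k, snd z)))"
      by (rule continuous_map_compose)
    then show ?thesis by (simp add: comp_def case_prod_unfold alt_prod_mult[OF k])
  qed
  have ter: "continuous_map ?E alt_prod_top ?t"
    unfolding alt_prod_top_def continuous_map_componentwise
  proof (intro conjI ballI)
    show "?t ` topspace (prod_topology (product_topology (\<lambda>k. discrete_topology (carrier (alt_group k))) {5..}) ?S)
      \<subseteq> extensional {5..}"
      by (auto simp: alt_prod_def)
    show "continuous_map (prod_topology (product_topology (\<lambda>k. discrete_topology (carrier (alt_group k))) {5..}) ?S)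
        (discrete_topology (carrier (alt_group k))) (\<lambda>z. ?t z k)" if "k \<in> {5..}" for k
      using coord[of k] that unfolding alt_prod_top_def by simp
  qed
  have einv: "continuous_map ?E ?E (\<lambda>z. (?t z, letter_inv (snd z)))"
    unfolding continuous_map_paired
  proof
    have "continuous_map ?S ?S letter_inv"
      unfolding continuous_map_from_discrete_topology using letter_inv_mem by simp
    then have "continuous_map ?E ?S (letter_inv \<circ> snd)"
      by (rule continuous_map_compose[OF continuous_map_snd])
    then show "continuous_map ?E ?S (\<lambda>z. letter_inv (snd z))" by (simp add: comp_def)
  qed (use ter in auto)
  have eqs: "vtop \<Gamma> = alt_prod_top" "etop \<Gamma> = ?E" "ini \<Gamma> = fst" "ter \<Gamma> = ?t"
    "einv \<Gamma> = (\<lambda>z. (?t z, letter_inv (snd z)))" "verts \<Gamma> = carrier alt_prod"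
    "edges \<Gamma> = carrier alt_prod \<times> (A <+> A)"
    by (auto simp: cayley_graph_def)
  have "topspace ?E = carrier alt_prod \<times> (A <+> A)" by (simp add: topspace_alt_prod_top)
  then show ?thesis
    unfolding topological_graph_def eqs
    by (intro conjI serre_cayley topspace_alt_prod_top continuous_map_fst ter einv)
qed

lemma truncate_mult:
  "truncate m (\<lambda>k. truncate m g k \<circ> letter_value alt_prod x k) = truncate m (g \<otimes>\<^bsub>alt_prod\<^esub> letter_value alt_prod x)"
  by (auto simp: truncate_eq_iff truncate_apply alt_prod_mult)

lemma cayley_hom: "graph_hom \<Gamma> (cayley_level A m) (truncate m) (map_prod (truncate m) id)"
  unfolding graph_hom_def
  by (auto simp: cayley_graph_def cayley_level_def truncate_mult)

lemma cayley_surj: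
  "truncate m ` verts \<Gamma> = verts (cayley_level A m)"
  "map_prod (truncate m) id ` edges \<Gamma> = edges (cayley_level A m)"
  by (simp_all add: cayley_graph_def cayley_level_def map_prod_surj_on)

text \<open>Every edge of the level is an image, so the incidence equations are inherited from the
  Cayley graph; the orientation is read off from the letter.\<close>

lemma finite_cayley_level: "finite_graph (cayley_level A m)"
proof -
  let ?L = "cayley_level A m"
  have "finite (truncate m ` carrier alt_prod)"
    using level_space.fin[OF level_space_alt_prod] by (simp add: topspace_alt_prod_top)
  then have "finite (verts ?L)" "finite (edges ?L)" using A(1) by (simp_all add: cayley_level_def)
  moreover have "serre_graph ?L"
    unfolding serre_graph_def
  proof (intro conjI ballI)
    fix d assume "d \<in> edges ?L"
    then have "d \<in> map_prod (truncate m) id ` edges \<Gamma>" by (simp only: cayley_surj(2))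
    then obtain e where e: "e \<in> edges \<Gamma>" "d = map_prod (truncate m) id e" by (elim imageE) simp
    note s = serre_cayley[unfolded serre_graph_def, THEN conjunct2, rule_format, OF e(1)]
    have e': "e \<in> edges \<Gamma>" "einv \<Gamma> e \<in> edges \<Gamma>" "ini \<Gamma> e \<in> verts \<Gamma>" "ter \<Gamma> e \<in> verts \<Gamma>"
      using s e(1) by auto
    have h: "ini ?L (map_prod (truncate m) id f) = truncate m (ini \<Gamma> f)"
        "ter ?L (map_prod (truncate m) id f) = truncate m (ter \<Gamma> f)"
        "einv ?L (map_prod (truncate m) id f) = map_prod (truncate m) id (einv \<Gamma> f)" if "f \<in> edges \<Gamma>" for f
      using cayley_hom[of m] that by (auto simp: graph_hom_def)
    show "ini ?L d \<in> verts ?L" "ter ?L d \<in> verts ?L" "einv ?L d \<in> edges ?L"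
      unfolding cayley_surj[symmetric] e(2) h[OF e'(1)] by (intro imageI e')+
    show "einv ?L (einv ?L d) = d" "ini ?L (einv ?L d) = ter ?L d" "ter ?L (einv ?L d) = ini ?L d"
      unfolding e(2) h[OF e'(1)] h[OF e'(2)] using s by simp_all
    obtain g x where d: "d = (g, x)" by (cases d)
    then have "x \<in> A <+> A" using \<open>d \<in> edges ?L\<close> by (simp add: cayley_level_def)
    with d show "(einv ?L d \<in> pos_edges ?L) = (d \<notin> pos_edges ?L)"
      using \<open>d \<in> edges ?L\<close> \<open>ter ?L d \<in> verts ?L\<close> by (auto simp: cayley_level_def)
  qed (auto simp: cayley_level_def)
  ultimately show ?thesis by (simp add: finite_graph_def)
qed

lemma cayley_tower: "graph_tower \<Gamma> truncate (\<lambda>m. map_prod (truncate m) id) (cayley_level A)"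
proof -
  have "level_space (vtop \<Gamma>) truncate"
    using level_space_alt_prod by (simp add: cayley_graph_def)
  moreover have "level_space (etop \<Gamma>) (\<lambda>m. map_prod (truncate m) id)"
    using level_space_prod_discrete[OF level_space_alt_prod, of "A <+> A"] A(1) by (simp add: cayley_graph_def)
  ultimately show ?thesis
    unfolding graph_tower_def graph_tower_axioms_def
    using topological_cayley finite_cayley_level cayley_hom cayley_surj by blast
qed

end

text \<open>A glued graph has vertices of its own type, whereas \<open>incomplete_action\<close> is
  fixed on initial segments of \<open>nat\<close> to keep the requests countable.\<close>

lemma incomplete_action_transport:
  assumes V: "finite V" and T: "T \<subseteq> V \<times> {..<n} \<times> V"
    and det: "\<And>x i y y'. (x, i, y) \<in> T \<Longrightarrow> (x, i, y') \<in> T \<Longrightarrow> y = y'"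
    and inj: "\<And>x x' i y. (x, i, y) \<in> T \<Longrightarrow> (x', i, y) \<in> T \<Longrightarrow> x = x'"
    and con: "\<And>x y. x \<in> V \<Longrightarrow> y \<in> V \<Longrightarrow> (x, y) \<in> {(x, y). \<exists>i. (x, i, y) \<in> T \<or> (y, i, x) \<in> T}\<^sup>*"
    and inc: "\<exists>s\<in>V. \<exists>i<n. \<forall>y. (s, i, y) \<notin> T"
  shows "\<exists>\<theta> r. inj_on \<theta> V \<and> incomplete_action n r {(\<theta> x, i, \<theta> y) | x i y. (x, i, y) \<in> T}"
proof -
  obtain \<theta> where \<theta>: "bij_betw \<theta> V {1..card V}"
    using ex_bij_betw_finite_nat[OF V] ex_bij_betw_nat_finite_1[OF V] bij_betw_inv by blast
  have im: "\<theta> ` V = {1..card V}" and ij: "inj_on \<theta> V" using \<theta> by (auto simp: bij_betw_def)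
  let ?E = "{(\<theta> x, i, \<theta> y) | x i y. (x, i, y) \<in> T}"
  have mem: "(\<theta> x, i, \<theta> y) \<in> ?E \<longleftrightarrow> (x, i, y) \<in> T" if "x \<in> V" "y \<in> V" for x i y
  proof
    assume "(\<theta> x, i, \<theta> y) \<in> ?E"
    then obtain x' y' where xy: "\<theta> x = \<theta> x'" "\<theta> y = \<theta> y'" "(x', i, y') \<in> T" by blast
    then have "x = x'" "y = y'" using T that ij by (auto dest: inj_onD)
    then show "(x, i, y) \<in> T" using xy(3) by simp
  qed blast
  have "incomplete_action n (card V) ?E"
    unfolding incomplete_action_def
  proof (intro conjI allI impI ballI)
    show "?E \<subseteq> {1..card V} \<times> {..<n} \<times> {1..card V}" using T unfolding im[symmetric] by auto
    fix x i y y' assume "(x, i, y) \<in> ?E" "(x, i, y') \<in> ?E"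
    then obtain a b a' b' where "x = \<theta> a" "y = \<theta> b" "(a, i, b) \<in> T" "x = \<theta> a'" "y' = \<theta> b'" "(a', i, b') \<in> T"
      by blast
    moreover from this have "a = a'" using T ij by (auto dest: inj_onD)
    ultimately show "y = y'" using det by auto
  next
    fix x x' i y assume "(x, i, y) \<in> ?E" "(x', i, y) \<in> ?E"
    then obtain a b a' b' where "x = \<theta> a" "y = \<theta> b" "(a, i, b) \<in> T" "x' = \<theta> a'" "y = \<theta> b'" "(a', i, b') \<in> T"
      by blast
    moreover from this have "b = b'" using T ij by (auto dest: inj_onD)
    ultimately show "x = x'" using inj by auto
  next
    fix x y assume "x \<in> {1..card V}" "y \<in> {1..card V}"
    then obtain a b where ab: "x = \<theta> a" "y = \<theta> b" "a \<in> V" "b \<in> V" unfolding im[symmetric] by blast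
    have "(\<theta> a, \<theta> b) \<in> {(x, y). \<exists>i. (x, i, y) \<in> ?E \<or> (y, i, x) \<in> ?E}\<^sup>*"
      using con[OF ab(3,4)]
    proof (induction rule: rtrancl_induct)
      case (step c d)
      then obtain i where "(c, i, d) \<in> T \<or> (d, i, c) \<in> T" by blast
      then have "(\<theta> c, i, \<theta> d) \<in> ?E \<or> (\<theta> d, i, \<theta> c) \<in> ?E" by blast
      then have "(\<theta> c, \<theta> d) \<in> {(x, y). \<exists>i. (x, i, y) \<in> ?E \<or> (y, i, x) \<in> ?E}"
        by (intro CollectI case_prodI exI)
      then show ?case using step.IH by (rule rtrancl_into_rtrancl[rotated])
    qed simp
    then show "(x, y) \<in> {(x, y). \<exists>i. (x, i, y) \<in> ?E \<or> (y, i, x) \<in> ?E}\<^sup>*" using ab by simp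
  next
    obtain s i where s: "s \<in> V" "i < n" "\<And>y. (s, i, y) \<notin> T" using inc by blast
    have "(\<theta> s, i, y) \<notin> ?E" for y
    proof
      assume "(\<theta> s, i, y) \<in> ?E"
      then obtain a b where "\<theta> s = \<theta> a" "(a, i, b) \<in> T" by blast
      moreover from this have "s = a" using T s(1) ij by (auto dest: inj_onD)
      ultimately show False using s(3) by simp
    qed
    then show "\<exists>s\<in>{1..card V}. \<exists>i<n. \<forall>y. (s, i, y) \<notin> ?E" using s im by blast
  qed
  then show ?thesis using ij by blast
qed

section \<open>Generators that complete every partial action\<close>

locale solving_generators =
  fixes n :: nat and \<tau> :: "nat \<Rightarrow> nat \<Rightarrow> nat \<Rightarrow> nat"
  assumes n: "n \<ge> 2"
    and gen: "\<And>k. k \<ge> 5 \<Longrightarrow> generating_family n k (\<tau> k)"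
    and solve: "\<And>r E b. incomplete_action n r E \<Longrightarrow>
      \<exists>k>b. k \<ge> 5 \<and> r \<le> k \<and> (\<forall>x i y. (x, i, y) \<in> E \<longrightarrow> \<tau> k i x = y)"
begin

definition a :: "nat \<Rightarrow> nat \<Rightarrow> nat \<Rightarrow> nat" where "a i = (\<lambda>k\<in>{5..}. \<tau> k i)"

definition A where "A = a ` {..<n}"

lemma a_apply: "k \<ge> 5 \<Longrightarrow> a i k = \<tau> k i"
  by (simp add: a_def)

lemma A_carrier: "A \<subseteq> carrier alt_prod"
  using gen unfolding A_def a_def carrier_alt_prod generating_family_def by auto

lemma a_carrier: "i < n \<Longrightarrow> a i \<in> carrier alt_prod"
  using A_carrier by (auto simp: A_def)

lemma finite_A: "finite A"
  by (simp add: A_def)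

lemma inj_a: "inj_on a {..<n}"
proof (rule inj_onI)
  fix i j assume ij: "i \<in> {..<n}" "j \<in> {..<n}" "a i = a j"
  obtain k where k: "k \<ge> 5" "\<forall>x i y. (x, i, y) \<in> {(1, i, i + 2) | i. i < n} \<longrightarrow> \<tau> k i x = y"
    using solve[OF incomplete_action_star[OF n], of 0] by (elim exE conjE)
  have "\<tau> k l 1 = l + 2" if "l < n" for l using k(2)[rule_format, of 1 l "l + 2"] that by simp
  moreover have "\<tau> k i = \<tau> k j" using ij(3) a_apply[OF k(1)] by metis
  ultimately show "i = j" using ij by (metis add_right_cancel lessThan_iff)
qed

lemma card_A: "card A = n"
  using card_image[OF inj_a] by (simp add: A_def)

abbreviation (input) H where "H \<equiv> generate alt_prod A"

lemma subgroup_H: "subgroup H alt_prod"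
  by (rule group.generate_is_subgroup[OF group_alt_prod A_carrier])

lemma H_surj:
  assumes k: "k \<ge> 5" shows "(\<lambda>h. h k) ` H = carrier (alt_group k)"
proof
  show "(\<lambda>h. h k) ` H \<subseteq> carrier (alt_group k)"
    using alt_prod_mem[OF subgroup.mem_carrier[OF subgroup_H] k] by auto
  have "\<exists>h\<in>H. h k = x" if "x \<in> generate (alt_group k) (\<tau> k ` {..<n})" for x
    using that
  proof induction
    case one
    then show ?case
      using generate.one[of alt_prod A] alt_prod_one[OF k] by (metis alt_group_one)
  next
    case (incl x)
    then obtain i where i: "i < n" "x = \<tau> k i" by auto
    then have "a i \<in> H" by (intro generate.incl) (auto simp: A_def)
    then show ?case using a_apply[OF k, of i] i by metis
  next
    case (inv x)
    then obtain i where i: "i < n" "x = \<tau> k i" by auto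
    then have "inv\<^bsub>alt_prod\<^esub> a i \<in> H" by (intro generate.inv) (auto simp: A_def)
    moreover have "(inv\<^bsub>alt_prod\<^esub> a i) k = inv' x"
      using alt_prod_inv[OF a_carrier[OF i(1)] k] a_apply[OF k] i by simp
    moreover have "inv\<^bsub>alt_group k\<^esub> x = inv' x"
      using gen[OF k] i by (intro alt_group_inv_equality) (auto simp: generating_family_def)
    ultimately show ?case by metis
  next
    case (eng x y)
    then obtain g h where gh: "g \<in> H" "g k = x" "h \<in> H" "h k = y" by blast
    then have "g \<otimes>\<^bsub>alt_prod\<^esub> h \<in> H" by (intro generate.eng)
    then show ?case using alt_prod_mult[OF k, of g h] gh by (metis alt_group_mult)
  qed
  then show "carrier (alt_group k) \<subseteq> (\<lambda>h. h k) ` H"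
    using gen[OF k] by (auto simp: generating_family_def)
qed

lemma H_dense:
  assumes "g \<in> carrier alt_prod" shows "\<exists>h\<in>H. truncate m h = truncate m g"
  using subdirect_dense[OF subgroup_H H_surj assms] unfolding truncate_eq_iff by blast

lemma top_generates_A: "top_generates alt_prod alt_prod_top A"
proof -
  interpret level_space alt_prod_top truncate by (rule level_space_alt_prod)
  have HT: "H \<subseteq> topspace alt_prod_top"
    using subgroup.subset[OF subgroup_H] topspace_alt_prod_top by simp
  have "g \<in> alt_prod_top closure_of H" if g: "g \<in> carrier alt_prod" for g
  proof (rule closed_limit)
    show "g \<in> topspace alt_prod_top" using g topspace_alt_prod_top by simp
    show "truncate m g \<in> truncate m ` (alt_prod_top closure_of H)" for m
      using H_dense[OF g, of m] closure_of_subset[OF HT] by (metis image_eqI subsetD)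
  qed simp
  then have "alt_prod_top closure_of H = carrier alt_prod"
    using closure_of_subset_topspace[of alt_prod_top H] topspace_alt_prod_top by auto
  then show ?thesis using A_carrier by (simp add: top_generates_def)
qed

sublocale G: graph_tower "cayley_graph alt_prod alt_prod_top A" truncate
  "\<lambda>m. map_prod (truncate m) id" "cayley_level A"
  by (rule cayley_tower[OF finite_A A_carrier])

abbreviation (input) \<Gamma> where "\<Gamma> \<equiv> cayley_graph alt_prod alt_prod_top A"
abbreviation (input) q where "q m \<equiv> map_prod (truncate m) id"

lemma verts_\<Gamma>: "verts \<Gamma> = carrier alt_prod"
  by (simp add: cayley_graph_def)

lemma edge_\<Gamma>: "g \<in> carrier alt_prod \<Longrightarrow> x \<in> A <+> A \<Longrightarrow> (g, x) \<in> edges \<Gamma>"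
  by (simp add: cayley_graph_def)

text \<open>Density gives an element of the abstract group that agrees at level \<open>m\<close>
  with the quotient of \<open>u\<close> and \<open>v\<close>; a word for it is a path between their
  truncations.\<close>

lemma level_connected_whole: "G.level_connected m (verts \<Gamma>) (edges \<Gamma>)"
  unfolding G.level_connected_def
proof (intro ballI)
  fix u v assume uv: "u \<in> verts \<Gamma>" "v \<in> verts \<Gamma>"
  let ?E = "(edge_rel (cayley_level A m) (q m ` edges \<Gamma>))\<^sup>*"
  have edge: "(truncate m g, truncate m (g \<otimes>\<^bsub>alt_prod\<^esub> letter_value alt_prod x)) \<in> ?E"
    if "g \<in> carrier alt_prod" "x \<in> A <+> A" for g x
  proof -
    have e: "(g, x) \<in> edges \<Gamma>" using edge_\<Gamma> that by blast
    have "(ini (cayley_level A m) (q m (g, x)), ter (cayley_level A m) (q m (g, x)))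
        \<in> edge_rel (cayley_level A m) (q m ` edges \<Gamma>)"
      unfolding edge_rel_def using e by blast
    then have "(truncate m (ini \<Gamma> (g, x)), truncate m (ter \<Gamma> (g, x))) \<in> ?E"
      unfolding G.level_edge[OF e] by (rule r_into_rtrancl)
    then show ?thesis by (simp add: cayley_graph_def)
  qed
  have path: "\<forall>g\<in>carrier alt_prod. (truncate m g, truncate m (g \<otimes>\<^bsub>alt_prod\<^esub> h)) \<in> ?E" if "h \<in> H" for h
    using that
  proof induction
    case one
    then show ?case using group.is_monoid[OF group_alt_prod] by (simp add: monoid.r_one)
  next
    case (incl h)
    show ?case using edge[OF _ InlI[OF incl]] unfolding letter_value.simps by blast
  next
    case (inv h)
    show ?case using edge[OF _ InrI[OF inv]] unfolding letter_value.simps by blast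
  next
    case (eng h1 h2)
    show ?case
    proof
      fix g assume g: "g \<in> carrier alt_prod"
      have h: "h1 \<in> carrier alt_prod" "h2 \<in> carrier alt_prod"
        using eng.hyps subgroup.mem_carrier[OF subgroup_H] by auto
      have "g \<otimes>\<^bsub>alt_prod\<^esub> h1 \<in> carrier alt_prod"
        using monoid.m_closed[OF group.is_monoid[OF group_alt_prod] g h(1)] .
      then have "(truncate m (g \<otimes>\<^bsub>alt_prod\<^esub> h1), truncate m (g \<otimes>\<^bsub>alt_prod\<^esub> h1 \<otimes>\<^bsub>alt_prod\<^esub> h2)) \<in> ?E"
        using eng.IH(2) by (rule bspec[rotated])
      moreover have "(truncate m g, truncate m (g \<otimes>\<^bsub>alt_prod\<^esub> h1)) \<in> ?E"
        using eng.IH(1) g by (rule bspec)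
      ultimately show "(truncate m g, truncate m (g \<otimes>\<^bsub>alt_prod\<^esub> (h1 \<otimes>\<^bsub>alt_prod\<^esub> h2))) \<in> ?E"
        unfolding monoid.m_assoc[OF group.is_monoid[OF group_alt_prod] g h, symmetric]
        by (rule rtrancl_trans[rotated])
    qed
  qed
  have uc: "u \<in> carrier alt_prod" "v \<in> carrier alt_prod" using uv verts_\<Gamma> by auto
  have "inv\<^bsub>alt_prod\<^esub> u \<otimes>\<^bsub>alt_prod\<^esub> v \<in> carrier alt_prod"
    using uc group_alt_prod by (simp add: monoid.m_closed group.is_monoid group.inv_closed)
  then obtain h where h: "h \<in> H" "truncate m h = truncate m (inv\<^bsub>alt_prod\<^esub> u \<otimes>\<^bsub>alt_prod\<^esub> v)"
    using H_dense by blast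
  have "truncate m (u \<otimes>\<^bsub>alt_prod\<^esub> h) = truncate m v"
    unfolding truncate_eq_iff
  proof
    fix k assume k: "k \<in> {5..m}"
    have "u k permutes {1..k}" using alt_prod_mem[OF uc(1), of k] k by (simp add: alt_group_carrier)
    then have "u k \<circ> (inv' (u k) \<circ> v k) = v k" by (metis comp_assoc id_comp permutes_inv_o(1))
    moreover have "h k = inv' (u k) \<circ> v k"
      using h(2) k unfolding truncate_eq_iff by (simp add: alt_prod_mult alt_prod_inv[OF uc(1)])
    ultimately show "(u \<otimes>\<^bsub>alt_prod\<^esub> h) k = v k" using k by (simp add: alt_prod_mult)
  qed
  then show "(truncate m u, truncate m v) \<in> ?E" using path[OF h(1)] uc(1) by metis
qed

end

lemma (in graph_tower) level_relE:
  assumes "(y, z) \<in> edge_rel (D m) (q m ` F)" "F \<subseteq> edges \<Gamma>"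
  obtains e where "e \<in> F" "y = p m (ini \<Gamma> e)" "z = p m (ter \<Gamma> e)"
proof -
  from assms(1) obtain e where e: "e \<in> F" "y = ini (D m) (q m e)" "z = ter (D m) (q m e)"
    unfolding edge_rel_def by blast
  then have "e \<in> edges \<Gamma>" using assms(2) by blast
  then show ?thesis using that e level_edge by simp
qed

section \<open>Gluing two subgraphs of a level\<close>

context solving_generators
begin

definition act :: "nat \<Rightarrow> nat \<Rightarrow> (nat \<Rightarrow> nat \<Rightarrow> nat) \<Rightarrow> nat \<Rightarrow> nat \<Rightarrow> nat" where
  "act m i g = truncate m (\<lambda>k. g k \<circ> a i k)"

lemma act_truncate: "act m i (truncate m g) = truncate m (g \<otimes>\<^bsub>alt_prod\<^esub> a i)"
  by (auto simp: act_def truncate_eq_iff truncate_apply alt_prod_mult)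

lemma act_inj:
  assumes "i < n" "g \<in> truncate m ` carrier alt_prod" "h \<in> truncate m ` carrier alt_prod"
    and eq: "act m i g = act m i h"
  shows "g = h"
proof -
  obtain g' h' where gh: "g = truncate m g'" "h = truncate m h'" using assms(2,3) by blast
  have "g' k = h' k" if k: "k \<in> {5..m}" for k
  proof -
    have "a i k permutes {1..k}"
      using alt_prod_mem[OF a_carrier[OF assms(1)], of k] k by (simp add: alt_group_carrier)
    then have "surj (a i k)" by (rule permutes_surj)
    moreover have "g' k \<circ> a i k = h' k \<circ> a i k"
      using eq k unfolding act_def gh truncate_eq_iff by (auto simp: truncate_apply)
    ultimately show ?thesis by (intro surj_fun_eq[of "a i k" UNIV]) simp_all
  qed
  then show ?thesis unfolding gh truncate_eq_iff by blast
qed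

lemma level_ini_ter:
  "ini (cayley_level A m) (g, x) = g" "ter (cayley_level A m) (g, Inl (a i)) = act m i g"
  by (simp_all add: cayley_level_def act_def)

lemma letter_cases:
  assumes "x \<in> A <+> A" obtains i where "i < n" "x = Inl (a i)" | i where "i < n" "x = Inr (a i)"
  using assms by (auto simp: A_def)

text \<open>Edges with inverse letters are turned around, so that the inductions below meet only
  edges labelled by generators, traversed in either direction, and receive them as elements of
  \<open>F\<close> in the full graph.\<close>

lemma level_path_induct [consumes 2, case_names base fwd bwd]:
  assumes F: "closed_subgraph \<Gamma> W F"
    and path: "(y0, y) \<in> (edge_rel (cayley_level A m) (q m ` F))\<^sup>*"
    and base: "P y0"
    and fwd: "\<And>g i. i < n \<Longrightarrow> g \<in> carrier alt_prod \<Longrightarrow> (g, Inl (a i)) \<in> F \<Longrightarrow> P (truncate m g) \<Longrightarrow>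
      P (truncate m (g \<otimes>\<^bsub>alt_prod\<^esub> a i))"
    and bwd: "\<And>g i. i < n \<Longrightarrow> g \<in> carrier alt_prod \<Longrightarrow> (g, Inl (a i)) \<in> F \<Longrightarrow>
      P (truncate m (g \<otimes>\<^bsub>alt_prod\<^esub> a i)) \<Longrightarrow> P (truncate m g)"
  shows "P y"
  using path
proof (induction rule: rtrancl_induct)
  case (step y z)
  note c = G.closed_subgraphD[OF F]
  obtain e where e: "e \<in> F" and yz: "y = truncate m (ini \<Gamma> e)" "z = truncate m (ter \<Gamma> e)"
    using step.hyps(2) c(2) by (rule G.level_relE)
  have eG: "e \<in> edges \<Gamma>" using e c(2) by blast
  obtain g x where gx: "e = (g, x)" by (cases e)
  then have g: "g \<in> carrier alt_prod" "x \<in> A <+> A" using eG by (simp_all add: cayley_graph_def)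
  from g(2) show ?case
  proof (cases rule: letter_cases)
    case (1 i)
    then show ?thesis using fwd[OF 1(1) g(1)] e gx yz step.IH by (simp add: cayley_graph_def)
  next
    case (2 i)
    let ?h = "ter \<Gamma> e"
    have "einv \<Gamma> e = (?h, Inl (a i))" using gx 2 by (simp add: cayley_graph_def)
    then have "(?h, Inl (a i)) \<in> F" "?h \<in> carrier alt_prod" "?h \<otimes>\<^bsub>alt_prod\<^esub> a i = g"
      using c(7)[OF e] G.edge_facts(2,5)[OF eG] verts_\<Gamma> gx by (simp_all add: cayley_graph_def)
    then show ?thesis using bwd[OF 2(1), of ?h] step.IH yz gx by (simp add: cayley_graph_def)
  qed
qed (rule base)

text \<open>Suppose \<open>u\<close> and \<open>v\<close> lie in different components of the intersection of the images at
  level \<open>m\<close>, and let \<open>C\<close> be the component of \<open>u\<close>. Gluing the two images along \<open>C\<close> yields a finite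
  incomplete action in which the two copies of \<open>v\<close> are distinct. At a level \<open>k\<close> where the
  generators extend this action, \<open>w k (\<theta> (\<iota> (truncate m w)))\<close> is constant along the edges of
  both subgraphs, so the two copies of \<open>v\<close> coincide after all.\<close>

lemma path_in_intersection:
  assumes c1: "closed_subgraph \<Gamma> W1 F1" and c2: "closed_subgraph \<Gamma> W2 F2"
    and l1: "\<And>k. G.level_connected k W1 F1" and l2: "\<And>k. G.level_connected k W2 F2"
    and u: "u \<in> W1" "u \<in> W2" and v: "v \<in> W1" "v \<in> W2"
  shows "(truncate m u, truncate m v) \<in> (edge_rel (cayley_level A m) (q m ` F1 \<inter> q m ` F2))\<^sup>*"
proof (rule ccontr)
  assume contra: "\<not> ?thesis"
  let ?D = "cayley_level A m"
  define S where "S = q m ` F1 \<inter> q m ` F2"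
  define C where "C = {b. (truncate m u, b) \<in> (edge_rel ?D S)\<^sup>*}"
  have uC: "truncate m u \<in> C" by (simp add: C_def)
  have vC: "truncate m v \<notin> C" using contra by (simp add: C_def S_def)
  \<comment> \<open>A Boolean index selects the subgraph, so that both are treated at once.\<close>
  define F where "F s = (if s then F2 else F1)" for s
  define Q where "Q s = q m ` F s" for s
  define W where "W s = (if s then W2 else W1)" for s
  have c: "closed_subgraph \<Gamma> (W s) (F s)" and l: "G.level_connected k (W s) (F s)"
    and uW: "u \<in> W s" and vW: "v \<in> W s" for s k
    using c1 c2 l1 l2 u v by (auto simp: F_def W_def)
  note d = G.closed_subgraphD[OF c]
  have Wc: "W s \<subseteq> carrier alt_prod" for s using d(1)[of s] verts_\<Gamma> by simp
  have uc: "u \<in> carrier alt_prod" "v \<in> carrier alt_prod" using uW vW Wc by blast+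
  \<comment> \<open>The gluing: outside \<open>C\<close> a vertex carries the tag of its subgraph,
    inside \<open>C\<close> both copies carry the tag \<open>False\<close>.\<close>
  define \<iota> where "\<iota> s y = (y, s \<and> y \<notin> C)" for s and y :: "nat \<Rightarrow> nat \<Rightarrow> nat"
  define V where "V = (\<Union>s. \<iota> s ` truncate m ` W s)"
  \<comment> \<open>The triples run against the edges. In \<open>\<Phi>\<close> below, passing from
    \<open>g\<close> to its product with \<open>a i\<close> inserts \<open>\<tau> k i\<close> as the
    factor applied first, and this must lead back from the end of the edge to its start.\<close>
  define T where "T = {(\<iota> s (act m i g), i, \<iota> s g) | s i g. i < n \<and> (g, Inl (a i)) \<in> Q s}"
  have ends: "g \<in> truncate m ` W s" "act m i g \<in> truncate m ` W s" "g \<in> truncate m ` carrier alt_prod"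
    if gi: "(g, Inl (a i)) \<in> Q s" for s g i
  proof -
    obtain e where e: "e \<in> F s" "q m e = (g, Inl (a i))" using gi unfolding Q_def by (elim imageE) simp
    have "e \<in> edges \<Gamma>" using e(1) d(2) by blast
    from G.level_edge(1,2)[OF this, of m]
    have "g = truncate m (ini \<Gamma> e)" "act m i g = truncate m (ter \<Gamma> e)" unfolding e(2) level_ini_ter by auto
    then show "g \<in> truncate m ` W s" "act m i g \<in> truncate m ` W s" using d(5,6)[OF e(1)] by blast+
    then show "g \<in> truncate m ` carrier alt_prod" using Wc[of s] by blast
  qed
  have symS: "sym ((edge_rel ?D S)\<^sup>*)"
  proof (rule edge_rel_sym)
    fix e assume "e \<in> S"
    then obtain e1 e2 where e: "e1 \<in> F1" "e = q m e1" "e2 \<in> F2" "e = q m e2"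
      unfolding S_def by (elim IntE imageE) simp
    have eG: "e1 \<in> edges \<Gamma>" "e2 \<in> edges \<Gamma>" using e d(2)[of False] d(2)[of True] by (auto simp: F_def)
    have inv: "einv \<Gamma> e1 \<in> F1" "einv \<Gamma> e2 \<in> F2" using d(7)[of e1 False] d(7)[of e2 True] e by (auto simp: F_def)
    have "einv ?D e = q m (einv \<Gamma> e1)" "einv ?D e = q m (einv \<Gamma> e2)"
      using G.level_edge(3)[OF eG(1), of m] G.level_edge(3)[OF eG(2), of m] e(2,4) by simp_all
    then have "einv ?D e \<in> S" using imageI[OF inv(1), of "q m"] imageI[OF inv(2), of "q m"] by (simp add: S_def)
    moreover have "e \<in> edges ?D"
      unfolding G.surj(2)[symmetric] e(2) using eG(1) by (rule imageI)
    ultimately show "einv ?D e \<in> S \<and> ini ?D (einv ?D e) = ter ?D e \<and> ter ?D (einv ?D e) = ini ?D e"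
      using finite_cayley_level[OF finite_A A_carrier, of m]
      unfolding finite_graph_def serre_graph_def by blast
  qed
  have C_iff: "g \<in> C \<longleftrightarrow> act m i g \<in> C" if "(g, Inl (a i)) \<in> S" for g i
  proof -
    have "(ini ?D (g, Inl (a i)), ter ?D (g, Inl (a i))) \<in> edge_rel ?D S"
      unfolding edge_rel_def using that by blast
    then have 1: "(g, act m i g) \<in> (edge_rel ?D S)\<^sup>*" unfolding level_ini_ter by (rule r_into_rtrancl)
    then have 2: "(act m i g, g) \<in> (edge_rel ?D S)\<^sup>*" by (rule symD[OF symS])
    show ?thesis unfolding C_def mem_Collect_eq using 1 2 rtrancl_trans by metis
  qed
  have \<iota>_iff: "\<iota> s g = \<iota> s' g \<longleftrightarrow> \<iota> s (act m i g) = \<iota> s' (act m i g)"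
    if "(g, Inl (a i)) \<in> Q s" "(g, Inl (a i)) \<in> Q s'" for s s' g i
  proof (cases "s = s'")
    case False
    then have "(g, Inl (a i)) \<in> S" using that by (auto simp: S_def Q_def F_def split: if_splits)
    then show ?thesis using C_iff by (auto simp: \<iota>_def)
  qed simp
  have VI: "\<iota> s y \<in> V" if "y \<in> truncate m ` W s" for s y
    using that unfolding V_def by (intro UN_I[of s] imageI) simp_all
  have T_V: "T \<subseteq> V \<times> {..<n} \<times> V"
  proof
    fix t assume "t \<in> T"
    then obtain s i g where t: "t = (\<iota> s (act m i g), i, \<iota> s g)" "i < n" "(g, Inl (a i)) \<in> Q s"
      unfolding T_def by (elim CollectE exE conjE)
    then show "t \<in> V \<times> {..<n} \<times> V" using VI[OF ends(1)[OF t(3)]] VI[OF ends(2)[OF t(3)]] by simp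
  qed
  have finV: "finite V"
  proof -
    have "finite (truncate m ` W s)" for s
      using finite_subset[OF image_mono[OF Wc]] level_space.fin[OF level_space_alt_prod]
        topspace_alt_prod_top by metis
    then show ?thesis by (simp add: V_def)
  qed
  \<comment> \<open>As the triples are reversed, this is the uniqueness of the edge with letter
    \<open>i\<close> that ends at a given vertex, and \<open>inj\<close> is that of the edge
    starting there; \<open>\<iota>_iff\<close> makes both compatible with the gluing.\<close>
  have det: "y = y'" if "(x, i, y) \<in> T" "(x, i, y') \<in> T" for x i y y'
  proof -
    obtain s g where g: "x = \<iota> s (act m i g)" "y = \<iota> s g" "i < n" "(g, Inl (a i)) \<in> Q s"
      using \<open>(x, i, y) \<in> T\<close> unfolding T_def by (elim CollectE exE conjE) simp
    obtain s' h where h: "x = \<iota> s' (act m i h)" "y' = \<iota> s' h" "(h, Inl (a i)) \<in> Q s'"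
      using \<open>(x, i, y') \<in> T\<close> unfolding T_def by (elim CollectE exE conjE) simp
    have "act m i g = act m i h" using g(1) h(1) by (simp add: \<iota>_def)
    then have "g = h" using act_inj[OF g(3) ends(3)[OF g(4)] ends(3)[OF h(3)]] by blast
    then show ?thesis using \<iota>_iff[of g i s s'] g h by simp
  qed
  have inj: "x = x'" if "(x, i, y) \<in> T" "(x', i, y) \<in> T" for x x' i y
  proof -
    obtain s g where g: "x = \<iota> s (act m i g)" "y = \<iota> s g" "(g, Inl (a i)) \<in> Q s"
      using \<open>(x, i, y) \<in> T\<close> unfolding T_def by (elim CollectE exE conjE) simp
    obtain s' h where h: "x' = \<iota> s' (act m i h)" "y = \<iota> s' h" "(h, Inl (a i)) \<in> Q s'"
      using \<open>(x', i, y) \<in> T\<close> unfolding T_def by (elim CollectE exE conjE) simp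
    have "g = h" using g(2) h(2) by (simp add: \<iota>_def)
    then show ?thesis using \<iota>_iff[of g i s s'] g h by simp
  qed
  let ?Adj = "{(x, y). \<exists>i. (x, i, y) \<in> T \<or> (y, i, x) \<in> T}"
  have T_edge: "(\<iota> s (truncate m (g \<otimes>\<^bsub>alt_prod\<^esub> a i)), i, \<iota> s (truncate m g)) \<in> T"
    if "i < n" "(g, Inl (a i)) \<in> F s" for s g i
  proof -
    have "(truncate m g, Inl (a i)) \<in> Q s" using that(2) unfolding Q_def by (force simp: image_iff)
    then show ?thesis unfolding T_def act_truncate[symmetric] using that(1) by blast
  qed
  have reach: "(\<iota> s (truncate m u), \<iota> s y) \<in> ?Adj\<^sup>*" if y: "y \<in> truncate m ` W s" for s y
  proof -
    have "(truncate m u, y) \<in> (edge_rel ?D (Q s))\<^sup>*"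
      using l[of m s] uW[of s] y unfolding G.level_connected_def Q_def by blast
    with c[of s] show ?thesis
      unfolding Q_def
    proof (induction rule: level_path_induct)
      case (fwd g i)
      have "(\<iota> s (truncate m g), \<iota> s (truncate m (g \<otimes>\<^bsub>alt_prod\<^esub> a i))) \<in> ?Adj"
        using T_edge[OF fwd(1,3)] by blast
      with fwd(4) show ?case by (rule rtrancl_into_rtrancl)
    next
      case (bwd g i)
      have "(\<iota> s (truncate m (g \<otimes>\<^bsub>alt_prod\<^esub> a i)), \<iota> s (truncate m g)) \<in> ?Adj"
        using T_edge[OF bwd(1,3)] by blast
      with bwd(4) show ?case by (rule rtrancl_into_rtrancl)
    qed simp
  qed
  have symAdj: "sym (?Adj\<^sup>*)" by (rule sym_rtrancl) (auto simp: sym_def)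
  \<comment> \<open>Each subgraph is connected at level \<open>m\<close>, and the two are glued at
    \<open>u\<close>.\<close>
  have con: "(x, y) \<in> ?Adj\<^sup>*" if "x \<in> V" "y \<in> V" for x y
  proof -
    have base: "(\<iota> False (truncate m u), z) \<in> ?Adj\<^sup>*" if z: "z \<in> V" for z
    proof -
      obtain s w where "z = \<iota> s w" "w \<in> truncate m ` W s" using z unfolding V_def by blast
      moreover have "\<iota> s (truncate m u) = \<iota> False (truncate m u)" using uC by (simp add: \<iota>_def)
      ultimately show ?thesis using reach[of w s] by simp
    qed
    show ?thesis using symD[OF symAdj base[OF that(1)]] base[OF that(2)] by (rule rtrancl_trans)
  qed
  have inc: "\<exists>s\<in>V. \<exists>i<n. \<forall>y. (s, i, y) \<notin> T"
  proof (rule ccontr)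
    assume "\<not> ?thesis"
    then have complete: "\<And>x i. x \<in> V \<Longrightarrow> i < n \<Longrightarrow> \<exists>y. (x, i, y) \<in> T" by blast
    \<comment> \<open>In a complete action the common vertices outside \<open>C\<close> would be closed under all letters,
      hence comprise the whole level, including \<open>u\<close>.\<close>
    define B where "B = truncate m ` W False \<inter> truncate m ` W True - C"
    have vB: "truncate m v \<in> B" using vW vC by (auto simp: B_def)
    have B_sub: "B \<subseteq> truncate m ` carrier alt_prod" using Wc[of False] by (auto simp: B_def)
    have finB: "finite B"
      using finite_subset[OF B_sub] level_space.fin[OF level_space_alt_prod] topspace_alt_prod_top by metis
    \<comment> \<open>Completeness gives an edge with letter \<open>i\<close> into \<open>z\<close>
      in each subgraph. By \<open>act_inj\<close> they coincide, so the edge lies in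
      \<open>S\<close>, and its start is outside \<open>C\<close> because \<open>z\<close>
      is.\<close>
    have pull: "z \<in> act m i ` B" if z: "z \<in> B" and i: "i < n" for z i
    proof -
      have copy: "\<exists>g. z = act m i g \<and> (g, Inl (a i)) \<in> Q s" for s
      proof -
        have "\<iota> s z \<in> V" using z VI[of z s] by (cases s) (auto simp: B_def)
        from complete[OF this i] obtain s' g where g: "\<iota> s z = \<iota> s' (act m i g)" "(g, Inl (a i)) \<in> Q s'"
          unfolding T_def by blast
        then have "s = s'" "z = act m i g" using z by (auto simp: \<iota>_def B_def)
        then show ?thesis using g by blast
      qed
      obtain g where g: "z = act m i g" "(g, Inl (a i)) \<in> Q False" using copy by blast
      obtain h where h: "z = act m i h" "(h, Inl (a i)) \<in> Q True" using copy by blast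
      have gh: "g = h" using act_inj[OF i ends(3)[OF g(2)] ends(3)[OF h(2)]] g(1) h(1) by simp
      have "(g, Inl (a i)) \<in> S" using g(2) h(2) gh by (simp add: S_def Q_def F_def)
      then have "g \<notin> C" using C_iff[of g i] z g(1) by (simp add: B_def)
      then have "g \<in> B" using ends(1)[OF g(2)] ends(1)[OF h(2)] gh by (simp add: B_def)
      then show ?thesis using g(1) by blast
    qed
    have act_B: "act m i ` B = B" if i: "i < n" for i
    proof -
      \<comment> \<open>The image is no larger than the finite set \<open>B\<close>, so containing
        \<open>B\<close> forces equality.\<close>
      have "B \<subseteq> act m i ` B" using pull[OF _ i] by blast
      then show ?thesis using card_seteq[of "act m i ` B" B] card_image_le[OF finB, of "act m i"] finB by simp
    qed
    have "(truncate m v, truncate m u) \<in> (edge_rel ?D (q m ` edges \<Gamma>))\<^sup>*"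
      using level_connected_whole[of m] uc verts_\<Gamma> unfolding G.level_connected_def by blast
    with G.whole_subgraph have "truncate m u \<in> B"
    proof (induction rule: level_path_induct)
      case base
      show ?case by (rule vB)
    next
      case (fwd g i)
      then show ?case using act_B[OF fwd(1)] act_truncate[of m i g] by (metis imageI)
    next
      case (bwd g i)
      then have "act m i (truncate m g) \<in> act m i ` B" using act_B[OF bwd(1)] act_truncate[of m i g] by simp
      then obtain h where h: "h \<in> B" "act m i (truncate m g) = act m i h" by blast
      then have "truncate m g = h" using act_inj[OF bwd(1)] bwd(2) B_sub by blast
      then show ?case using h(1) by simp
    qed
    then show False using uC by (simp add: B_def)
  qed
  have "\<exists>\<theta> r. inj_on \<theta> V \<and> incomplete_action n r {(\<theta> x, i, \<theta> y) | x i y. (x, i, y) \<in> T}"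
    by (rule incomplete_action_transport[OF finV T_V]) (fact det inj con inc)+
  then obtain \<theta> r where \<theta>: "inj_on \<theta> V" "incomplete_action n r {(\<theta> x, i, \<theta> y) | x i y. (x, i, y) \<in> T}"
    by blast
  \<comment> \<open>Since \<open>k > m\<close>, level \<open>k\<close> determines both
    \<open>truncate m w\<close> and coordinate \<open>k\<close> of \<open>w\<close>, so
    \<open>\<Phi>\<close> can be followed along paths of that level.\<close>
  obtain k where k: "k > m" "k \<ge> 5"
    "\<forall>x i y. (x, i, y) \<in> {(\<theta> x, i, \<theta> y) | x i y. (x, i, y) \<in> T} \<longrightarrow> \<tau> k i x = y"
    using solve[OF \<theta>(2), of m] by (elim exE conjE)
  define \<Phi> where "\<Phi> s w = w k (\<theta> (\<iota> s (truncate m w)))" for s and w :: "nat \<Rightarrow> nat \<Rightarrow> nat"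
  have \<Phi>_truncate: "\<Phi> s (truncate k w) = \<Phi> s w" for s w
  proof -
    have "truncate m (truncate k w) = truncate m w" unfolding truncate_eq_iff using k(1) by (auto simp: truncate_apply)
    then show ?thesis using k(2) by (simp add: \<Phi>_def truncate_apply)
  qed
  have \<Phi>_edge: "\<Phi> s (g \<otimes>\<^bsub>alt_prod\<^esub> a i) = \<Phi> s g" if "i < n" "(g, Inl (a i)) \<in> F s" for s g i
  proof -
    have "\<tau> k i (\<theta> (\<iota> s (truncate m (g \<otimes>\<^bsub>alt_prod\<^esub> a i)))) = \<theta> (\<iota> s (truncate m g))"
      using k(3) T_edge[OF that] by blast
    then show ?thesis unfolding \<Phi>_def alt_prod_mult[OF k(2)] a_apply[OF k(2)] by simp
  qed
  have \<Phi>_v: "\<Phi> s v = \<Phi> s u" for s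
  proof -
    have "(truncate k u, truncate k v) \<in> (edge_rel (cayley_level A k) (q k ` F s))\<^sup>*"
      using l[of k s] uW[of s] vW[of s] unfolding G.level_connected_def by blast
    with c[of s] have "\<Phi> s (truncate k v) = \<Phi> s (truncate k u)"
    proof (induction rule: level_path_induct)
      case (fwd g i)
      then show ?case using \<Phi>_edge[OF fwd(1,3)] unfolding \<Phi>_truncate by simp
    next
      case (bwd g i)
      then show ?case using \<Phi>_edge[OF bwd(1,3)] unfolding \<Phi>_truncate by simp
    qed simp
    then show ?thesis unfolding \<Phi>_truncate .
  qed
  have "\<iota> False (truncate m u) = \<iota> True (truncate m u)" using uC by (simp add: \<iota>_def)
  then have "\<Phi> False v = \<Phi> True v" using \<Phi>_v by (simp add: \<Phi>_def)
  moreover have "v k permutes {1..k}" using alt_prod_mem[OF uc(2) k(2)] by (simp add: alt_group_carrier)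
  ultimately have "\<theta> (\<iota> False (truncate m v)) = \<theta> (\<iota> True (truncate m v))"
    unfolding \<Phi>_def by (metis permutes_inj injD)
  moreover have "\<iota> s (truncate m v) \<in> V" for s using vW by (intro VI imageI)
  ultimately have "\<iota> False (truncate m v) = \<iota> True (truncate m v)" using \<theta>(1) by (auto dest: inj_onD)
  then show False using vC by (simp add: \<iota>_def)
qed

lemma tree_like_cayley: "tree_like \<Gamma>"
proof -
  have "connected_graph (restrict_graph \<Gamma> (verts \<Gamma>) (edges \<Gamma>))"
    using G.connected_graph_iff[OF G.whole_subgraph] level_connected_whole by blast
  then have "connected_graph \<Gamma>" by (simp only: G.restrict_whole)
  moreover have "connected_graph (restrict_graph \<Gamma> (\<Inter>(W, F)\<in>connected_subgraphs \<Gamma> u v. W)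
      (\<Inter>(W, F)\<in>connected_subgraphs \<Gamma> u v. F))" if "u \<in> verts \<Gamma>" "v \<in> verts \<Gamma>" for u v
    by (rule G.connected_intersections[OF level_connected_whole path_in_intersection that])
  ultimately show ?thesis unfolding tree_like_def using G.profinite by blast
qed

end

theorem corollary4p6:
  fixes n :: nat
  assumes "n \<ge> 2"
  shows "\<exists>A. finite A \<and> card A = n \<and> top_generates alt_prod alt_prod_top A \<and>
             tree_like (cayley_graph alt_prod alt_prod_top A)"
proof -
  obtain \<tau> where "solving_generators n \<tau>"
    using ex_solving_levels[OF assms] assms unfolding solving_generators_def by blast
  then interpret solving_generators n \<tau> .
  show ?thesis using finite_A card_A top_generates_A tree_like_cayley by blast
qed

end
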